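(* Let $s\ge0$ be given. There exists a constant $C>0$ such that for any $\phi\in H^s(\mathbb{R}^2)$, if $v_b:=W_{\mathbb{R}^2}(t)\phi\,\big|_{y=0}$, then $$\|v_b\|_{\mathcal{H}^s(\mathbb{R}^2)}\le C\,\|\phi\|_{H^s(\mathbb{R}^2)}.$$
   Context: $W_{\mathbb{R}^2}(t)$ is the $C_0$-semigroup with infinitesimal generator $i\Delta$ in $\mathbb{R}^2$, so that $v=W_{\mathbb{R}^2}(t)\phi$ solves $$i v_t+v_{xx}+v_{yy}=0,\qquad v(x,y,0)=\phi(x,y),\qquad (x,y)\in\mathbb{R}^2,\ t\in\mathbb{R},$$ and $v_b(x,t)=v(x,0,t)$ is its trace at $y=0$. With $\mathcal{F}[w](\sigma,\xi)$ the Fourier transform of $w(x,t)$ with respect to both $x$ and $t$ ($\sigma$ dual to $t$, $\xi$ dual to $x$), the space $\mathcal{H}^s(\mathbb{R}^2)$ is $$\mathcal{H}^s(\mathbb{R}^2)=\Big\{w\in L^2(\mathbb{R}^2):\ (1+|\sigma|+|\xi|^2)^{s/2}\,|\sigma+|\xi|^2|^{1/4}\,\mathcal{F}[w](\sigma,\xi)\in L^2(\mathbb{R}^2)\Big\},$$ with $$\|w\|_{\mathcal{H}^s(\mathbb{R}^2)}=\big\|(1+|\sigma|+|\xi|^2)^{s/2}\,|\sigma+|\xi|^2|^{1/4}\,\mathcal{F}[w](\sigma,\xi)\big\|_{L^2(\mathbb{R}^2)}.$$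
   Formalization: The space H^s(R^2) of the boundary trace is not required to lie in L^2: for Gaussian φ, v_b is not in L^2 (its square integral diverges logarithmically as |t|→∞), so the norm is taken of F[v_b] as a tempered distribution that is a function. *)

theory Defs
  imports "HOL-Analysis.Analysis"
begin

text \<open>Elements of \<open>L\<^sup>2\<close> are represented by Borel functions; equality in \<open>L\<^sup>2\<close> is equality
  almost everywhere.\<close>

definition L2 :: "('a::euclidean_space \<Rightarrow> complex) set" where
  "L2 = {f \<in> borel_measurable borel. integrable lborel (\<lambda>x. (norm (f x))\<^sup>2)}"

definition L2_norm :: "('a::euclidean_space \<Rightarrow> complex) \<Rightarrow> real" where
  "L2_norm f = sqrt (LINT x|lborel. (norm (f x))\<^sup>2)"

fun iter_deriv :: "'a list \<Rightarrow> ('a::euclidean_space \<Rightarrow> complex) \<Rightarrow> 'a \<Rightarrow> complex" where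
  "iter_deriv [] f = f"
| "iter_deriv (b # bs) f = (\<lambda>x. frechet_derivative (iter_deriv bs f) (at x) b)"

definition schwartz :: "('a::euclidean_space \<Rightarrow> complex) set" where
  "schwartz = {f. \<forall>bs. set bs \<subseteq> Basis \<longrightarrow>
     (\<forall>x. iter_deriv bs f differentiable (at x)) \<and>
     (\<forall>N::nat. bounded (range (\<lambda>x. (1 + norm x) ^ N *\<^sub>R iter_deriv bs f x)))}"

definition laplacian :: "('a::euclidean_space \<Rightarrow> complex) \<Rightarrow> 'a \<Rightarrow> complex" where
  "laplacian f x = (\<Sum>b\<in>Basis. iter_deriv [b, b] f x)"

text \<open>Functions that define a tempered distribution by integration.\<close>

definition tempered_fun :: "('a::euclidean_space \<Rightarrow> complex) \<Rightarrow> bool" where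
  "tempered_fun f \<longleftrightarrow> f \<in> borel_measurable borel \<and>
     (\<exists>N::nat. integrable lborel (\<lambda>x. norm (f x) / (1 + norm x) ^ N))"

definition fourier_integral :: "('a::euclidean_space \<Rightarrow> complex) \<Rightarrow> 'a \<Rightarrow> complex" where
  "fourier_integral f \<xi> =
     of_real ((2 * pi) powr (- real DIM('a) / 2)) * (LINT x|lborel. exp (- \<i> * of_real (x \<bullet> \<xi>)) * f x)"

text \<open>The Fourier transform in the sense of tempered distributions, for those \<open>f\<close> whose transform
  is again a function. By Plancherel's theorem this includes every \<open>f \<in> L\<^sup>2\<close>, and the transform is
  unique almost everywhere, so no integral over \<open>fourier f\<close> depends on the choice.\<close>

definition has_fourier :: "('a::euclidean_space \<Rightarrow> complex) \<Rightarrow> ('a \<Rightarrow> complex) \<Rightarrow> bool" where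
  "has_fourier f g \<longleftrightarrow> tempered_fun f \<and> tempered_fun g \<and>
     (\<forall>\<psi>\<in>schwartz. (LINT \<xi>|lborel. g \<xi> * \<psi> \<xi>) = (LINT x|lborel. f x * fourier_integral \<psi> x))"

definition fourier :: "('a::euclidean_space \<Rightarrow> complex) \<Rightarrow> 'a \<Rightarrow> complex" where
  "fourier f = (SOME g. has_fourier f g)"

definition sobolev_weighted :: "real \<Rightarrow> ('a::euclidean_space \<Rightarrow> complex) \<Rightarrow> 'a \<Rightarrow> complex" where
  "sobolev_weighted s f = (\<lambda>\<xi>. (1 + (norm \<xi>)\<^sup>2) powr (s / 2) *\<^sub>R fourier f \<xi>)"

text \<open>Meant for \<open>s \<ge> 0\<close>, where \<open>H\<^sup>s\<close> is a subspace of \<open>L\<^sup>2\<close>.\<close>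

definition sobolev :: "real \<Rightarrow> ('a::euclidean_space \<Rightarrow> complex) set" where
  "sobolev s = {f \<in> L2. sobolev_weighted s f \<in> L2}"

definition sobolev_norm :: "real \<Rightarrow> ('a::euclidean_space \<Rightarrow> complex) \<Rightarrow> real" where
  "sobolev_norm s f = L2_norm (sobolev_weighted s f)"

text \<open>Strongly continuous groups of bounded operators on \<open>L\<^sup>2\<close>, indexed by all real times since the
  Schroedinger flow is considered for \<open>t \<in> \<real>\<close>. Linearity and boundedness together imply that
  \<open>W t\<close> respects equality almost everywhere.\<close>

definition C0_group :: "(real \<Rightarrow> ('a::euclidean_space \<Rightarrow> complex) \<Rightarrow> 'a \<Rightarrow> complex) \<Rightarrow> bool" where
  "C0_group W \<longleftrightarrow>
     (\<forall>t. \<forall>f\<in>L2. W t f \<in> L2) \<and>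
     (\<forall>t a b. \<forall>f\<in>L2. \<forall>g\<in>L2.
        AE x in lborel. W t (\<lambda>x. a * f x + b * g x) x = a * W t f x + b * W t g x) \<and>
     (\<forall>t. \<exists>M. \<forall>f\<in>L2. L2_norm (W t f) \<le> M * L2_norm f) \<and>
     (\<forall>f\<in>L2. AE x in lborel. W 0 f x = f x) \<and>
     (\<forall>t r. \<forall>f\<in>L2. AE x in lborel. W (t + r) f x = W t (W r f) x) \<and>
     (\<forall>f\<in>L2. ((\<lambda>t. L2_norm (\<lambda>x. W t f x - f x)) \<longlongrightarrow> 0) (at 0))"

text \<open>The graph of the infinitesimal generator.\<close>

definition generator ::
  "(real \<Rightarrow> ('a::euclidean_space \<Rightarrow> complex) \<Rightarrow> 'a \<Rightarrow> complex) \<Rightarrow> (('a \<Rightarrow> complex) \<times> ('a \<Rightarrow> complex)) set" where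
  "generator W = {(f, g). f \<in> L2 \<and> g \<in> L2 \<and>
     ((\<lambda>h. L2_norm (\<lambda>x. (W h f x - f x) /\<^sub>R h - g x)) \<longlongrightarrow> 0) (at 0)}"

text \<open>The graph of \<open>\<i>\<Delta>\<close> with domain \<open>H\<^sup>2\<close>, the Laplacian being taken in the sense of
  distributions.\<close>

definition i_laplacian :: "(('a::euclidean_space \<Rightarrow> complex) \<times> ('a \<Rightarrow> complex)) set" where
  "i_laplacian = {(f, g). f \<in> sobolev 2 \<and> g \<in> L2 \<and>
     (\<forall>\<psi>\<in>schwartz. (LINT x|lborel. g x * \<psi> x) = \<i> * (LINT x|lborel. f x * laplacian \<psi> x))}"

definition schroedinger_group ::
  "(real \<Rightarrow> ('a::euclidean_space \<Rightarrow> complex) \<Rightarrow> 'a \<Rightarrow> complex) \<Rightarrow> bool" where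
  "schroedinger_group W \<longleftrightarrow> C0_group W \<and> generator W = i_laplacian"

text \<open>\<open>w(x,t)\<close> is the trace \<open>v(x,0,t)\<close>. For data that are merely in \<open>L\<^sup>2\<close> the restriction to the
  null set \<open>y = 0\<close> has no pointwise meaning; the trace is the value at \<open>y = 0\<close> of the (weakly)
  continuous representative of \<open>y \<mapsto> v(\<cdot>,y,\<cdot>)\<close>. Explicitly: for every \<open>\<psi>(x,t)\<close> the
  distribution \<open>y \<mapsto> \<integral>\<integral> v(x,y,t) \<psi>(x,t) dx dt\<close> is a continuous function of \<open>y\<close>, and its
  value at \<open>0\<close> is \<open>\<integral>\<integral> w \<psi>\<close>. The integral over \<open>t\<close> is outermost, so that the choice of
  representative of each \<open>v t \<in> L\<^sup>2\<close> is irrelevant.\<close>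

definition has_trace :: "(real \<Rightarrow> real \<times> real \<Rightarrow> complex) \<Rightarrow> (real \<times> real \<Rightarrow> complex) \<Rightarrow> bool" where
  "has_trace v w \<longleftrightarrow> tempered_fun w \<and>
     (\<forall>\<psi>\<in>schwartz. \<exists>g. continuous_on UNIV g \<and> tempered_fun g \<and>
        (\<forall>\<theta>\<in>schwartz.
           (LINT t|lborel. LINT z|lborel. v t z * \<psi> (fst z, t) * \<theta> (snd z)) =
           (LINT y|lborel. g y * \<theta> y)) \<and>
        g 0 = (LINT z|lborel. w z * \<psi> z))"

text \<open>For \<open>w(x,t)\<close> the dual variables are listed in the same order, \<open>(\<xi>,\<sigma>)\<close>.\<close>

definition boundary_weighted :: "real \<Rightarrow> (real \<times> real \<Rightarrow> complex) \<Rightarrow> real \<times> real \<Rightarrow> complex" where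
  "boundary_weighted s w = (\<lambda>(\<xi>, \<sigma>).
     ((1 + \<bar>\<sigma>\<bar> + \<bar>\<xi>\<bar>\<^sup>2) powr (s / 2) * \<bar>\<sigma> + \<bar>\<xi>\<bar>\<^sup>2\<bar> powr (1 / 4)) *\<^sub>R fourier w (\<xi>, \<sigma>))"

text \<open>Finiteness of the norm of \<open>\<H>\<^sup>s\<close>. Membership of \<open>w\<close> itself in \<open>L\<^sup>2\<close> is not included: the
  trace of the flow of a Gaussian has finite norm, but its \<open>L\<^sup>2\<close> norm diverges logarithmically as
  \<open>\<bar>t\<bar> \<rightarrow> \<infinity>\<close>.\<close>

definition boundary_norm_finite :: "real \<Rightarrow> (real \<times> real \<Rightarrow> complex) \<Rightarrow> bool" where
  "boundary_norm_finite s w \<longleftrightarrow> (\<exists>g. has_fourier w g) \<and> boundary_weighted s w \<in> L2"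

definition boundary_norm :: "real \<Rightarrow> (real \<times> real \<Rightarrow> complex) \<Rightarrow> real" where
  "boundary_norm s w = L2_norm (boundary_weighted s w)"

end

theory Submission
  imports Defs "HOL-Probability.Characteristic_Functions" "HOL-Probability.Sinc_Integral"
begin

text \<open>
  On the Fourier side the flow multiplies the transform \<open>\<Phi>(\<xi>,\<eta>)\<close> of the initial datum by
  \<open>exp (- i t (\<xi>\<^sup>2 + \<eta>\<^sup>2))\<close>. The trace at \<open>y = 0\<close> therefore has as its space-time transform the
  push-forward of \<open>\<Phi> d\<xi> d\<eta>\<close> under \<open>(\<xi>,\<eta>) \<mapsto> (\<xi>, \<sigma>)\<close> with \<open>\<sigma> = - (\<xi>\<^sup>2 + \<eta>\<^sup>2)\<close>. At fixed \<open>\<xi>\<close> one has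
  \<open>d\<eta> = d\<sigma> / (2 |\<eta>|)\<close> and \<open>|\<sigma> + \<xi>\<^sup>2| = \<eta>\<^sup>2\<close>, so the transform of the trace is
  \<open>(\<Phi>(\<xi>,\<eta>) + \<Phi>(\<xi>,-\<eta>)) / (2 \<eta>)\<close>, and in the square of the boundary norm the weight
  \<open>|\<sigma> + \<xi>\<^sup>2|\<^sup>1\<^sup>/\<^sup>2 = |\<eta>|\<close>, the two factors \<open>1 / |\<eta>|\<close> and the Jacobian \<open>|\<eta>|\<close> cancel exactly. What remains
  is \<open>1 + |\<sigma>| + \<xi>\<^sup>2 = 1 + 2 \<xi>\<^sup>2 + \<eta>\<^sup>2\<close>, at most twice the Sobolev weight \<open>1 + \<xi>\<^sup>2 + \<eta>\<^sup>2\<close>; this gives the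
  constant \<open>2\<^sup>s\<^sup>/\<^sup>2\<close> (\<open>trace_density_square\<close>, \<open>boundary_norm_estimate\<close>).

  To make this computation meaningful for distributions, the Fourier transform is first developed
  on Schwartz functions, where inversion holds (\<open>fourier_inversion\<close>); Gaussians separate tempered
  functions, so transforms are unique almost everywhere (\<open>tempered_AE_zero\<close>); and Bessel's inequality
  (\<open>fourier_integral_L2\<close>) with the completeness of \<open>L\<^sup>2\<close> extends the transform to \<open>L\<^sup>2\<close>
  (\<open>L2_has_fourier\<close>). Inversion turns Bessel's inequality into Plancherel's theorem.

  The group is only given through its generator. For data in the domain of \<open>i \<Delta>\<close> the transform of the
  orbit solves \<open>\<partial>\<^sub>t U = - i |\<zeta>|\<^sup>2 U\<close> in \<open>L\<^sup>2\<close>, which determines it (\<open>flow_on_domain\<close>); data with compactly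
  supported transform lie in the domain and are dense, so boundedness gives the multiplier formula
  in general (\<open>schroedinger_group_fourier\<close>).

  By Fubini the pairing of the flow with \<open>\<psi>(x,t) \<theta>(y)\<close> is the pairing of \<open>\<theta>\<close> with an explicit continuous
  function of \<open>y\<close>, which is thus the only candidate for the function in the definition of the trace.
  A tempered \<open>w\<close> is then a trace if and only if its pairing with \<open>\<psi>\<close> is the integral of \<open>\<Phi>\<close> against the
  transform of \<open>\<psi>\<close> on the paraboloid (\<open>has_trace_iff\<close>). This identifies the transform of every trace
  (\<open>has_fourier_trace_density\<close>). For existence, \<open>\<Phi>\<close> is cut at \<open>|\<eta>| = 1\<close>: above, the density of the
  push-forward is in \<open>L\<^sup>2\<close>; below, it becomes so after convolution in \<open>\<sigma>\<close> with an exponential,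
  and the trace is recovered with a factor that is linear in \<open>t\<close> (\<open>trace_exists_high\<close>,
  \<open>trace_exists_low\<close>).
\<close>


section \<open>Square-integrable functions\<close>

lemma L2_measurable [measurable_dest]: "f \<in> L2 \<Longrightarrow> f \<in> borel_measurable borel"
  by (simp add: L2_def)

lemma L2_integrable_sq: "f \<in> L2 \<Longrightarrow> integrable lborel (\<lambda>x. (norm (f x))\<^sup>2)"
  by (simp add: L2_def)

lemma L2_norm_nonneg [simp]: "0 \<le> L2_norm f"
  by (simp add: L2_norm_def)

lemma L2_norm_sq: "(L2_norm f)\<^sup>2 = (LINT x|lborel. (norm (f x))\<^sup>2)"
  by (simp add: L2_norm_def)

lemma L2_nn_integral:
  assumes "f \<in> L2"
  shows "(\<integral>\<^sup>+x. ennreal ((norm (f x))\<^sup>2) \<partial>lborel) = ennreal ((L2_norm f)\<^sup>2)"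
  unfolding L2_norm_sq by (rule nn_integral_eq_integral) (use assms L2_integrable_sq in auto)

lemma L2_bound_nn:
  assumes [measurable]: "f \<in> borel_measurable borel"
    and le: "(\<integral>\<^sup>+x. ennreal ((norm (f x))\<^sup>2) \<partial>lborel) \<le> ennreal (c\<^sup>2)" and "0 \<le> c"
  shows "f \<in> L2" "L2_norm f \<le> c"
proof -
  have "integrable lborel (\<lambda>x. (norm (f x))\<^sup>2)"
    by (rule integrableI_nonneg) (use le in \<open>auto simp: order_le_less_trans\<close>)
  then show "f \<in> L2" by (simp add: L2_def)
  from L2_nn_integral[OF this] le have "(L2_norm f)\<^sup>2 \<le> c\<^sup>2"
    by (simp add: ennreal_le_iff)
  then show "L2_norm f \<le> c"
    using \<open>0 \<le> c\<close> by (rule power2_le_imp_le)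
qed

lemma L2_norm_mono:
  assumes "g \<in> L2" and [measurable]: "f \<in> borel_measurable borel"
    and le: "AE x in lborel. norm (f x) \<le> c * norm (g x)" and "0 \<le> c"
  shows "f \<in> L2" "L2_norm f \<le> c * L2_norm g"
proof -
  have "(\<integral>\<^sup>+x. ennreal ((norm (f x))\<^sup>2) \<partial>lborel) \<le> (\<integral>\<^sup>+x. ennreal (c\<^sup>2) * ennreal ((norm (g x))\<^sup>2) \<partial>lborel)"
    by (intro nn_integral_mono_AE)
      (use le in \<open>auto simp: ennreal_mult[symmetric] power_mult_distrib[symmetric] intro!: power_mono\<close>)
  also have "\<dots> = ennreal ((c * L2_norm g)\<^sup>2)"
    using L2_measurable[OF \<open>g \<in> L2\<close>]
    by (subst nn_integral_cmult) (auto simp: L2_nn_integral[OF \<open>g \<in> L2\<close>] ennreal_mult[symmetric] power_mult_distrib)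
  finally show "f \<in> L2" "L2_norm f \<le> c * L2_norm g"
    using L2_bound_nn[of f "c * L2_norm g"] \<open>0 \<le> c\<close> by auto
qed

lemma L2_cong_AE:
  assumes "f \<in> L2" "g \<in> borel_measurable borel" "AE x in lborel. f x = g x"
  shows "g \<in> L2" "L2_norm f = L2_norm g"
proof -
  have [measurable]: "f \<in> borel_measurable borel" "g \<in> borel_measurable borel"
    using assms by (auto simp: L2_def)
  have ae: "AE x in lborel. (norm (f x))\<^sup>2 = (norm (g x))\<^sup>2"
    using assms(3) by auto
  show "g \<in> L2"
  proof (rule L2_norm_mono(1)[OF assms(1,2)])
    show "AE x in lborel. norm (g x) \<le> 1 * norm (f x)"
      using assms(3) by eventually_elim simp
  qed simp
  show "L2_norm f = L2_norm g"
    unfolding L2_norm_def by (subst integral_cong_AE[OF _ _ ae]) auto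
qed

lemma L2_scale:
  assumes "f \<in> L2"
  shows "(\<lambda>x. c * f x) \<in> L2" "L2_norm (\<lambda>x. c * f x) = norm c * L2_norm f"
proof -
  note L2_measurable[OF assms, measurable]
  show "(\<lambda>x. c * f x) \<in> L2"
    by (rule L2_norm_mono(1)[OF assms, where c = "norm c"]) (auto simp: norm_mult)
  show "L2_norm (\<lambda>x. c * f x) = norm c * L2_norm f"
    unfolding L2_norm_def by (simp add: norm_mult power_mult_distrib real_sqrt_mult)
qed

lemma L2_add_mem:
  assumes "f \<in> L2" "g \<in> L2"
  shows "(\<lambda>x. f x + g x) \<in> L2"
proof -
  note [measurable] = L2_measurable[OF assms(1)] L2_measurable[OF assms(2)]
  have "integrable lborel (\<lambda>x. 2 * (norm (f x))\<^sup>2 + 2 * (norm (g x))\<^sup>2)"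
    using L2_integrable_sq[OF assms(1)] L2_integrable_sq[OF assms(2)] by auto
  then have "integrable lborel (\<lambda>x. (norm (f x + g x))\<^sup>2)"
  proof (rule Bochner_Integration.integrable_bound)
    show "AE x in lborel. norm ((norm (f x + g x))\<^sup>2) \<le> norm (2 * (norm (f x))\<^sup>2 + 2 * (norm (g x))\<^sup>2)"
    proof (rule AE_I2)
      fix x
      have "(norm (f x + g x))\<^sup>2 \<le> (norm (f x) + norm (g x))\<^sup>2"
        by (intro power_mono norm_triangle_ineq) auto
      also have "\<dots> \<le> 2 * (norm (f x))\<^sup>2 + 2 * (norm (g x))\<^sup>2"
        using sum_squares_bound[of "norm (f x)" "norm (g x)"] by (simp add: power2_sum)
      finally show "norm ((norm (f x + g x))\<^sup>2) \<le> norm (2 * (norm (f x))\<^sup>2 + 2 * (norm (g x))\<^sup>2)"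
        by simp
    qed
  qed simp
  then show ?thesis by (simp add: L2_def)
qed

lemma L2_diff_mem: "f \<in> L2 \<Longrightarrow> g \<in> L2 \<Longrightarrow> (\<lambda>x. f x - g x) \<in> L2"
  using L2_add_mem[of f "\<lambda>x. (-1) * g x"] L2_scale[of g "-1"] by simp

lemma L2_Cauchy_Schwarz:
  assumes "f \<in> L2" "g \<in> L2"
  shows "integrable lborel (\<lambda>x. f x * g x)"
    and "(LINT x|lborel. norm (f x) * norm (g x)) \<le> L2_norm f * L2_norm g"
    and "norm (LINT x|lborel. f x * g x) \<le> L2_norm f * L2_norm g"
proof -
  note [measurable] = L2_measurable[OF assms(1)] L2_measurable[OF assms(2)]
  have "integrable lborel (\<lambda>x. (norm (f x))\<^sup>2 + (norm (g x))\<^sup>2)"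
    using L2_integrable_sq[OF assms(1)] L2_integrable_sq[OF assms(2)] by auto
  then have int: "integrable lborel (\<lambda>x. norm (f x) * norm (g x))"
  proof (rule Bochner_Integration.integrable_bound)
    show "AE x in lborel. norm (norm (f x) * norm (g x)) \<le> norm ((norm (f x))\<^sup>2 + (norm (g x))\<^sup>2)"
    proof (rule AE_I2)
      fix x
      have "0 \<le> (norm (f x))\<^sup>2 + (norm (g x))\<^sup>2" "0 \<le> norm (f x) * norm (g x)" by auto
      then show "norm (norm (f x) * norm (g x)) \<le> norm ((norm (f x))\<^sup>2 + (norm (g x))\<^sup>2)"
        using sum_squares_bound[of "norm (f x)" "norm (g x)"] unfolding real_norm_def by linarith
    qed
  qed simp
  then have "integrable lborel (\<lambda>x. norm (f x * g x))" by (simp add: norm_mult)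
  then show "integrable lborel (\<lambda>x. f x * g x)"
    by (subst (asm) integrable_norm_iff) auto
  have "(\<integral>\<^sup>+x. ennreal (norm (f x)) * ennreal (norm (g x)) \<partial>lborel)\<^sup>2
      \<le> (\<integral>\<^sup>+x. (ennreal (norm (f x)))\<^sup>2 \<partial>lborel) * (\<integral>\<^sup>+x. (ennreal (norm (g x)))\<^sup>2 \<partial>lborel)"
    by (rule Cauchy_Schwarz_nn_integral) auto
  also have "\<dots> = ennreal ((L2_norm f)\<^sup>2) * ennreal ((L2_norm g)\<^sup>2)"
    by (simp add: ennreal_power L2_nn_integral assms)
  also have "(\<integral>\<^sup>+x. ennreal (norm (f x)) * ennreal (norm (g x)) \<partial>lborel)
      = ennreal (LINT x|lborel. norm (f x) * norm (g x))"
    by (subst nn_integral_eq_integral[OF int, symmetric]) (auto simp: ennreal_mult)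
  finally have "(LINT x|lborel. norm (f x) * norm (g x))\<^sup>2 \<le> (L2_norm f * L2_norm g)\<^sup>2"
    by (simp add: ennreal_power ennreal_mult[symmetric] power_mult_distrib)
  then show le: "(LINT x|lborel. norm (f x) * norm (g x)) \<le> L2_norm f * L2_norm g"
    by (rule power2_le_imp_le) auto
  have "norm (LINT x|lborel. f x * g x) \<le> (LINT x|lborel. norm (f x * g x))"
    by (rule integral_norm_bound)
  with le show "norm (LINT x|lborel. f x * g x) \<le> L2_norm f * L2_norm g"
    by (simp add: norm_mult)
qed

lemma L2_triangle:
  assumes "f \<in> L2" "g \<in> L2"
  shows "L2_norm (\<lambda>x. f x + g x) \<le> L2_norm f + L2_norm g"
proof -
  note [measurable] = L2_measurable[OF assms(1)] L2_measurable[OF assms(2)]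
  have int: "integrable lborel (\<lambda>x. norm (f x) * norm (g x))"
    using integrable_norm[OF L2_Cauchy_Schwarz(1)[OF assms]] by (simp add: norm_mult)
  note sq = L2_integrable_sq[OF assms(1)] L2_integrable_sq[OF assms(2)]
  have "(L2_norm (\<lambda>x. f x + g x))\<^sup>2 \<le> (LINT x|lborel. (norm (f x))\<^sup>2 + (norm (g x))\<^sup>2 + 2 * (norm (f x) * norm (g x)))"
    unfolding L2_norm_sq
  proof (rule integral_mono)
    show "integrable lborel (\<lambda>x. (norm (f x + g x))\<^sup>2)"
      by (rule L2_integrable_sq[OF L2_add_mem[OF assms]])
    show "integrable lborel (\<lambda>x. (norm (f x))\<^sup>2 + (norm (g x))\<^sup>2 + 2 * (norm (f x) * norm (g x)))"
      using sq int by auto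
    fix x
    have "(norm (f x + g x))\<^sup>2 \<le> (norm (f x) + norm (g x))\<^sup>2"
      by (intro power_mono norm_triangle_ineq) auto
    then show "(norm (f x + g x))\<^sup>2 \<le> (norm (f x))\<^sup>2 + (norm (g x))\<^sup>2 + 2 * (norm (f x) * norm (g x))"
      by (simp add: power2_sum)
  qed
  also have "\<dots> = (L2_norm f)\<^sup>2 + (L2_norm g)\<^sup>2 + 2 * (LINT x|lborel. norm (f x) * norm (g x))"
    using sq int by (simp add: L2_norm_sq)
  also have "\<dots> \<le> (L2_norm f + L2_norm g)\<^sup>2"
    using L2_Cauchy_Schwarz(2)[OF assms] by (simp add: power2_sum)
  finally show ?thesis
    by (rule power2_le_imp_le) auto
qed

lemma L2_norm_minus_commute: "L2_norm (\<lambda>x. f x - g x) = L2_norm (\<lambda>x. g x - f x)"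
  unfolding L2_norm_def by (simp add: norm_minus_commute)

lemma L2_triangle_diff:
  assumes "f \<in> L2" "g \<in> L2" "h \<in> L2"
  shows "L2_norm (\<lambda>x. f x - h x) \<le> L2_norm (\<lambda>x. f x - g x) + L2_norm (\<lambda>x. g x - h x)"
  using L2_triangle[OF L2_diff_mem[OF assms(1,2)] L2_diff_mem[OF assms(2,3)]] by simp

lemma L2_norm_eq_0:
  assumes "f \<in> L2" "L2_norm f = 0"
  shows "AE x in lborel. f x = 0"
proof -
  have "(LINT x|lborel. (norm (f x))\<^sup>2) = 0"
    using assms(2) L2_norm_sq[of f] by simp
  then show ?thesis
    using integral_nonneg_eq_0_iff_AE[OF L2_integrable_sq[OF assms(1)]] by auto
qed

lemma L2_zero [simp]: "(\<lambda>x. 0) \<in> L2" "L2_norm (\<lambda>x. 0) = 0"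
  by (auto simp: L2_def L2_norm_def)

lemma L2_indicator:
  assumes "f \<in> L2" "A \<in> sets borel"
  shows "(\<lambda>x. indicator A x * f x) \<in> L2" "L2_norm (\<lambda>x. indicator A x * f x) \<le> L2_norm f"
proof -
  note [measurable] = L2_measurable[OF assms(1)] assms(2)
  show "(\<lambda>x. indicator A x * f x) \<in> L2" "L2_norm (\<lambda>x. indicator A x * f x) \<le> L2_norm f"
    using L2_norm_mono[OF assms(1), of "\<lambda>x. indicator A x * f x" 1]
    by (auto simp: indicator_def)
qed


lemma L2_Fatou:
  assumes Y: "\<And>n. Y n \<in> L2" and [measurable]: "f \<in> borel_measurable borel"
    and lim: "AE x in lborel. (\<lambda>n. Y n x) \<longlonglongrightarrow> f x"
    and le: "eventually (\<lambda>n. L2_norm (Y n) \<le> c) sequentially" and "0 \<le> c"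
  shows "f \<in> L2" "L2_norm f \<le> c"
proof -
  have [measurable]: "Y n \<in> borel_measurable borel" for n
    using Y by (rule L2_measurable)
  have "(\<integral>\<^sup>+x. ennreal ((norm (f x))\<^sup>2) \<partial>lborel) = (\<integral>\<^sup>+x. liminf (\<lambda>n. ennreal ((norm (Y n x))\<^sup>2)) \<partial>lborel)"
  proof (rule nn_integral_cong_AE)
    show "AE x in lborel. ennreal ((norm (f x))\<^sup>2) = liminf (\<lambda>n. ennreal ((norm (Y n x))\<^sup>2))"
      using lim
    proof eventually_elim
      case (elim x)
      then have "(\<lambda>n. ennreal ((norm (Y n x))\<^sup>2)) \<longlonglongrightarrow> ennreal ((norm (f x))\<^sup>2)"
        by (intro tendsto_intros)
      then show ?case
        by (intro lim_imp_Liminf[symmetric]) auto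
    qed
  qed
  also have "\<dots> \<le> liminf (\<lambda>n. \<integral>\<^sup>+x. ennreal ((norm (Y n x))\<^sup>2) \<partial>lborel)"
    by (rule nn_integral_liminf) simp
  also have "\<dots> = liminf (\<lambda>n. ennreal ((L2_norm (Y n))\<^sup>2))"
    by (simp add: L2_nn_integral[OF Y])
  also have "\<dots> \<le> ennreal (c\<^sup>2)"
    using le by (intro Liminf_le) (auto elim!: eventually_mono intro!: ennreal_leI power_mono)
  finally show "f \<in> L2" "L2_norm f \<le> c"
    using L2_bound_nn[of f c] \<open>0 \<le> c\<close> by auto
qed

lemma L2_norm_of_real_sum:
  fixes f :: "nat \<Rightarrow> 'a::euclidean_space \<Rightarrow> complex"
  assumes "\<And>n. f n \<in> L2"
  shows "(\<lambda>x. complex_of_real (\<Sum>n<m. norm (f n x))) \<in> L2 \<and>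
    L2_norm (\<lambda>x. complex_of_real (\<Sum>n<m. norm (f n x))) \<le> (\<Sum>n<m. L2_norm (f n))"
proof (induction m)
  case (Suc m)
  note [measurable] = L2_measurable[OF assms]
  have n: "(\<lambda>x. complex_of_real (norm (f m x))) \<in> L2"
    by (rule L2_norm_mono(1)[OF assms[of m], of _ 1]) auto
  have ne: "L2_norm (\<lambda>x. complex_of_real (norm (f m x))) = L2_norm (f m)"
    by (simp add: L2_norm_def)
  show ?case
    using L2_add_mem[OF conjunct1[OF Suc.IH] n] L2_triangle[OF conjunct1[OF Suc.IH] n] Suc.IH
    by (simp add: ne)
qed auto

text \<open>The theorem of Riesz and Fischer: along a subsequence with summable increments the partial
  sums of the increments stay bounded in \<open>L\<^sup>2\<close>, so the subsequence converges almost everywhere.\<close>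

theorem L2_complete:
  fixes X :: "nat \<Rightarrow> 'a::euclidean_space \<Rightarrow> complex"
  assumes X: "\<And>n. X n \<in> L2"
    and Cauchy: "\<And>e. e > 0 \<Longrightarrow> \<exists>N. \<forall>m\<ge>N. \<forall>n\<ge>N. L2_norm (\<lambda>x. X m x - X n x) < e"
  obtains f where "f \<in> L2" "(\<lambda>n. L2_norm (\<lambda>x. X n x - f x)) \<longlonglongrightarrow> 0"
proof -
  have "\<forall>n. \<exists>N. \<forall>p\<ge>N. \<forall>q\<ge>N. L2_norm (\<lambda>x. X p x - X q x) < (1/2)^n"
    using Cauchy by simp
  then obtain N where N: "\<And>n p q. p \<ge> N n \<Longrightarrow> q \<ge> N n \<Longrightarrow> L2_norm (\<lambda>x. X p x - X q x) < (1/2)^n"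
    by metis
  \<comment> \<open>The first summand makes \<open>k n \<ge> n\<close>, the sum makes \<open>k\<close> increasing with \<open>k n \<ge> N n\<close>.\<close>
  define k where "k n = n + (\<Sum>i\<le>n. N i)" for n
  have kN: "N n \<le> k n" for n
    unfolding k_def by (rule trans_le_add2, rule member_le_sum) auto
  have kSuc: "k n \<le> k (Suc n)" for n unfolding k_def by simp
  have kn: "n \<le> k n" for n unfolding k_def by simp
  define D where "D n x = X (k (Suc n)) x - X (k n) x" for n x
  note [measurable] = L2_measurable[OF X]
  have D: "D n \<in> L2" for n unfolding D_def by (rule L2_diff_mem[OF X X])
  note [measurable] = L2_measurable[OF D]
  have Dle: "L2_norm (D n) \<le> (1/2)^n" for n
    using N[OF order_trans[OF kN kSuc] kN, of n] unfolding D_def by simp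
  define S where "S m x = (\<Sum>n<m. norm (D n x))" for m x
  have [measurable]: "S m \<in> borel_measurable borel" for m
    unfolding S_def by measurable
  have S: "(\<lambda>x. complex_of_real (S m x)) \<in> L2" for m
    unfolding S_def using L2_norm_of_real_sum[of D, OF D] by blast
  have S2: "L2_norm (\<lambda>x. complex_of_real (S m x)) \<le> 2" for m
  proof -
    have "L2_norm (\<lambda>x. complex_of_real (S m x)) \<le> (\<Sum>n<m. L2_norm (D n))"
      unfolding S_def using L2_norm_of_real_sum[of D, OF D] by blast
    also have "\<dots> \<le> (\<Sum>n<m. (1/2)^n)" by (intro sum_mono Dle)
    also have "\<dots> \<le> (\<Sum>n. (1/2)^n)" by (intro sum_le_suminf) auto
    also have "\<dots> = 2" by (simp add: suminf_geometric)
    finally show ?thesis .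
  qed
  have Smono: "S m x \<le> S (Suc m) x" "0 \<le> S m x" for m x
    unfolding S_def by (auto intro: sum_nonneg)
  have "(\<integral>\<^sup>+x. (SUP m. ennreal ((S m x)\<^sup>2)) \<partial>lborel) = (SUP m. \<integral>\<^sup>+x. ennreal ((S m x)\<^sup>2) \<partial>lborel)"
    by (rule nn_integral_monotone_convergence_SUP)
      (auto simp: incseq_Suc_iff le_fun_def intro!: ennreal_leI power_mono Smono)
  also have "\<dots> \<le> ennreal (2\<^sup>2)"
  proof (rule SUP_least)
    fix m
    have "(\<integral>\<^sup>+x. ennreal ((S m x)\<^sup>2) \<partial>lborel) = ennreal ((L2_norm (\<lambda>x. complex_of_real (S m x)))\<^sup>2)"
      using L2_nn_integral[OF S[of m]] by simp
    also have "\<dots> \<le> ennreal (2\<^sup>2)" by (intro ennreal_leI power_mono S2) auto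
    finally show "(\<integral>\<^sup>+x. ennreal ((S m x)\<^sup>2) \<partial>lborel) \<le> ennreal (2\<^sup>2)" .
  qed
  finally have "AE x in lborel. (SUP m. ennreal ((S m x)\<^sup>2)) \<noteq> \<infinity>"
    by (intro nn_integral_noteq_infinite) (auto simp: top_unique)
  then have conv: "AE x in lborel. convergent (\<lambda>n. X (k n) x)"
  proof eventually_elim
    case (elim x)
    obtain c where c: "0 \<le> c" "(SUP m. ennreal ((S m x)\<^sup>2)) = ennreal c"
      using elim by (cases "SUP m. ennreal ((S m x)\<^sup>2)") auto
    have "S m x \<le> sqrt c" for m
    proof -
      have "ennreal ((S m x)\<^sup>2) \<le> ennreal c" unfolding c(2)[symmetric] by (rule SUP_upper) simp
      then have "(S m x)\<^sup>2 \<le> c" using c(1) by (simp add: ennreal_le_iff)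
      then show ?thesis by (rule real_le_rsqrt)
    qed
    then have "(\<Sum>k\<le>n. norm (D k x)) \<le> sqrt c" for n
      unfolding S_def lessThan_Suc_atMost[symmetric] by blast
    then have "summable (\<lambda>n. norm (D n x))"
      by (intro bounded_imp_summable[of _ "sqrt c"]) auto
    then have "summable (\<lambda>n. D n x)" by (rule summable_norm_cancel)
    then have "convergent (\<lambda>n. (\<Sum>i<n. D i x) + X (k 0) x)"
      by (intro convergent_add convergent_const) (simp add: summable_iff_convergent)
    moreover have "(\<Sum>i<n. D i x) + X (k 0) x = X (k n) x" for n
      unfolding D_def by (simp add: sum_lessThan_telescope[of "\<lambda>n. X (k n) x"])
    ultimately show ?case by simp
  qed
  define f where "f x = lim (\<lambda>n. X (k n) x)" for x
  have [measurable]: "f \<in> borel_measurable borel"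
    unfolding f_def by measurable
  have lim: "AE x in lborel. (\<lambda>n. X (k n) x) \<longlonglongrightarrow> f x"
    using conv by eventually_elim (simp add: f_def convergent_LIMSEQ_iff)
  have est: "(\<lambda>x. X m x - f x) \<in> L2 \<and> L2_norm (\<lambda>x. X m x - f x) \<le> e"
    if "e > 0" and M: "\<forall>m\<ge>M. \<forall>n\<ge>M. L2_norm (\<lambda>x. X m x - X n x) < e" and "m \<ge> M" for e M m
  proof -
    have ev: "eventually (\<lambda>n. L2_norm (\<lambda>x. X m x - X (k n) x) \<le> e) sequentially"
      using eventually_ge_at_top[of M]
    proof eventually_elim
      case (elim n)
      then have "M \<le> k n" using kn[of n] by linarith
      with M \<open>m \<ge> M\<close> show ?case by (simp add: less_imp_le)
    qed
    have "AE x in lborel. (\<lambda>n. X m x - X (k n) x) \<longlonglongrightarrow> X m x - f x"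
      using lim by eventually_elim (intro tendsto_intros)
    from L2_Fatou[OF L2_diff_mem[OF X X] _ this ev] \<open>e > 0\<close> show ?thesis by auto
  qed
  have f: "f \<in> L2"
  proof -
    obtain M where "\<forall>m\<ge>M. \<forall>n\<ge>M. L2_norm (\<lambda>x. X m x - X n x) < 1"
      using Cauchy[of 1] by auto
    from est[OF _ this order_refl] have "(\<lambda>x. X M x - f x) \<in> L2" by simp
    from L2_diff_mem[OF X[of M] this] show ?thesis by simp
  qed
  have "(\<lambda>n. L2_norm (\<lambda>x. X n x - f x)) \<longlonglongrightarrow> 0"
  proof (rule LIMSEQ_I)
    fix e :: real assume "e > 0"
    then obtain M where "\<forall>m\<ge>M. \<forall>n\<ge>M. L2_norm (\<lambda>x. X m x - X n x) < e/2"
      using Cauchy[of "e/2"] by auto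
    then show "\<exists>M. \<forall>n\<ge>M. norm (L2_norm (\<lambda>x. X n x - f x) - 0) < e"
      using est[of "e/2" M] \<open>e > 0\<close> by (intro exI[of _ M]) fastforce
  qed
  with f that show ?thesis by blast
qed

section \<open>Polynomial weights\<close>

lemma one_plus_norm_power_pos: "0 < (1 + norm x) ^ N"
  by (intro zero_less_power) (simp add: add_pos_nonneg)

lemma integrable_Cauchy_density: "integrable lborel (\<lambda>x::real. 1 / (1 + x\<^sup>2))"
  using integrable_inverse_1_plus_square
  by (simp add: set_integrable_def einterval_def field_simps)

lemma prod_one_plus_le:
  fixes x :: "'a::euclidean_space"
  shows "(\<Prod>b\<in>Basis. 1 + (x \<bullet> b)\<^sup>2) \<le> (1 + norm x) ^ (2 * DIM('a))"
proof -
  have "1 + (x \<bullet> b)\<^sup>2 \<le> (1 + norm x)\<^sup>2" if "b \<in> Basis" for b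
  proof -
    have "(x \<bullet> b)\<^sup>2 \<le> (norm x)\<^sup>2"
      using Basis_le_norm[OF that, of x] by (simp add: abs_le_square_iff[symmetric])
    then have "(x \<bullet> b)\<^sup>2 \<le> (norm x)\<^sup>2 + 2 * norm x"
      using norm_ge_zero[of x] by linarith
    then show ?thesis by (simp add: power2_sum)
  qed
  then have "(\<Prod>b\<in>Basis. 1 + (x \<bullet> b)\<^sup>2) \<le> (\<Prod>b\<in>(Basis::'a set). (1 + norm x)\<^sup>2)"
    by (intro prod_mono) auto
  then show ?thesis by (simp add: power_mult)
qed

text \<open>Comparison with a product of one-dimensional Cauchy densities, one factor \<open>1 + (x \<bullet> b)\<^sup>2\<close> for
  each coordinate; this is where twice the dimension comes from.\<close>

lemma integrable_weight:
  assumes "2 * DIM('a) \<le> N"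
  shows "integrable lborel (\<lambda>x::'a::euclidean_space. 1 / (1 + norm x) ^ N)"
proof (rule integrableI_nonneg)
  have "(\<integral>\<^sup>+x. ennreal (1 / (1 + norm (x::'a)) ^ N) \<partial>lborel)
      \<le> (\<integral>\<^sup>+x. (\<Prod>b\<in>(Basis::'a set). ennreal (1 / (1 + (x \<bullet> b)\<^sup>2))) \<partial>lborel)"
  proof (rule nn_integral_mono)
    fix x :: 'a
    have "(\<Prod>b\<in>Basis. 1 + (x \<bullet> b)\<^sup>2) \<le> (1 + norm x) ^ N"
      using prod_one_plus_le[of x] power_increasing[OF assms, of "1 + norm x"] by simp
    moreover have "0 < (\<Prod>b\<in>Basis. 1 + (x \<bullet> b)\<^sup>2)" by (intro prod_pos) (auto simp: add_pos_nonneg)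
    ultimately have "1 / (1 + norm x) ^ N \<le> 1 / (\<Prod>b\<in>Basis. 1 + (x \<bullet> b)\<^sup>2)"
      by (intro divide_left_mono) auto
    then show "ennreal (1 / (1 + norm x) ^ N) \<le> (\<Prod>b\<in>Basis. ennreal (1 / (1 + (x \<bullet> b)\<^sup>2)))"
      by (simp add: prod_ennreal prod_dividef ennreal_leI)
  qed
  also have "\<dots> = (\<Prod>b\<in>(Basis::'a set). (\<integral>\<^sup>+x. ennreal (1 / (1 + x\<^sup>2)) \<partial>lborel))"
    by (rule nn_integral_lborel_prod) auto
  also have "\<dots> < \<infinity>"
    using integrable_Cauchy_density
    by (simp add: integrable_iff_bounded power_less_top_ennreal)
  finally show "(\<integral>\<^sup>+x. ennreal (1 / (1 + norm (x::'a)) ^ N) \<partial>lborel) < \<infinity>" .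
qed auto

lemma L2_weight:
  assumes "DIM('a) \<le> N"
  shows "(\<lambda>x::'a::euclidean_space. complex_of_real (1 / (1 + norm x) ^ N)) \<in> L2"
  using integrable_weight[where 'a='a, of "2 * N"] assms
  by (simp only: L2_def norm_of_real mem_Collect_eq)
    (simp add: power_divide power_mult[symmetric] mult.commute)

lemma tempered_measurable [measurable_dest]: "tempered_fun f \<Longrightarrow> f \<in> borel_measurable borel"
  by (simp add: tempered_fun_def)

lemma tempered_mult:
  fixes f h :: "'a::euclidean_space \<Rightarrow> complex"
  assumes f: "tempered_fun f" and [measurable]: "h \<in> borel_measurable borel"
    and h: "\<And>x. norm (h x) \<le> C * (1 + norm x) ^ k"
  shows "tempered_fun (\<lambda>x. h x * f x)"
proof -
  note [measurable] = tempered_measurable[OF f]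
  obtain N where N: "integrable lborel (\<lambda>x. norm (f x) / (1 + norm x) ^ N)"
    using f by (auto simp: tempered_fun_def)
  have "integrable lborel (\<lambda>x. norm (h x * f x) / (1 + norm x) ^ (N + k))"
  proof (rule Bochner_Integration.integrable_bound)
    show "integrable lborel (\<lambda>x. C * (norm (f x) / (1 + norm x) ^ N))"
      using N by (rule integrable_mult_right)
    show "AE x in lborel. norm (norm (h x * f x) / (1 + norm x) ^ (N + k)) \<le> norm (C * (norm (f x) / (1 + norm x) ^ N))"
    proof (rule AE_I2)
      fix x :: 'a
      have p: "0 < 1 + norm x" by (simp add: add_pos_nonneg)
      have "0 \<le> C * (1 + norm x) ^ k" using h[of x] norm_ge_zero order_trans by blast
      then have C: "0 \<le> C" using zero_less_power[OF p, of k] by (simp add: zero_le_mult_iff)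
      have "norm (h x * f x) / (1 + norm x) ^ (N + k) \<le> C * (1 + norm x) ^ k * norm (f x) / (1 + norm x) ^ (N + k)"
        using h[of x] by (intro divide_right_mono) (auto simp: norm_mult intro!: mult_right_mono)
      also have "\<dots> = C * (norm (f x) / (1 + norm x) ^ N)"
        using p by (simp add: power_add)
      finally show "norm (norm (h x * f x) / (1 + norm x) ^ (N + k)) \<le> norm (C * (norm (f x) / (1 + norm x) ^ N))"
        using C by simp
    qed
  qed simp
  then show ?thesis
    unfolding tempered_fun_def by (auto intro!: exI[of _ "N + k"])
qed

text \<open>The power \<open>DIM\<close> of the weight is square integrable, so the Cauchy-Schwarz inequality applies.\<close>

lemma L2_imp_tempered:
  fixes f :: "'a::euclidean_space \<Rightarrow> complex"
  assumes "f \<in> L2"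
  shows "tempered_fun f"
proof -
  note [measurable] = L2_measurable[OF assms]
  have "integrable lborel (\<lambda>x. norm (f x * complex_of_real (1 / (1 + norm x) ^ DIM('a))))"
    by (intro integrable_norm L2_Cauchy_Schwarz[OF assms L2_weight]) simp
  then have "integrable lborel (\<lambda>x. norm (f x) / (1 + norm x) ^ DIM('a))"
    unfolding norm_mult norm_of_real by simp
  then show ?thesis
    unfolding tempered_fun_def by auto
qed

text \<open>The only property of test functions that enters absolute convergence of the pairings.\<close>

definition rapid :: "('a::euclidean_space \<Rightarrow> complex) \<Rightarrow> bool" where
  "rapid f \<longleftrightarrow> (\<forall>N. \<exists>C. \<forall>x. norm (f x) \<le> C / (1 + norm x) ^ N)"

lemma rapidE:
  assumes "rapid f"
  obtains C where "0 \<le> C" "\<And>x. norm (f x) \<le> C / (1 + norm x) ^ N"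
proof -
  obtain C where C: "\<And>x. norm (f x) \<le> C / (1 + norm x) ^ N"
    using assms unfolding rapid_def by blast
  have "0 \<le> norm (f 0)" by simp
  also have "\<dots> \<le> C" using C[of 0] by simp
  finally show ?thesis using C that by blast
qed

lemma rapid_tempered_integrable:
  assumes f: "tempered_fun f" and [measurable]: "\<psi> \<in> borel_measurable borel" and "rapid \<psi>"
  shows "integrable lborel (\<lambda>x. f x * \<psi> x)"
proof -
  note [measurable] = tempered_measurable[OF f]
  obtain N where N: "integrable lborel (\<lambda>x. norm (f x) / (1 + norm x) ^ N)"
    using f by (auto simp: tempered_fun_def)
  obtain C where C: "0 \<le> C" "\<And>x. norm (\<psi> x) \<le> C / (1 + norm x) ^ N"
    using \<open>rapid \<psi>\<close> rapidE by blast
  have "integrable lborel (\<lambda>x. C * (norm (f x) / (1 + norm x) ^ N))"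
    using N by (rule integrable_mult_right)
  then show ?thesis
  proof (rule Bochner_Integration.integrable_bound)
    show "AE x in lborel. norm (f x * \<psi> x) \<le> norm (C * (norm (f x) / (1 + norm x) ^ N))"
    proof (rule AE_I2)
      fix x
      have "norm (f x * \<psi> x) \<le> norm (f x) * (C / (1 + norm x) ^ N)"
        unfolding norm_mult using C(2) by (rule mult_left_mono) simp
      then show "norm (f x * \<psi> x) \<le> norm (C * (norm (f x) / (1 + norm x) ^ N))"
        using C(1) by (simp add: mult.commute)
    qed
  qed simp
qed

lemma rapid_L2:
  fixes f :: "'a::euclidean_space \<Rightarrow> complex"
  assumes [measurable]: "f \<in> borel_measurable borel" and "rapid f"
  shows "f \<in> L2"
proof -
  obtain C where C: "0 \<le> C" "\<And>x. norm (f x) \<le> C / (1 + norm x) ^ DIM('a)"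
    using \<open>rapid f\<close> rapidE by blast
  show ?thesis
  proof (rule L2_norm_mono(1)[OF L2_weight[OF order_refl], of _ C])
    show "AE x in lborel. norm (f x) \<le> C * norm (complex_of_real (1 / (1 + norm x) ^ DIM('a)))"
      unfolding norm_of_real using C(2) by simp
  qed (use C in auto)
qed

lemma bounded_imp_tempered:
  fixes f :: "'a::euclidean_space \<Rightarrow> complex"
  assumes [measurable]: "f \<in> borel_measurable borel" and "\<And>x. norm (f x) \<le> C"
  shows "tempered_fun f"
proof -
  have "integrable lborel (\<lambda>x. C * (1 / (1 + norm (x::'a)) ^ (2 * DIM('a))))"
    by (intro integrable_mult_right integrable_weight) simp
  then have "integrable lborel (\<lambda>x. norm (f x) / (1 + norm x) ^ (2 * DIM('a)))"
    by (rule Bochner_Integration.integrable_bound)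
      (auto intro!: divide_right_mono order_trans[OF assms(2)])
  then show ?thesis unfolding tempered_fun_def by auto
qed

lemma rapid_integrable:
  assumes "f \<in> borel_measurable borel" "rapid f"
  shows "integrable lborel f"
  using rapid_tempered_integrable[OF bounded_imp_tempered[of "\<lambda>_. 1" 1] assms] by simp

section \<open>Schwartz functions\<close>

text \<open>The directional derivative; along a basis vector it is one step of \<open>iter_deriv\<close>.\<close>

definition pd :: "'a \<Rightarrow> ('a::euclidean_space \<Rightarrow> complex) \<Rightarrow> 'a \<Rightarrow> complex" where
  "pd b f x = frechet_derivative f (at x) b"

lemma pd_eq: "(f has_derivative f') (at x) \<Longrightarrow> pd b f x = f' b"
  by (simp add: pd_def frechet_derivative_at[symmetric])

lemma pd_has_derivative: "f differentiable (at x) \<Longrightarrow> (f has_derivative (\<lambda>h. pd h f x)) (at x)"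
  using frechet_derivative_works[of f "at x"] by (simp add: pd_def[abs_def])

lemma iter_deriv_append: "iter_deriv (bs @ cs) f = iter_deriv bs (iter_deriv cs f)"
  by (induction bs) auto

lemma schwartz_differentiable: "f \<in> schwartz \<Longrightarrow> f differentiable (at x)"
  unfolding schwartz_def by (auto dest: spec[of _ "[]"])

lemma schwartz_has_derivative: "f \<in> schwartz \<Longrightarrow> (f has_derivative (\<lambda>h. pd h f x)) (at x)"
  by (intro pd_has_derivative schwartz_differentiable)

lemma schwartz_pd: 
  assumes "f \<in> schwartz" "b \<in> Basis" shows "pd b f \<in> schwartz"
proof -
  have "pd b f = iter_deriv [b] f" by (simp add: pd_def[abs_def])
  then have "iter_deriv bs (pd b f) = iter_deriv (bs @ [b]) f" for bs
    by (simp add: iter_deriv_append)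
  then show ?thesis
    using assms unfolding schwartz_def by auto
qed

lemma schwartz_rapid: 
  assumes "f \<in> schwartz" shows "rapid f"
  unfolding rapid_def
proof
  fix N :: nat
  have "bounded (range (\<lambda>x. (1 + norm x) ^ N *\<^sub>R iter_deriv [] f x))"
    using assms unfolding schwartz_def by (auto dest: spec[of _ "[]"] simp del: iter_deriv.simps)
  then obtain C where C: "\<And>x. norm ((1 + norm x) ^ N *\<^sub>R f x) \<le> C"
    by (auto simp: bounded_iff)
  have "norm (f x) \<le> C / (1 + norm x) ^ N" for x
  proof -
    have "0 < (1 + norm x) ^ N" by (rule one_plus_norm_power_pos)
    with C[of x] show ?thesis by (simp add: pos_le_divide_eq mult.commute)
  qed
  then show "\<exists>C. \<forall>x. norm (f x) \<le> C / (1 + norm x) ^ N" by blast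
qed

text \<open>Schwartz space is the largest set of differentiable, rapidly decreasing functions that is closed
  under partial derivatives. Membership is therefore shown by exhibiting one such set.\<close>

lemma schwartz_coinduct:
  assumes d: "\<And>f x. f \<in> P \<Longrightarrow> f differentiable (at x)"
    and r: "\<And>f. f \<in> P \<Longrightarrow> rapid f"
    and p: "\<And>f b. f \<in> P \<Longrightarrow> b \<in> Basis \<Longrightarrow> pd b f \<in> P"
    and f: "f \<in> P"
  shows "f \<in> schwartz"
proof -
  have P: "iter_deriv bs f \<in> P" if "set bs \<subseteq> Basis" for bs
    using that
  proof (induction bs)
    case (Cons b bs)
    then have "pd b (iter_deriv bs f) \<in> P" by (intro p) auto
    then show ?case by (simp add: pd_def[abs_def])
  qed (simp add: f)
  have "bounded (range (\<lambda>x. (1 + norm x) ^ N *\<^sub>R g x))" if g: "g \<in> P" for g and N :: nat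
  proof -
    obtain C where C: "\<And>x. norm (g x) \<le> C / (1 + norm x) ^ N"
      using rapidE[OF r[OF g]] by blast
    have "norm ((1 + norm x) ^ N *\<^sub>R g x) \<le> C" for x
    proof -
      have "0 < (1 + norm x) ^ N" by (rule one_plus_norm_power_pos)
      with C[of x] show ?thesis by (simp add: pos_le_divide_eq mult.commute)
    qed
    then show ?thesis by (auto simp: bounded_iff)
  qed
  with P d show ?thesis unfolding schwartz_def by blast
qed

lemma schwartz_continuous: "f \<in> schwartz \<Longrightarrow> continuous_on UNIV f"
  by (meson differentiable_imp_continuous_within continuous_at_imp_continuous_on schwartz_differentiable)

lemma schwartz_measurable [measurable_dest]: "f \<in> schwartz \<Longrightarrow> f \<in> borel_measurable borel"
  by (intro borel_measurable_continuous_onI schwartz_continuous)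

lemma schwartz_integrable: "f \<in> schwartz \<Longrightarrow> integrable lborel f"
  by (intro rapid_integrable schwartz_rapid schwartz_measurable)

lemma schwartz_L2: "f \<in> schwartz \<Longrightarrow> f \<in> L2"
  by (intro rapid_L2 schwartz_rapid schwartz_measurable)

lemma schwartz_tempered_integrable:
  "tempered_fun f \<Longrightarrow> \<psi> \<in> schwartz \<Longrightarrow> integrable lborel (\<lambda>x. f x * \<psi> x)"
  by (intro rapid_tempered_integrable schwartz_rapid schwartz_measurable)

lemma schwartz_bounded:
  assumes "f \<in> schwartz" obtains C where "0 \<le> C" "\<And>x. norm (f x) \<le> C"
  using rapidE[OF schwartz_rapid[OF assms], of 0] by auto

lemma rapid_add:
  assumes "rapid f" "rapid g" shows "rapid (\<lambda>x. f x + g x)"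
  unfolding rapid_def
proof
  fix N
  obtain C D where "\<And>x. norm (f x) \<le> C / (1 + norm x) ^ N" "\<And>x. norm (g x) \<le> D / (1 + norm x) ^ N"
    using assms unfolding rapid_def by metis
  then have "norm (f x + g x) \<le> (C + D) / (1 + norm x) ^ N" for x
    by (simp add: add_divide_distrib order_trans[OF norm_triangle_ineq] add_mono)
  then show "\<exists>C. \<forall>x. norm (f x + g x) \<le> C / (1 + norm x) ^ N" by blast
qed

lemma rapid_mult:
  fixes f h :: "'a::euclidean_space \<Rightarrow> complex"
  assumes "rapid f" and h: "\<And>x. norm (h x) \<le> C * (1 + norm x) ^ k"
  shows "rapid (\<lambda>x. h x * f x)"
  unfolding rapid_def
proof
  fix N
  obtain D where D: "0 \<le> D" "\<And>x. norm (f x) \<le> D / (1 + norm x) ^ (N + k)"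
    using assms rapidE by blast
  have "norm (h x * f x) \<le> (C * D) / (1 + norm x) ^ N" for x
  proof -
    have "0 < 1 + norm x" by (simp add: add_pos_nonneg)
    have "norm (h x * f x) \<le> (C * (1 + norm x) ^ k) * (D / (1 + norm x) ^ (N + k))"
      unfolding norm_mult using h[of x]
      by (intro mult_mono D) (auto intro: order_trans[OF norm_ge_zero])
    also have "\<dots> = (C * D) / (1 + norm x) ^ N"
      using \<open>0 < 1 + norm x\<close> by (simp add: power_add)
    finally show ?thesis .
  qed
  then show "\<exists>C. \<forall>x. norm (h x * f x) \<le> C / (1 + norm x) ^ N" by blast
qed

lemma rapid_coord: "rapid f \<Longrightarrow> rapid (\<lambda>x. of_real (x \<bullet> c) * f x)"
proof (rule rapid_mult[where C = "norm c" and k = 1])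
  fix x
  have "\<bar>x \<bullet> c\<bar> \<le> norm x * norm c" by (rule Cauchy_Schwarz_ineq2)
  also have "\<dots> \<le> norm c * (1 + norm x) ^ 1" by (simp add: algebra_simps)
  finally show "norm (complex_of_real (x \<bullet> c)) \<le> norm c * (1 + norm x) ^ 1" by simp
qed

lemma rapid_cmult: "rapid f \<Longrightarrow> rapid (\<lambda>x. a * f x)"
  by (rule rapid_mult[where C = "norm a" and k = 0]) auto

lemma schwartz_lincomb:
  fixes f g :: "'a::euclidean_space \<Rightarrow> complex"
  assumes "f \<in> schwartz" "g \<in> schwartz"
  shows "(\<lambda>x. a * f x + c * g x) \<in> schwartz"
proof (rule schwartz_coinduct[where P = "{\<lambda>x. a * f x + c * g x | f g. f \<in> schwartz \<and> g \<in> schwartz}"])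
  have der: "((\<lambda>x. a * f x + c * g x) has_derivative (\<lambda>h. a * pd h f x + c * pd h g x)) (at x)"
    if "f \<in> schwartz" "g \<in> schwartz" for f g :: "'a \<Rightarrow> complex" and x
    by (rule derivative_eq_intros refl schwartz_has_derivative that)+ simp
  fix u :: "'a \<Rightarrow> complex" assume "u \<in> {\<lambda>x. a * f x + c * g x | f g. f \<in> schwartz \<and> g \<in> schwartz}"
  then obtain f g where u: "u = (\<lambda>x. a * f x + c * g x)" and fg: "f \<in> schwartz" "g \<in> schwartz"
    by blast
  show "u differentiable (at x)" for x
    unfolding u using der[OF fg, of x] by (rule differentiableI)
  show "rapid u"
    unfolding u by (intro rapid_add rapid_cmult schwartz_rapid fg)
  fix b :: 'a assume b: "b \<in> Basis"
  have "pd b u = (\<lambda>x. a * pd b f x + c * pd b g x)"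
    unfolding u by (rule ext) (simp add: pd_eq[OF der[OF fg]])
  then show "pd b u \<in> {\<lambda>x. a * f x + c * g x | f g. f \<in> schwartz \<and> g \<in> schwartz}"
    using schwartz_pd[OF _ b] fg by blast
qed (use assms in blast)

lemma schwartz_cmult: "f \<in> schwartz \<Longrightarrow> (\<lambda>x. a * f x) \<in> schwartz"
  using schwartz_lincomb[of f f a 0] by simp

lemma schwartz_add: "f \<in> schwartz \<Longrightarrow> g \<in> schwartz \<Longrightarrow> (\<lambda>x. f x + g x) \<in> schwartz"
  using schwartz_lincomb[of f g 1 1] by simp

lemma schwartz_diff: "f \<in> schwartz \<Longrightarrow> g \<in> schwartz \<Longrightarrow> (\<lambda>x. f x - g x) \<in> schwartz"
  using schwartz_lincomb[of f g 1 "-1"] by simp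

text \<open>The second summand is there for the induction: by the product rule, differentiating \<open>(x \<bullet> c) f\<close>
  leaves a multiple of \<open>f\<close> itself.\<close>

lemma schwartz_coord_add:
  fixes f g :: "'a::euclidean_space \<Rightarrow> complex"
  assumes "f \<in> schwartz" "g \<in> schwartz"
  shows "(\<lambda>x. of_real (x \<bullet> c) * f x + g x) \<in> schwartz"
proof (rule schwartz_coinduct[where P = "{\<lambda>x. of_real (x \<bullet> c) * f x + g x | f g. f \<in> schwartz \<and> g \<in> schwartz}"])
  have der: "((\<lambda>x. of_real (x \<bullet> c) * f x + g x) has_derivative
      (\<lambda>h. of_real (x \<bullet> c) * pd h f x + of_real (h \<bullet> c) * f x + pd h g x)) (at x)"
    if "f \<in> schwartz" "g \<in> schwartz" for f g :: "'a \<Rightarrow> complex" and x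
    by (rule derivative_eq_intros refl schwartz_has_derivative that)+ simp
  fix u :: "'a \<Rightarrow> complex" assume "u \<in> {\<lambda>x. of_real (x \<bullet> c) * f x + g x | f g. f \<in> schwartz \<and> g \<in> schwartz}"
  then obtain f g where u: "u = (\<lambda>x. of_real (x \<bullet> c) * f x + g x)" and fg: "f \<in> schwartz" "g \<in> schwartz"
    by blast
  show "u differentiable (at x)" for x
    unfolding u using der[OF fg, of x] by (rule differentiableI)
  show "rapid u"
    unfolding u by (intro rapid_add rapid_coord schwartz_rapid fg)
  fix b :: 'a assume b: "b \<in> Basis"
  have *: "pd b u = (\<lambda>x. of_real (x \<bullet> c) * pd b f x + (of_real (b \<bullet> c) * f x + pd b g x))"
    unfolding u by (rule ext) (simp add: pd_eq[OF der[OF fg]])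
  have "(\<lambda>x. of_real (b \<bullet> c) * f x + pd b g x) \<in> schwartz"
    using schwartz_lincomb[OF fg(1) schwartz_pd[OF fg(2) b], of _ 1] by simp
  with * show "pd b u \<in> {\<lambda>x. of_real (x \<bullet> c) * f x + g x | f g. f \<in> schwartz \<and> g \<in> schwartz}"
    using schwartz_pd[OF fg(1) b]
    by (intro CollectI exI[of _ "pd b f"] exI[of _ "\<lambda>x. of_real (b \<bullet> c) * f x + pd b g x"] conjI)
qed (use assms in blast)


lemma schwartz_coord: "f \<in> schwartz \<Longrightarrow> (\<lambda>x. of_real (x \<bullet> c) * f x) \<in> schwartz"
  using schwartz_coord_add[of f "\<lambda>x. 0 * f x" c] schwartz_cmult[of f 0] by simp

lemma schwartz_sum: "finite I \<Longrightarrow> I \<noteq> {} \<Longrightarrow> (\<And>i. i \<in> I \<Longrightarrow> f i \<in> schwartz) \<Longrightarrow> (\<lambda>x. \<Sum>i\<in>I. f i x) \<in> schwartz"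
  by (induction I rule: finite_ne_induct) (auto intro: schwartz_add)

lemma schwartz_norm_sq:
  assumes "f \<in> schwartz" shows "(\<lambda>x. of_real ((norm x)\<^sup>2) * f x) \<in> schwartz"
proof -
  have "(\<lambda>x. \<Sum>b\<in>Basis. of_real (x \<bullet> b) * (of_real (x \<bullet> b) * f x)) \<in> schwartz"
    by (intro schwartz_sum schwartz_coord assms) auto
  moreover have "(\<Sum>b\<in>Basis. of_real (x \<bullet> b) * (of_real (x \<bullet> b) * f x)) = of_real ((norm x)\<^sup>2) * f x" for x
  proof -
    have "(norm x)\<^sup>2 = (\<Sum>b\<in>Basis. (x \<bullet> b) * (x \<bullet> b))"
      unfolding power2_norm_eq_inner by (rule euclidean_inner)
    then show ?thesis by (simp add: sum_distrib_right mult.assoc)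
  qed
  ultimately show ?thesis by simp
qed

lemma schwartz_reflect:
  fixes f :: "'a::euclidean_space \<Rightarrow> complex"
  assumes "f \<in> schwartz" shows "(\<lambda>x. f (- x)) \<in> schwartz"
proof (rule schwartz_coinduct[where P = "{\<lambda>x. f (- x) | f. f \<in> schwartz}"])
  have der: "((\<lambda>x. f (- x)) has_derivative (\<lambda>h. pd (- h) f (- x))) (at x)"
    if "f \<in> schwartz" for f :: "'a \<Rightarrow> complex" and x
    using has_derivative_compose[OF _ schwartz_has_derivative[OF that], of uminus uminus x UNIV]
    by (simp add: has_derivative_minus[OF has_derivative_ident])
  fix u :: "'a \<Rightarrow> complex" assume "u \<in> {\<lambda>x. f (- x) | f. f \<in> schwartz}"
  then obtain f where u: "u = (\<lambda>x. f (- x))" and f: "f \<in> schwartz"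
    by blast
  show "u differentiable (at x)" for x
    unfolding u using der[OF f, of x] by (rule differentiableI)
  show "rapid u"
    using schwartz_rapid[OF f] unfolding u rapid_def by (metis norm_minus_cancel)
  fix b :: 'a assume b: "b \<in> Basis"
  have "pd (- b) f x = (-1) * pd b f x" for x
    using linear_neg[OF has_derivative_linear[OF schwartz_has_derivative[OF f, of x]], of b] by simp
  then have "pd b u = (\<lambda>x. (\<lambda>y. (-1) * pd b f y) (- x))"
    unfolding u by (intro ext) (simp add: pd_eq[OF der[OF f]])
  moreover have "(\<lambda>y. (-1) * pd b f y) \<in> schwartz"
    by (intro schwartz_cmult schwartz_pd f b)
  ultimately show "pd b u \<in> {\<lambda>x. f (- x) | f. f \<in> schwartz}"
    by (intro CollectI exI[of _ "\<lambda>y. (-1) * pd b f y"] conjI)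
qed (use assms in blast)

text \<open>The products against which the trace is tested, at a fixed time.\<close>

lemma rapid_tensor:
  fixes f :: "real \<times> real \<Rightarrow> complex" and g :: "real \<Rightarrow> complex"
  assumes "rapid f" "rapid g"
  shows "rapid (\<lambda>z. f (fst z, t) * g (snd z))"
  unfolding rapid_def
proof
  fix N
  obtain C where C: "0 \<le> C" "\<And>x. norm (f x) \<le> C / (1 + norm x) ^ N"
    using rapidE[OF assms(1)] by blast
  obtain D where D: "0 \<le> D" "\<And>x. norm (g x) \<le> D / (1 + norm x) ^ N"
    using rapidE[OF assms(2)] by blast
  have "norm (f (fst z, t) * g (snd z)) \<le> (C * D) / (1 + norm z) ^ N" for z :: "real \<times> real"
  proof -
    have z: "norm z \<le> norm (fst z) + norm (snd z)" by (metis norm_Pair_le prod.collapse)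
    have x: "norm (fst z) \<le> norm (fst z, t)" using norm_fst_le by blast
    have "1 + norm z \<le> (1 + norm (fst z)) * (1 + norm (snd z))"
      using z by (simp add: algebra_simps) (erule order_trans, simp)
    also have "\<dots> \<le> (1 + norm (fst z, t)) * (1 + norm (snd z))"
      using x by (intro mult_right_mono) auto
    finally have "(1 + norm z) ^ N \<le> ((1 + norm (fst z, t)) * (1 + norm (snd z))) ^ N"
      by (intro power_mono) auto
    moreover have "0 < (1 + norm z) ^ N" by (rule one_plus_norm_power_pos)
    ultimately have le: "(C * D) / ((1 + norm (fst z, t)) * (1 + norm (snd z))) ^ N \<le> (C * D) / (1 + norm z) ^ N"
      using C D by (intro divide_left_mono) auto
    have "norm (f (fst z, t) * g (snd z)) \<le> (C / (1 + norm (fst z, t)) ^ N) * (D / (1 + norm (snd z)) ^ N)"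
      unfolding norm_mult using C D by (intro mult_mono) auto
    also have "\<dots> = (C * D) / ((1 + norm (fst z, t)) * (1 + norm (snd z))) ^ N"
      by (simp add: power_mult_distrib)
    finally show ?thesis using le by linarith
  qed
  then show "\<exists>C. \<forall>z. norm (f (fst z, t) * g (snd z)) \<le> C / (1 + norm z) ^ N" by blast
qed

lemma schwartz_tensor:
  fixes f :: "real \<times> real \<Rightarrow> complex" and g :: "real \<Rightarrow> complex"
  assumes "f \<in> schwartz" "g \<in> schwartz"
  shows "(\<lambda>z. f (fst z, t) * g (snd z)) \<in> schwartz"
proof (rule schwartz_coinduct[where P = "{\<lambda>z. f (fst z, t) * g (snd z) | f g. f \<in> schwartz \<and> g \<in> schwartz}"])
  have der: "((\<lambda>z. f (fst z, t) * g (snd z)) has_derivative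
      (\<lambda>h. f (fst z, t) * pd (snd h) g (snd z) + pd (fst h, 0) f (fst z, t) * g (snd z))) (at z)"
    if fg: "f \<in> schwartz" "g \<in> schwartz" for f :: "real \<times> real \<Rightarrow> complex" and g z
  proof -
    have 1: "((\<lambda>z. f (fst z, t)) has_derivative (\<lambda>h. pd (fst h, 0) f (fst z, t))) (at z)"
      by (rule has_derivative_compose[OF _ schwartz_has_derivative[OF fg(1)]])
        (auto intro!: derivative_eq_intros)
    have 2: "((\<lambda>z. g (snd z)) has_derivative (\<lambda>h. pd (snd h) g (snd z))) (at z)"
      by (rule has_derivative_compose[OF _ schwartz_has_derivative[OF fg(2)]])
        (auto intro!: derivative_eq_intros)
    show ?thesis by (rule has_derivative_mult[OF 1 2])
  qed
  fix u :: "real \<times> real \<Rightarrow> complex"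
  assume "u \<in> {\<lambda>z. f (fst z, t) * g (snd z) | f g. f \<in> schwartz \<and> g \<in> schwartz}"
  then obtain f g where u: "u = (\<lambda>z. f (fst z, t) * g (snd z))" and fg: "f \<in> schwartz" "g \<in> schwartz"
    by blast
  show "u differentiable (at x)" for x
    unfolding u using der[OF fg, of x] by (rule differentiableI)
  show "rapid u"
    unfolding u by (intro rapid_tensor schwartz_rapid fg)
  fix b :: "real \<times> real" assume "b \<in> Basis"
  then consider "b = (1, 0)" | "b = (0, 1)" by (auto simp: Basis_prod_def)
  then show "pd b u \<in> {\<lambda>z. f (fst z, t) * g (snd z) | f g. f \<in> schwartz \<and> g \<in> schwartz}"
  proof cases
    case 1
    have "pd 0 g x = 0" for x
      using linear_0[OF has_derivative_linear[OF schwartz_has_derivative[OF fg(2), of x]]] .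
    then have "pd b u = (\<lambda>z. pd b f (fst z, t) * g (snd z))"
      unfolding u by (intro ext) (simp add: pd_eq[OF der[OF fg]] 1)
    then show ?thesis using schwartz_pd[OF fg(1) \<open>b \<in> Basis\<close>] fg(2) by blast
  next
    case 2
    have "pd (0, 0) f x = 0" for x
      using linear_0[OF has_derivative_linear[OF schwartz_has_derivative[OF fg(1), of x]]]
      by (simp add: zero_prod_def)
    then have "pd b u = (\<lambda>z. f (fst z, t) * pd 1 g (snd z))"
      unfolding u by (intro ext) (simp add: pd_eq[OF der[OF fg]] 2)
    then show ?thesis using schwartz_pd[OF fg(2), of 1] fg(1) by auto
  qed
qed (use assms in blast)

text \<open>Polynomials times the Gaussian centred at \<open>a\<close>. The Gaussian alone is not closed under
  derivatives, so this set is what witnesses that it is a Schwartz function.\<close>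

inductive_set hermite :: "'a::euclidean_space \<Rightarrow> real \<Rightarrow> ('a \<Rightarrow> complex) set" for a c where
  gauss: "(\<lambda>x. of_real (exp (- c * (norm (x - a))\<^sup>2))) \<in> hermite a c"
| lincomb: "f \<in> hermite a c \<Longrightarrow> g \<in> hermite a c \<Longrightarrow> (\<lambda>x. p * f x + q * g x) \<in> hermite a c"
| coord: "f \<in> hermite a c \<Longrightarrow> (\<lambda>x. of_real (x \<bullet> d) * f x) \<in> hermite a c"

lemma power_le_fact_exp:
  fixes y :: real assumes "0 \<le> y" shows "y ^ n \<le> fact n * exp y"
proof -
  have "y ^ n /\<^sub>R fact n \<le> (\<Sum>k. y ^ k /\<^sub>R fact k)"
    using sum_le_suminf[OF summable_exp_generic, of "{n}" y] assms by simp
  also have "\<dots> = exp y" by (simp add: exp_def)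
  finally show ?thesis by (simp add: field_simps)
qed

lemma rapid_gauss:
  assumes "0 < c" shows "rapid (\<lambda>x::'a::euclidean_space. of_real (exp (- c * (norm (x - a))\<^sup>2)))"
  unfolding rapid_def
proof (intro allI exI)
  fix N and x :: 'a
  define r where "r = norm (x - a)"
  have "1 + norm x \<le> 1 + norm a + r"
    unfolding r_def using norm_triangle_ineq[of "x - a" a] by simp
  also have "\<dots> \<le> (1 + norm a) * (1 + r)"
    unfolding r_def by (simp add: algebra_simps)
  finally have "(1 + norm x) ^ N \<le> ((1 + norm a) * (1 + r)) ^ N"
    by (intro power_mono) auto
  also have "\<dots> \<le> (1 + norm a) ^ N * (fact N * exp (1 + r))"
    unfolding power_mult_distrib by (intro mult_left_mono power_le_fact_exp) (auto simp: r_def)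
  finally have "(1 + norm x) ^ N * exp (- c * r\<^sup>2) \<le> (1 + norm a) ^ N * (fact N * exp (1 + r)) * exp (- c * r\<^sup>2)"
    by (intro mult_right_mono) auto
  also have "\<dots> = (1 + norm a) ^ N * fact N * exp (1 + r - c * r\<^sup>2)"
    by (simp add: exp_add[symmetric])
  also have "\<dots> \<le> (1 + norm a) ^ N * fact N * exp (1 + 1 / (4 * c))"
  proof -
    have "0 \<le> c * (r - 1 / (2 * c))\<^sup>2" using assms by simp
    also have "\<dots> = c * r\<^sup>2 - r + 1 / (4 * c)"
      using assms by (simp add: power2_diff power_divide field_simps power2_eq_square)
    finally show ?thesis by (intro mult_left_mono) auto
  qed
  finally have "(1 + norm x) ^ N * exp (- c * r\<^sup>2) \<le> (1 + norm a) ^ N * fact N * exp (1 + 1 / (4 * c))" .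
  moreover have "0 < (1 + norm x) ^ N" by (rule one_plus_norm_power_pos)
  ultimately show "norm (complex_of_real (exp (- c * (norm (x - a))\<^sup>2)))
      \<le> ((1 + norm a) ^ N * fact N * exp (1 + 1 / (4 * c))) / (1 + norm x) ^ N"
    unfolding r_def norm_of_real by (simp add: pos_le_divide_eq mult.commute)
qed

lemma hermite_schwartz:
  fixes f :: "'a::euclidean_space \<Rightarrow> complex"
  assumes "0 < c" "f \<in> hermite a c" shows "f \<in> schwartz"
proof -
  have d: "\<exists>D. (\<forall>x. (g has_derivative D x) (at x)) \<and> (\<forall>b. (\<lambda>x. D x b) \<in> hermite a c)"
    if "g \<in> hermite a c" for g :: "'a \<Rightarrow> complex"
    using that
  proof induction
    case gauss
    let ?g = "\<lambda>x. complex_of_real (exp (- c * (norm (x - a))\<^sup>2))"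
    let ?D = "\<lambda>x h. of_real (x \<bullet> ((-2 * c) *\<^sub>R h)) * ?g x + of_real (2 * c * (a \<bullet> h)) * ?g x"
    have "(?g has_derivative ?D x) (at x)" for x
      unfolding power2_norm_eq_inner
      by (auto intro!: derivative_eq_intros simp: algebra_simps inner_commute)
    moreover have "(\<lambda>x. ?D x b) \<in> hermite a c" for b
      using hermite.lincomb[OF hermite.coord[OF hermite.gauss[of c a], of "(-2 * c) *\<^sub>R b"] hermite.gauss[of c a],
          of 1 "of_real (2 * c * (a \<bullet> b))"] by (simp only: mult_1)
    ultimately show ?case by (intro exI[of _ "\<lambda>x. ?D x"] conjI allI)
  next
    case (lincomb f g p q)
    then obtain D E where D: "\<And>x. (f has_derivative D x) (at x)" "\<And>b. (\<lambda>x. D x b) \<in> hermite a c"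
      and E: "\<And>x. (g has_derivative E x) (at x)" "\<And>b. (\<lambda>x. E x b) \<in> hermite a c"
      by blast
    have "((\<lambda>x. p * f x + q * g x) has_derivative (\<lambda>h. p * D x h + q * E x h)) (at x)" for x
      by (rule derivative_eq_intros refl D E)+ simp
    moreover have "(\<lambda>x. p * D x b + q * E x b) \<in> hermite a c" for b
      by (intro hermite.lincomb D E)
    ultimately show ?case
      by (intro exI[of _ "\<lambda>x h. p * D x h + q * E x h"]) blast
  next
    case (coord f d)
    then obtain D where D: "\<And>x. (f has_derivative D x) (at x)" "\<And>b. (\<lambda>x. D x b) \<in> hermite a c"
      by blast
    have "((\<lambda>x. of_real (x \<bullet> d) * f x) has_derivative
        (\<lambda>h. 1 * (of_real (x \<bullet> d) * D x h) + of_real (h \<bullet> d) * f x)) (at x)" for x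
      by (rule derivative_eq_intros refl D)+ simp
    moreover have "(\<lambda>x. 1 * (of_real (x \<bullet> d) * D x b) + of_real (b \<bullet> d) * f x) \<in> hermite a c" for b
      by (intro hermite.lincomb hermite.coord D coord)
    ultimately show ?case
      by (intro exI[of _ "\<lambda>x h. 1 * (of_real (x \<bullet> d) * D x h) + of_real (h \<bullet> d) * f x"]) blast
  qed
  have r: "rapid g" if "g \<in> hermite a c" for g :: "'a \<Rightarrow> complex"
    using that by induction (intro rapid_gauss rapid_add rapid_cmult rapid_coord assms; assumption)+
  show ?thesis
  proof (rule schwartz_coinduct[where P = "hermite a c"])
    show "g differentiable at x" if "g \<in> hermite a c" for g :: "'a \<Rightarrow> complex" and x
      using d[OF that] by (auto simp: differentiable_def)
    show "pd b g \<in> hermite a c" if g: "g \<in> hermite a c" for g :: "'a \<Rightarrow> complex" and b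
    proof -
      obtain D where "\<forall>x. (g has_derivative D x) (at x)" "(\<lambda>x. D x b) \<in> hermite a c"
        using d[OF g] by blast
      moreover from this have "pd b g = (\<lambda>x. D x b)" by (auto simp: pd_eq)
      ultimately show ?thesis by simp
    qed
  qed (use assms r in auto)
qed

lemma gauss_schwartz:
  "0 < c \<Longrightarrow> (\<lambda>x::'a::euclidean_space. of_real (exp (- c * (norm (x - a))\<^sup>2))) \<in> schwartz"
  by (rule hermite_schwartz[OF _ hermite.gauss])

section \<open>The Fourier transform of Schwartz functions\<close>

text \<open>By the mean value theorem the error of the linear approximation, divided by the length of the
  increment, is dominated by \<open>2 B\<close>; dominated convergence then gives the limit.\<close>

lemma has_derivative_integral:
  fixes f :: "'x::euclidean_space \<Rightarrow> 'y \<Rightarrow> complex"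
  assumes U: "open U" "convex U" "x \<in> U"
    and int: "\<And>z. z \<in> U \<Longrightarrow> integrable M (f z)"
    and der: "\<And>z y. z \<in> U \<Longrightarrow> ((\<lambda>z. f z y) has_derivative f' z y) (at z)"
    and [measurable]: "\<And>h. (\<lambda>y. f' x y h) \<in> borel_measurable M"
    and B: "integrable M B" "\<And>z y h. z \<in> U \<Longrightarrow> norm (f' z y h) \<le> B y * norm h"
  shows "((\<lambda>z. \<integral>y. f z y \<partial>M) has_derivative (\<lambda>h. \<integral>y. f' x y h \<partial>M)) (at x)"
proof -
  have int': "integrable M (\<lambda>y. f' x y h)" for h
    using B(2)[OF U(3), of _ h]
    by (intro Bochner_Integration.integrable_bound[OF integrable_mult_left[OF B(1), of "norm h"]])
      (auto intro: order_trans[OF _ abs_ge_self])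
  have lin: "bounded_linear (f' x y)" for y
    using der[OF U(3)] by (rule has_derivative_bounded_linear)
  have bl: "bounded_linear (\<lambda>h. \<integral>y. f' x y h \<partial>M)"
  proof (rule bounded_linear_intro)
    show "(\<integral>y. f' x y (h + k) \<partial>M) = (\<integral>y. f' x y h \<partial>M) + (\<integral>y. f' x y k \<partial>M)" for h k
      using int' by (simp add: linear_add[OF bounded_linear.linear[OF lin]])
    show "(\<integral>y. f' x y (r *\<^sub>R h) \<partial>M) = r *\<^sub>R (\<integral>y. f' x y h \<partial>M)" for r h
      by (simp add: linear_scale[OF bounded_linear.linear[OF lin]])
    show "norm (\<integral>y. f' x y h \<partial>M) \<le> norm h * (\<integral>y. B y \<partial>M)" for h
    proof -
      have "norm (\<integral>y. f' x y h \<partial>M) \<le> (\<integral>y. norm (f' x y h) \<partial>M)" by (rule integral_norm_bound)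
      also have "\<dots> \<le> (\<integral>y. B y * norm h \<partial>M)"
        using int' B U(3) by (intro integral_mono) auto
      finally show ?thesis by (simp add: mult.commute)
    qed
  qed
  have "(\<lambda>h. norm ((\<integral>y. f (x + h) y \<partial>M) - (\<integral>y. f x y \<partial>M) - (\<integral>y. f' x y h \<partial>M)) / norm h) \<midarrow>0\<rightarrow> 0"
    unfolding tendsto_at_iff_sequentially comp_def
  proof (intro allI impI)
    fix X :: "nat \<Rightarrow> 'x" assume X0: "\<forall>i. X i \<in> UNIV - {0}" and X: "X \<longlonglongrightarrow> 0"
    have nz: "X i \<noteq> 0" for i using X0 by auto
    have "(\<lambda>i. x + X i) \<longlonglongrightarrow> x + 0" by (intro tendsto_intros X)
    then have ev: "eventually (\<lambda>i. x + X i \<in> U) sequentially"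
      using U(1,3) by (simp add: topological_tendstoD)
    define r where "r i y = (if x + X i \<in> U then norm (f (x + X i) y - f x y - f' x y (X i)) / norm (X i) else 0)" for i y
    have rm: "r i \<in> borel_measurable M" for i
    proof (cases "x + X i \<in> U")
      case True
      have [measurable]: "f (x + X i) \<in> borel_measurable M" "f x \<in> borel_measurable M"
        using int U(3) True by auto
      show ?thesis unfolding r_def using True by simp
    next
      case False
      then have "r i = (\<lambda>y. 0)" by (auto simp: r_def)
      then show ?thesis by simp
    qed
    have rb: "norm (r i y) \<le> 2 * B y" for i y
    proof (cases "x + X i \<in> U")
      case True
      have "norm (f (x + X i) y - f x y) \<le> B y * norm (x + X i - x)"
      proof (rule differentiable_bound[where S = U and f = "\<lambda>z. f z y" and f' = "\<lambda>z. f' z y"])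
        fix z assume z: "z \<in> U"
        show "((\<lambda>z. f z y) has_derivative f' z y) (at z within U)"
          using der[OF z] by (rule has_derivative_at_withinI)
        show "onorm (f' z y) \<le> B y"
          by (rule onorm_bound) (use B(2)[OF z, of y] B(2)[OF z, of y "SOME b. b \<in> Basis"] in
              \<open>auto simp: SOME_Basis intro: order_trans[OF norm_ge_zero]\<close>)
      qed (use U True in auto)
      moreover have "norm (f' x y (X i)) \<le> B y * norm (X i)" by (rule B(2)[OF U(3)])
      ultimately have "norm (f (x + X i) y - f x y - f' x y (X i)) \<le> 2 * B y * norm (X i)"
        using norm_triangle_ineq4[of "f (x + X i) y - f x y" "f' x y (X i)"] by simp
      then show ?thesis
        unfolding r_def using True nz[of i] by (simp add: divide_le_eq)
    next
      case False
      have "0 \<le> B y"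
        using B(2)[OF U(3), of y "SOME b. b \<in> Basis"] by (auto simp: SOME_Basis intro: order_trans[OF norm_ge_zero])
      then show ?thesis using False by (simp add: r_def)
    qed
    have rlim: "(\<lambda>i. r i y) \<longlonglongrightarrow> 0" for y
    proof -
      have "(\<lambda>h. norm (f (x + h) y - f x y - f' x y h) / norm h) \<midarrow>0\<rightarrow> 0"
        using der[OF U(3), of y] unfolding has_derivative_at by blast
      then have "(\<lambda>i. norm (f (x + X i) y - f x y - f' x y (X i)) / norm (X i)) \<longlonglongrightarrow> 0"
        unfolding tendsto_at_iff_sequentially comp_def using X0 X by blast
      then show ?thesis
        by (rule Lim_transform_eventually) (use ev in \<open>auto elim!: eventually_mono simp: r_def\<close>)
    qed
    have "(\<lambda>i. \<integral>y. r i y \<partial>M) \<longlonglongrightarrow> (\<integral>y. 0 \<partial>M)"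
      by (rule integral_dominated_convergence[where w = "\<lambda>y. 2 * B y"]) (use rm rb rlim B(1) in auto)
    then have lim: "(\<lambda>i. \<integral>y. r i y \<partial>M) \<longlonglongrightarrow> 0" by simp
    show "(\<lambda>i. norm ((\<integral>y. f (x + X i) y \<partial>M) - (\<integral>y. f x y \<partial>M) - (\<integral>y. f' x y (X i) \<partial>M)) / norm (X i)) \<longlonglongrightarrow> 0"
    proof (rule Lim_null_comparison[OF _ lim])
      show "eventually (\<lambda>i. norm (norm ((\<integral>y. f (x + X i) y \<partial>M) - (\<integral>y. f x y \<partial>M) - (\<integral>y. f' x y (X i) \<partial>M)) / norm (X i)) \<le> (\<integral>y. r i y \<partial>M)) sequentially"
        using ev
      proof eventually_elim
        case (elim i)
        have "(\<integral>y. f (x + X i) y \<partial>M) - (\<integral>y. f x y \<partial>M) - (\<integral>y. f' x y (X i) \<partial>M)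
            = (\<integral>y. f (x + X i) y - f x y - f' x y (X i) \<partial>M)"
          using int[OF elim] int[OF U(3)] int' by simp
        also have "norm \<dots> \<le> (\<integral>y. norm (f (x + X i) y - f x y - f' x y (X i)) \<partial>M)"
          by (rule integral_norm_bound)
        finally have "norm ((\<integral>y. f (x + X i) y \<partial>M) - (\<integral>y. f x y \<partial>M) - (\<integral>y. f' x y (X i) \<partial>M)) / norm (X i)
            \<le> (\<integral>y. norm (f (x + X i) y - f x y - f' x y (X i)) \<partial>M) / norm (X i)"
          by (rule divide_right_mono) simp
        also have "\<dots> = (\<integral>y. r i y \<partial>M)"
          unfolding r_def using elim by simp
        finally show ?case by simp
      qed
    qed
  qed
  with bl show ?thesis unfolding has_derivative_at by blast
qed

lemma
  fixes t :: "'a::euclidean_space" and f :: "'a \<Rightarrow> complex"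
  assumes c: "c \<noteq> 0"
  shows integrable_lborel_affine: "integrable lborel f \<Longrightarrow> integrable lborel (\<lambda>x. f (t + c *\<^sub>R x))"
    and integral_lborel_affine: "f \<in> borel_measurable borel \<Longrightarrow>
      (LINT x|lborel. f x) = \<bar>c\<bar> ^ DIM('a) *\<^sub>R (LINT x|lborel. f (t + c *\<^sub>R x))"
proof -
  show "integrable lborel (\<lambda>x. f (t + c *\<^sub>R x))" if f: "integrable lborel f"
  proof -
    have [measurable]: "f \<in> borel_measurable borel" using f by auto
    have "integrable (density (distr lborel borel (\<lambda>x. t + c *\<^sub>R x)) (\<lambda>_. \<bar>c\<bar>^DIM('a))) f"
      using f lborel_affine[OF c, of t] by simp
    then have "integrable lborel (\<lambda>x. \<bar>c\<bar> ^ DIM('a) *\<^sub>R f (t + c *\<^sub>R x))"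
      by (subst (asm) integrable_density) (auto simp: integrable_distr_eq)
    from integrable_scaleR_right[of "inverse (\<bar>c\<bar> ^ DIM('a))", OF this] show ?thesis
      using c by simp
  qed
  assume [measurable]: "f \<in> borel_measurable borel"
  have "(LINT x|lborel. f x) = (LINT x|density (distr lborel borel (\<lambda>x. t + c *\<^sub>R x)) (\<lambda>_. \<bar>c\<bar>^DIM('a)). f x)"
    using lborel_affine[OF c, of t] by simp
  also have "\<dots> = \<bar>c\<bar> ^ DIM('a) *\<^sub>R (LINT x|lborel. f (t + c *\<^sub>R x))"
    by (subst integral_density) (auto simp: integral_distr)
  finally show "(LINT x|lborel. f x) = \<bar>c\<bar> ^ DIM('a) *\<^sub>R (LINT x|lborel. f (t + c *\<^sub>R x))" .
qed

lemma norm_character [simp]: "norm (exp (- \<i> * complex_of_real r)) = 1"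
  by (simp add: norm_exp_eq_Re)

lemma integrable_character:
  assumes "integrable lborel f"
  shows "integrable lborel (\<lambda>x. exp (- \<i> * of_real (x \<bullet> \<xi>)) * f x)"
proof (rule Bochner_Integration.integrable_bound[OF assms])
  have [measurable]: "f \<in> borel_measurable borel" using assms by auto
  show "(\<lambda>x. exp (- \<i> * of_real (x \<bullet> \<xi>)) * f x) \<in> borel_measurable lborel" by measurable
qed (simp add: norm_mult del: mult_minus_left)

lemma fourier_integral_measurable [measurable]:
  assumes [measurable]: "f \<in> borel_measurable borel"
  shows "fourier_integral f \<in> borel_measurable borel"
proof -
  have "(\<lambda>\<xi>. LINT x|lborel. exp (- \<i> * of_real (x \<bullet> \<xi>)) * f x) \<in> borel_measurable borel"
    by (rule lborel.borel_measurable_lebesgue_integral) measurable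
  then show ?thesis unfolding fourier_integral_def[abs_def] by measurable
qed

lemma fourier_integral_bound:
  fixes f :: "'a::euclidean_space \<Rightarrow> complex"
  shows "norm (fourier_integral f \<xi>) \<le> (2 * pi) powr (- real DIM('a) / 2) * (LINT x|lborel. norm (f x))"
proof -
  have "norm (LINT x|lborel. exp (- \<i> * of_real (x \<bullet> \<xi>)) * f x)
      \<le> (LINT x|lborel. norm (exp (- \<i> * of_real (x \<bullet> \<xi>)) * f x))"
    by (rule integral_norm_bound)
  then show ?thesis
    unfolding fourier_integral_def norm_mult norm_of_real
    by (simp add: norm_mult del: mult_minus_left) 
qed

text \<open>In place of integration by parts: translating \<open>f\<close> by \<open>s b\<close> multiplies its transform by
  \<open>exp (i s (\<xi> \<bullet> b))\<close>, and this identity is differentiated in \<open>s\<close>.\<close>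

lemma fourier_integral_pd:
  fixes f :: "'a::euclidean_space \<Rightarrow> complex"
  assumes f: "f \<in> schwartz" and b: "b \<in> Basis"
  shows "fourier_integral (pd b f) \<xi> = \<i> * of_real (\<xi> \<bullet> b) * fourier_integral f \<xi>"
proof -
  let ?E = "\<lambda>x. exp (- \<i> * complex_of_real (x \<bullet> \<xi>))"
  let ?I = "LINT x|lborel. ?E x * f x"
  note [measurable] = schwartz_measurable[OF f] schwartz_measurable[OF schwartz_pd[OF f b]]
  have trans: "(LINT x|lborel. ?E x * f (x + s *\<^sub>R b)) = exp (\<i> * of_real (s * (\<xi> \<bullet> b))) * ?I" for s :: real
  proof -
    have "?I = (LINT x|lborel. ?E (s *\<^sub>R b + 1 *\<^sub>R x) * f (s *\<^sub>R b + 1 *\<^sub>R x))"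
      by (subst integral_lborel_affine[of 1 _ "s *\<^sub>R b"]) auto
    also have "\<dots> = (LINT x|lborel. exp (- \<i> * of_real (s * (\<xi> \<bullet> b))) * (?E x * f (x + s *\<^sub>R b)))"
      by (intro Bochner_Integration.integral_cong refl)
        (simp add: inner_add_left exp_add[symmetric] algebra_simps inner_commute)
    also have "\<dots> = exp (- \<i> * of_real (s * (\<xi> \<bullet> b))) * (LINT x|lborel. ?E x * f (x + s *\<^sub>R b))"
      by simp
    finally show ?thesis by (simp add: exp_minus field_simps)
  qed
  \<comment> \<open>Both sides are differentiated at \<open>s = 0\<close>.\<close>
  have "((\<lambda>s. LINT x|lborel. ?E x * f (x + s *\<^sub>R b)) has_derivative
      (\<lambda>h. LINT x|lborel. ?E x * (of_real h * pd b f (x + 0 *\<^sub>R b)))) (at 0)"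
  proof -
    obtain C where C: "0 \<le> C" "\<And>x. norm (pd b f x) \<le> C / (1 + norm x) ^ (2 * DIM('a))"
      using rapidE[OF schwartz_rapid[OF schwartz_pd[OF f b]]] by blast
    show ?thesis
    proof (rule has_derivative_integral[where U = "ball 0 1" and
          B = "\<lambda>x. C * 2 ^ (2 * DIM('a)) * (1 / (1 + norm x) ^ (2 * DIM('a)))"])
      fix z :: real and x :: 'a assume z: "z \<in> ball 0 1"
      have "integrable lborel (\<lambda>x. f (z *\<^sub>R b + 1 *\<^sub>R x))"
        by (intro integrable_lborel_affine schwartz_integrable f) simp
      then show "integrable lborel (\<lambda>x. ?E x * f (x + z *\<^sub>R b))"
        by (intro integrable_character) (simp add: add.commute)
      have lin: "pd (h *\<^sub>R b) f y = of_real h * pd b f y" for h y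
        using linear_scale[OF has_derivative_linear[OF schwartz_has_derivative[OF f, of y]], of h b]
        by (simp add: scaleR_conv_of_real)
      have "((\<lambda>s. f (x + s *\<^sub>R b)) has_derivative (\<lambda>h. pd (h *\<^sub>R b) f (x + z *\<^sub>R b))) (at z)"
        by (rule has_derivative_compose[OF _ schwartz_has_derivative[OF f]]) (auto intro!: derivative_eq_intros)
      then show "((\<lambda>s. ?E x * f (x + s *\<^sub>R b)) has_derivative (\<lambda>h. ?E x * (of_real h * pd b f (x + z *\<^sub>R b)))) (at z)"
        unfolding lin by (rule has_derivative_mult_right)
      show "norm (?E x * (of_real h * pd b f (x + z *\<^sub>R b)))
          \<le> C * 2 ^ (2 * DIM('a)) * (1 / (1 + norm x) ^ (2 * DIM('a))) * norm h" for h
      proof -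
        have "norm (z *\<^sub>R b) \<le> 1" using z b by simp
        then have "1 + norm x \<le> 2 * (1 + norm (x + z *\<^sub>R b))"
        proof -
          have "norm x \<le> norm (x + z *\<^sub>R b) + norm (z *\<^sub>R b)"
            using norm_triangle_ineq4[of "x + z *\<^sub>R b" "z *\<^sub>R b"] by simp
          with \<open>norm (z *\<^sub>R b) \<le> 1\<close> norm_ge_zero[of "x + z *\<^sub>R b"] show ?thesis by argo
        qed
        then have "(1 + norm x) ^ (2 * DIM('a)) \<le> 2 ^ (2 * DIM('a)) * (1 + norm (x + z *\<^sub>R b)) ^ (2 * DIM('a))"
          unfolding power_mult_distrib[symmetric] by (intro power_mono) auto
        moreover have "0 < (1 + norm x) ^ (2 * DIM('a))" "0 < (1 + norm (x + z *\<^sub>R b)) ^ (2 * DIM('a))"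
          by (rule one_plus_norm_power_pos)+
        ultimately have "1 / (1 + norm (x + z *\<^sub>R b)) ^ (2 * DIM('a)) \<le> 2 ^ (2 * DIM('a)) * (1 / (1 + norm x) ^ (2 * DIM('a)))"
          by (simp add: field_simps)
        from mult_left_mono[OF this C(1)]
        have "C / (1 + norm (x + z *\<^sub>R b)) ^ (2 * DIM('a)) \<le> C * 2 ^ (2 * DIM('a)) * (1 / (1 + norm x) ^ (2 * DIM('a)))"
          by (simp add: mult.assoc)
        then have "norm (pd b f (x + z *\<^sub>R b)) \<le> C * 2 ^ (2 * DIM('a)) * (1 / (1 + norm x) ^ (2 * DIM('a)))"
          using C(2) order_trans by blast
        from mult_right_mono[OF this norm_ge_zero[of h]] show ?thesis
          by (simp add: norm_mult mult.commute del: mult_minus_left)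
      qed
    next
      show "integrable lborel (\<lambda>x::'a. C * 2 ^ (2 * DIM('a)) * (1 / (1 + norm x) ^ (2 * DIM('a))))"
        by (intro integrable_mult_right integrable_weight) simp
    qed auto
  qed
  moreover have "((\<lambda>s. LINT x|lborel. ?E x * f (x + s *\<^sub>R b)) has_derivative
      (\<lambda>h. \<i> * of_real (h * (\<xi> \<bullet> b)) * ?I)) (at 0)"
  proof -
    have 1: "((\<lambda>s. \<i> * complex_of_real (s * (\<xi> \<bullet> b))) has_derivative (\<lambda>h. \<i> * of_real (h * (\<xi> \<bullet> b)))) (at 0)"
      by (auto intro!: derivative_eq_intros)
    have 2: "(exp has_derivative (*) 1) (at (\<i> * complex_of_real (0 * (\<xi> \<bullet> b))))"
      using DERIV_exp[of "0::complex"] by (simp add: has_field_derivative_def)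
    show ?thesis
      using has_derivative_mult_left[OF has_derivative_compose[OF 1 2]] by (simp only: trans mult_1_left)
  qed
  ultimately have "(\<lambda>h. LINT x|lborel. ?E x * (of_real h * pd b f (x + 0 *\<^sub>R b))) = (\<lambda>h. \<i> * of_real (h * (\<xi> \<bullet> b)) * ?I)"
    by (rule has_derivative_unique)
  from fun_cong[OF this, of 1] show ?thesis
    unfolding fourier_integral_def by simp
qed

lemma character_has_derivative:
  "((\<lambda>z. exp (- \<i> * complex_of_real (x \<bullet> z))) has_derivative
    (\<lambda>h. exp (- \<i> * complex_of_real (x \<bullet> z)) * (- \<i> * of_real (x \<bullet> h)))) (at z)"
proof -
  have 1: "((\<lambda>z. - \<i> * complex_of_real (x \<bullet> z)) has_derivative (\<lambda>h. - \<i> * of_real (x \<bullet> h))) (at z)"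
    by (auto intro!: derivative_eq_intros)
  have 2: "(exp has_derivative (*) (exp (- \<i> * complex_of_real (x \<bullet> z)))) (at (- \<i> * complex_of_real (x \<bullet> z)))"
    using DERIV_exp unfolding has_field_derivative_def .
  show ?thesis by (rule has_derivative_compose[OF 1 2])
qed

lemma fourier_integral_has_derivative:
  fixes f :: "'a::euclidean_space \<Rightarrow> complex"
  assumes f: "f \<in> schwartz"
  shows "(fourier_integral f has_derivative (\<lambda>h. fourier_integral (\<lambda>x. - \<i> * of_real (x \<bullet> h) * f x) \<xi>)) (at \<xi>)"
proof -
  note [measurable] = schwartz_measurable[OF f]
  let ?E = "\<lambda>\<xi> x. exp (- \<i> * complex_of_real (x \<bullet> \<xi>))"
  have nx: "rapid (\<lambda>x. of_real (norm x) * f x)"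
    by (rule rapid_mult[OF schwartz_rapid[OF f], of _ 1 1]) auto
  have "((\<lambda>\<xi>. LINT x|lborel. ?E \<xi> x * f x) has_derivative (\<lambda>h. LINT x|lborel. ?E \<xi> x * (- \<i> * of_real (x \<bullet> h) * f x))) (at \<xi>)"
  proof (rule has_derivative_integral[where U = UNIV and B = "\<lambda>x. norm (of_real (norm x) * f x)"])
    show "integrable lborel (\<lambda>x. ?E z x * f x)" for z
      by (intro integrable_character schwartz_integrable f)
    show "((\<lambda>z. ?E z x * f x) has_derivative (\<lambda>h. ?E z x * (- \<i> * of_real (x \<bullet> h) * f x))) (at z)" for z x
      using has_derivative_mult_left[OF character_has_derivative] by (simp only: mult.assoc)
    show "integrable lborel (\<lambda>x. norm (of_real (norm x) * f x))"
      by (intro integrable_norm rapid_integrable nx) measurable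
    show "norm (?E z x * (- \<i> * of_real (x \<bullet> h) * f x)) \<le> norm (of_real (norm x) * f x) * norm h" for z x h
      using mult_right_mono[OF Cauchy_Schwarz_ineq2[of x h] norm_ge_zero[of "f x"]]
      by (simp add: norm_mult mult_ac del: mult_minus_left)
  qed auto
  then show ?thesis
    unfolding fourier_integral_def[abs_def] by (rule has_derivative_mult_right)
qed

lemma pd_fourier_integral:
  assumes "f \<in> schwartz"
  shows "pd b (fourier_integral f) = fourier_integral (\<lambda>x. - \<i> * of_real (x \<bullet> b) * f x)"
  by (rule ext) (rule pd_eq[OF fourier_integral_has_derivative[OF assms]])

lemma schwartz_coord_i: "f \<in> schwartz \<Longrightarrow> (\<lambda>x. - \<i> * of_real (x \<bullet> b) * f x) \<in> schwartz"
  using schwartz_cmult[OF schwartz_coord[of f b], of "- \<i>"] by (simp add: mult.assoc)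

text \<open>Each power of \<open>\<xi>\<close> costs one derivative of \<open>f\<close>. With the \<open>l\<^sup>1\<close> norm of \<open>\<xi>\<close> the step from one power to
  the next is an identity, so the induction over all Schwartz functions at once is immediate.\<close>

lemma rapid_fourier_integral:
  fixes f :: "'a::euclidean_space \<Rightarrow> complex"
  assumes "f \<in> schwartz" shows "rapid (fourier_integral f)"
proof -
  let ?s = "\<lambda>\<xi>::'a. 1 + (\<Sum>b\<in>Basis. \<bar>\<xi> \<bullet> b\<bar>)"
  have "\<exists>C. \<forall>\<xi>. ?s \<xi> ^ N * norm (fourier_integral g \<xi>) \<le> C" if "g \<in> schwartz" for N and g :: "'a \<Rightarrow> complex"
    using that
  proof (induction N arbitrary: g)
    case 0
    then show ?case using fourier_integral_bound[of g] by auto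
  next
    case (Suc N)
    from Suc.IH[OF Suc.prems] obtain C where C: "\<And>\<xi>. ?s \<xi> ^ N * norm (fourier_integral g \<xi>) \<le> C" by blast
    have "\<forall>b\<in>Basis. \<exists>D. \<forall>\<xi>. ?s \<xi> ^ N * norm (fourier_integral (pd b g) \<xi>) \<le> D"
      using Suc.IH[OF schwartz_pd[OF Suc.prems]] by blast
    then obtain D where D: "\<And>b \<xi>. b \<in> Basis \<Longrightarrow> ?s \<xi> ^ N * norm (fourier_integral (pd b g) \<xi>) \<le> D b"
      by metis
    have "?s \<xi> ^ Suc N * norm (fourier_integral g \<xi>) \<le> C + sum D Basis" for \<xi>
    proof -
      have "?s \<xi> ^ Suc N * norm (fourier_integral g \<xi>)
          = ?s \<xi> ^ N * norm (fourier_integral g \<xi>) + (\<Sum>b\<in>Basis. ?s \<xi> ^ N * norm (fourier_integral (pd b g) \<xi>))"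
        by (simp add: fourier_integral_pd[OF Suc.prems] norm_mult sum_distrib_left sum_distrib_right algebra_simps)
      also have "\<dots> \<le> C + sum D Basis"
        by (intro add_mono C sum_mono D)
      finally show ?thesis .
    qed
    then show ?case by blast
  qed
  note * = this[OF assms]
  show ?thesis
    unfolding rapid_def
  proof
    fix N
    obtain C where C: "\<And>\<xi>. ?s \<xi> ^ N * norm (fourier_integral f \<xi>) \<le> C" using *[of N] by blast
    have "norm (fourier_integral f \<xi>) \<le> C / (1 + norm \<xi>) ^ N" for \<xi>
    proof -
      have "(1 + norm \<xi>) ^ N \<le> ?s \<xi> ^ N"
        using norm_le_l1[of \<xi>] by (intro power_mono) auto
      then have "(1 + norm \<xi>) ^ N * norm (fourier_integral f \<xi>) \<le> C"
        using C[of \<xi>] by (meson mult_right_mono norm_ge_zero order_trans)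
      moreover have "0 < (1 + norm \<xi>) ^ N" by (rule one_plus_norm_power_pos)
      ultimately show ?thesis by (simp add: pos_le_divide_eq mult.commute)
    qed
    then show "\<exists>C. \<forall>\<xi>. norm (fourier_integral f \<xi>) \<le> C / (1 + norm \<xi>) ^ N" by blast
  qed
qed

lemma fourier_integral_schwartz:
  assumes "f \<in> schwartz" shows "fourier_integral f \<in> schwartz"
proof (rule schwartz_coinduct[where P = "fourier_integral ` schwartz"])
  show "g differentiable at x" if "g \<in> fourier_integral ` schwartz" for g x
    using that by (auto intro: differentiableI[OF fourier_integral_has_derivative])
  show "rapid g" if "g \<in> fourier_integral ` schwartz" for g
    using that rapid_fourier_integral by auto
  show "pd b g \<in> fourier_integral ` schwartz" if "g \<in> fourier_integral ` schwartz" "b \<in> Basis" for g b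
  proof -
    from that(1) obtain h where h: "g = fourier_integral h" "h \<in> schwartz" ..
    show ?thesis
      unfolding h(1) pd_fourier_integral[OF h(2)] by (intro imageI schwartz_coord_i h)
  qed
qed (use assms in auto)

lemma laplacian_eq: "laplacian f x = (\<Sum>b\<in>Basis. pd b (pd b f) x)"
  by (simp add: laplacian_def pd_def[abs_def])

lemma norm_sq_eq_sum: "(norm x)\<^sup>2 = (\<Sum>b\<in>Basis. (x \<bullet> b)\<^sup>2)" for x :: "'a::euclidean_space"
  unfolding power2_norm_eq_inner by (subst euclidean_inner) (simp add: power2_eq_square)

lemma laplacian_fourier_integral:
  assumes f: "f \<in> schwartz"
  shows "laplacian (fourier_integral f) \<xi> = fourier_integral (\<lambda>x. - of_real ((norm x)\<^sup>2) * f x) \<xi>"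
proof -
  have "pd b (pd b (fourier_integral f)) = fourier_integral (\<lambda>x. - of_real ((x \<bullet> b)\<^sup>2) * f x)" for b
    unfolding pd_fourier_integral[OF f] pd_fourier_integral[OF schwartz_coord_i[OF f]]
    by (rule arg_cong[where f = fourier_integral]) (auto simp: power2_eq_square algebra_simps)
  then have "laplacian (fourier_integral f) \<xi> = (\<Sum>b\<in>Basis. fourier_integral (\<lambda>x. - of_real ((x \<bullet> b)\<^sup>2) * f x) \<xi>)"
    by (simp add: laplacian_eq)
  also have "\<dots> = fourier_integral (\<lambda>x. \<Sum>b\<in>Basis. - of_real ((x \<bullet> b)\<^sup>2) * f x) \<xi>"
  proof -
    have "(\<lambda>x. - of_real ((x \<bullet> b)\<^sup>2) * f x) \<in> schwartz" for b
      using schwartz_cmult[OF schwartz_coord[OF schwartz_coord[OF f], of b b], of "-1"]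
      by (simp add: power2_eq_square mult.assoc)
    note int = integrable_character[OF schwartz_integrable[OF this]]
    have "(LINT x|lborel. (\<Sum>b\<in>Basis. exp (- \<i> * of_real (x \<bullet> \<xi>)) * (- of_real ((x \<bullet> b)\<^sup>2) * f x)))
        = (\<Sum>b\<in>Basis. (LINT x|lborel. exp (- \<i> * of_real (x \<bullet> \<xi>)) * (- of_real ((x \<bullet> b)\<^sup>2) * f x)))"
      by (rule Bochner_Integration.integral_sum) (rule int)
    then show ?thesis
      unfolding fourier_integral_def by (simp only: sum_distrib_left)
  qed
  also have "(\<lambda>x. \<Sum>b\<in>Basis. - of_real ((x \<bullet> b)\<^sup>2) * f x) = (\<lambda>x. - of_real ((norm x)\<^sup>2) * f x)"
    unfolding norm_sq_eq_sum by (simp add: sum_distrib_right sum_negf)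
  finally show ?thesis .
qed


lemma fourier_integral_multiplication:
  assumes f: "integrable lborel f" and g: "integrable lborel g"
  shows "(LINT \<xi>|lborel. fourier_integral f \<xi> * g \<xi>) = (LINT x|lborel. f x * fourier_integral g x)"
proof -
  let ?E = "\<lambda>x \<xi>. exp (- \<i> * complex_of_real (x \<bullet> \<xi>))"
  let ?k = "complex_of_real ((2 * pi) powr (- real DIM('a) / 2))"
  have [measurable]: "f \<in> borel_measurable borel" "g \<in> borel_measurable borel" using f g by auto
  have int: "integrable (lborel \<Otimes>\<^sub>M lborel) (\<lambda>(x, \<xi>). ?E x \<xi> * f x * g \<xi>)"
  proof (rule lborel_pair.Fubini_integrable)
    show "(\<lambda>(x, \<xi>). ?E x \<xi> * f x * g \<xi>) \<in> borel_measurable (lborel \<Otimes>\<^sub>M lborel)" by measurable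
    have "integrable lborel (\<lambda>x. norm (f x) * (LINT \<xi>|lborel. norm (g \<xi>)))"
      using f by auto
    then show "integrable lborel (\<lambda>x. LINT \<xi>|lborel. norm (case (x, \<xi>) of (x, \<xi>) \<Rightarrow> ?E x \<xi> * f x * g \<xi>))"
      by (simp add: norm_mult del: mult_minus_left)
    show "AE x in lborel. integrable lborel (\<lambda>\<xi>. case (x, \<xi>) of (x, \<xi>) \<Rightarrow> ?E x \<xi> * f x * g \<xi>)"
    proof (rule AE_I2)
      fix x
      have "integrable lborel (\<lambda>\<xi>. f x * (exp (- \<i> * of_real (\<xi> \<bullet> x)) * g \<xi>))"
        by (intro integrable_mult_right integrable_character g)
      then show "integrable lborel (\<lambda>\<xi>. case (x, \<xi>) of (x, \<xi>) \<Rightarrow> ?E x \<xi> * f x * g \<xi>)"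
        by (simp add: inner_commute mult_ac del: mult_minus_left)
    qed
  qed
  have "(LINT \<xi>|lborel. fourier_integral f \<xi> * g \<xi>) = (LINT \<xi>|lborel. ?k * (LINT x|lborel. ?E x \<xi> * f x * g \<xi>))"
    unfolding fourier_integral_def by (simp only: integral_mult_left_zero) (simp only: mult.assoc)
  also have "\<dots> = ?k * (LINT x|lborel. (LINT \<xi>|lborel. ?E x \<xi> * f x * g \<xi>))"
    using lborel_pair.Fubini_integral[OF int] by simp
  also have "\<dots> = ?k * (LINT x|lborel. f x * (LINT \<xi>|lborel. exp (- \<i> * of_real (\<xi> \<bullet> x)) * g \<xi>))"
    unfolding integral_mult_right_zero[symmetric] by (simp add: mult_ac inner_commute del: mult_minus_left)
  also have "\<dots> = (LINT x|lborel. f x * fourier_integral g x)"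
    unfolding fourier_integral_def mult.left_commute[of "f x" for x] integral_mult_right_zero ..
  finally show ?thesis .
qed

subsection \<open>The Gaussian\<close>

lemma
  fixes f :: "'a::euclidean_space \<Rightarrow> real \<Rightarrow> complex"
  assumes f: "\<And>b. b \<in> Basis \<Longrightarrow> integrable lborel (f b)"
  shows integral_lborel_prod: "(LINT x|lborel. (\<Prod>b\<in>Basis. f b (x \<bullet> b))) = (\<Prod>b\<in>Basis. LINT t|lborel. f b t)"
proof -
  interpret product_sigma_finite "\<lambda>_::'a. lborel :: real measure" by standard
  have [measurable]: "b \<in> Basis \<Longrightarrow> f b \<in> borel_measurable borel" for b using f by auto
  have "(LINT x|lborel. (\<Prod>b\<in>Basis. f b (x \<bullet> b)))
      = (LINT x|distr (\<Pi>\<^sub>M b\<in>Basis. lborel) borel (\<lambda>x. \<Sum>b\<in>Basis. x b *\<^sub>R b). (\<Prod>b\<in>Basis. f b (x \<bullet> b)))"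
    by (subst lborel_eq) simp
  also have "\<dots> = (LINT x|(\<Pi>\<^sub>M b\<in>(Basis::'a set). lborel). (\<Prod>b\<in>Basis. f b ((\<Sum>b\<in>Basis. x b *\<^sub>R b) \<bullet> b)))"
    by (rule integral_distr) measurable
  also have "\<dots> = (LINT x|(\<Pi>\<^sub>M b\<in>(Basis::'a set). lborel). (\<Prod>b\<in>Basis. f b (x b)))"
    by (intro Bochner_Integration.integral_cong refl prod.cong) (simp add: inner_sum_left_Basis)
  also have "\<dots> = (\<Prod>b\<in>Basis. LINT t|lborel. f b t)"
    by (rule product_integral_prod) (use f in auto)
  finally show ?thesis .
qed

definition gauss :: "'a::euclidean_space \<Rightarrow> real" where
  "gauss x = exp (- (norm x)\<^sup>2 / 2)"

lemma gauss_pos: "0 < gauss x" and gauss_le_1: "gauss x \<le> 1" and gauss_0 [simp]: "gauss 0 = 1"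
  by (auto simp: gauss_def)

lemma gauss_shift_schwartz: "c \<noteq> 0 \<Longrightarrow> (\<lambda>x. complex_of_real (gauss (c *\<^sub>R (x - a)))) \<in> schwartz"
  using gauss_schwartz[of "c\<^sup>2 / 2" a] by (simp add: gauss_def power_mult_distrib)

lemma schwartz_gauss: "(\<lambda>x. complex_of_real (gauss x)) \<in> schwartz"
  using gauss_shift_schwartz[of 1 0] by simp

lemma gauss_measurable [measurable]: "gauss \<in> borel_measurable borel"
  unfolding gauss_def[abs_def] by measurable

lemma integrable_gauss: "integrable lborel (gauss :: 'a::euclidean_space \<Rightarrow> real)"
  using schwartz_integrable[OF schwartz_gauss[where 'a='a]] by (simp add: complex_of_real_integrable_eq)

lemma gauss_dilate_tendsto: "(\<lambda>n. gauss (\<xi> /\<^sub>R real (Suc n))) \<longlonglongrightarrow> 1"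
proof -
  have "(\<lambda>n. exp (- (norm (inverse (real (Suc n)) *\<^sub>R \<xi>))\<^sup>2 / 2)) \<longlonglongrightarrow> exp (- (norm (0 *\<^sub>R \<xi>))\<^sup>2 / 2)"
    by (intro tendsto_intros LIMSEQ_inverse_real_of_nat) auto
  then show ?thesis
    unfolding gauss_def by (simp del: of_nat_Suc)
qed

lemma gauss_transform_real:
  "(LINT x|lborel. exp (- \<i> * complex_of_real (x * t)) * complex_of_real (exp (- x\<^sup>2 / 2)))
    = complex_of_real (sqrt (2 * pi) * exp (- t\<^sup>2 / 2))"
proof -
  have "complex_of_real (exp (- (- t)\<^sup>2 / 2)) = char std_normal_distribution (- t)"
    by (simp add: char_std_normal_distribution)
  also have "\<dots> = (LINT x|lborel. std_normal_density x *\<^sub>R iexp (- t * x))"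
    unfolding char_def by (rule integral_density) auto
  also have "\<dots> = (LINT x|lborel. complex_of_real (1 / sqrt (2 * pi)) *
      (exp (- \<i> * complex_of_real (x * t)) * complex_of_real (exp (- x\<^sup>2 / 2))))"
    by (intro Bochner_Integration.integral_cong refl)
      (simp add: std_normal_density_def scaleR_conv_of_real mult_ac)
  also have "\<dots> = complex_of_real (1 / sqrt (2 * pi)) * 
      (LINT x|lborel. exp (- \<i> * complex_of_real (x * t)) * complex_of_real (exp (- x\<^sup>2 / 2)))"
    by (rule integral_mult_right_zero)
  finally show ?thesis by (simp add: field_simps)
qed

text \<open>The integrand is a product over the coordinates, which reduces the claim to the characteristic
  function of the normal distribution.\<close>

lemma gauss_transform:
  fixes \<xi> :: "'a::euclidean_space"
  shows "(LINT x|lborel. exp (- \<i> * of_real (x \<bullet> \<xi>)) * of_real (gauss x))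
    = complex_of_real ((2 * pi) powr (real DIM('a) / 2) * gauss \<xi>)"
proof -
  let ?f = "\<lambda>b t. exp (- \<i> * complex_of_real (t * (\<xi> \<bullet> b))) * complex_of_real (exp (- t\<^sup>2 / 2))"
  have "exp (- \<i> * of_real (x \<bullet> \<xi>)) * of_real (gauss x) = (\<Prod>b\<in>Basis. ?f b (x \<bullet> b))" for x
  proof -
    have "exp (- \<i> * complex_of_real (x \<bullet> \<xi>)) = (\<Prod>b\<in>Basis. exp (- \<i> * complex_of_real ((x \<bullet> b) * (\<xi> \<bullet> b))))"
      by (subst exp_sum[symmetric]) (auto simp: euclidean_inner[of x \<xi>] sum_distrib_left)
    moreover have "gauss x = (\<Prod>b\<in>Basis. exp (- (x \<bullet> b)\<^sup>2 / 2))"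
      by (subst exp_sum[symmetric]) (auto simp: gauss_def norm_sq_eq_sum sum_negf sum_divide_distrib)
    ultimately show ?thesis by (simp add: prod.distrib)
  qed
  then have "(LINT x|lborel. exp (- \<i> * of_real (x \<bullet> \<xi>)) * of_real (gauss x))
      = (LINT x|lborel. (\<Prod>b\<in>Basis. ?f b (x \<bullet> b)))" by simp
  also have "\<dots> = (\<Prod>b\<in>Basis. LINT t|lborel. ?f b t)"
  proof (rule integral_lborel_prod)
    fix b :: 'a
    have "integrable lborel (\<lambda>t::real. complex_of_real (exp (- t\<^sup>2 / 2)))"
      using schwartz_integrable[OF schwartz_gauss[where 'a=real]] by (simp add: gauss_def)
    from integrable_character[OF this, of "\<xi> \<bullet> b"] show "integrable lborel (?f b)" by simp
  qed
  also have "\<dots> = (\<Prod>b\<in>Basis. complex_of_real (sqrt (2 * pi) * exp (- (\<xi> \<bullet> b)\<^sup>2 / 2)))"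
    by (simp only: gauss_transform_real)
  also have "\<dots> = complex_of_real (sqrt (2 * pi) ^ DIM('a) * (\<Prod>b\<in>Basis. exp (- (\<xi> \<bullet> b)\<^sup>2 / 2)))"
    by (simp only: of_real_prod[symmetric] prod.distrib prod_constant)
  also have "(\<Prod>b\<in>Basis. exp (- (\<xi> \<bullet> b)\<^sup>2 / 2)) = gauss \<xi>"
    by (subst exp_sum[symmetric]) (auto simp: gauss_def norm_sq_eq_sum sum_negf sum_divide_distrib)
  also have "sqrt (2 * pi) ^ DIM('a) = (2 * pi) powr (real DIM('a) / 2)"
    by (simp add: powr_half_sqrt[symmetric] powr_realpow[symmetric] powr_powr)
  finally show ?thesis .
qed

lemma integral_gauss: "(LINT x|lborel. gauss (x::'a::euclidean_space)) = (2 * pi) powr (real DIM('a) / 2)"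
proof -
  have "complex_of_real (LINT x|lborel. gauss (x::'a)) = of_real ((2 * pi) powr (real DIM('a) / 2))"
    using gauss_transform[of "0::'a"] by simp
  then show ?thesis unfolding of_real_eq_iff .
qed

text \<open>A plane wave cut off at scale \<open>r\<close>; its transform is an approximate identity.\<close>

definition gauss_wave :: "real \<Rightarrow> 'a::euclidean_space \<Rightarrow> 'a \<Rightarrow> complex" where
  "gauss_wave r x \<xi> = exp (- \<i> * of_real (\<xi> \<bullet> x)) * of_real (gauss (\<xi> /\<^sub>R r))"

lemma integrable_gauss_wave: "0 < r \<Longrightarrow> integrable lborel (gauss_wave r x)"
  unfolding gauss_wave_def[abs_def]
  using gauss_shift_schwartz[of "inverse r" 0]
  by (intro integrable_character schwartz_integrable) simp

lemma fourier_gauss_wave: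
  fixes x :: "'a::euclidean_space"
  assumes r: "0 < r"
  shows "fourier_integral (gauss_wave r x) y = of_real (r ^ DIM('a) * gauss (r *\<^sub>R (x + y)))"
proof -
  have [measurable]: "gauss_wave r x \<in> borel_measurable borel" using integrable_gauss_wave[OF r, of x] by auto
  have "(LINT \<xi>|lborel. exp (- \<i> * of_real (\<xi> \<bullet> y)) * gauss_wave r x \<xi>)
      = \<bar>r\<bar> ^ DIM('a) *\<^sub>R (LINT \<xi>|lborel. exp (- \<i> * of_real ((0 + r *\<^sub>R \<xi>) \<bullet> y)) * gauss_wave r x (0 + r *\<^sub>R \<xi>))"
    by (rule integral_lborel_affine) (use r in auto)
  also have "(LINT \<xi>|lborel. exp (- \<i> * of_real ((0 + r *\<^sub>R \<xi>) \<bullet> y)) * gauss_wave r x (0 + r *\<^sub>R \<xi>))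
      = (LINT \<xi>|lborel. exp (- \<i> * of_real (\<xi> \<bullet> (r *\<^sub>R (x + y)))) * of_real (gauss \<xi>))"
    using r by (intro Bochner_Integration.integral_cong refl)
      (simp add: gauss_wave_def exp_add[symmetric] inner_add_right algebra_simps)
  finally show ?thesis
    using r unfolding fourier_integral_def gauss_transform
    by (simp add: scaleR_conv_of_real powr_minus[symmetric] powr_minus_divide)
qed

text \<open>Fourier inversion: a Gaussian of width \<open>n\<close> is inserted into the inversion integral and moved
  to the other side by the multiplication formula, where it has become an approximate identity.\<close>

theorem fourier_inversion:
  fixes f :: "'a::euclidean_space \<Rightarrow> complex"
  assumes f: "integrable lborel f" and cont: "continuous_on UNIV f" and bd: "\<And>x. norm (f x) \<le> C"
    and Ff: "integrable lborel (fourier_integral f)"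
  shows "fourier_integral (fourier_integral f) x = f (- x)"
proof -
  let ?k = "complex_of_real ((2 * pi) powr (- real DIM('a) / 2))"
  let ?E = "\<lambda>\<xi>. exp (- \<i> * complex_of_real (\<xi> \<bullet> x))"
  have [measurable]: "f \<in> borel_measurable borel" using f by auto
  define g where "g n = gauss_wave (real (Suc n)) x" for n
  have gi: "integrable lborel (g n)" for n
    unfolding g_def by (rule integrable_gauss_wave) simp
  have g_ft: "fourier_integral (g n) y = of_real (real (Suc n) ^ DIM('a) * gauss (real (Suc n) *\<^sub>R (x + y)))" for n y
    unfolding g_def by (rule fourier_gauss_wave) simp
  have lhs: "(\<lambda>n. LINT \<xi>|lborel. fourier_integral f \<xi> * g n \<xi>) \<longlonglongrightarrow> (LINT \<xi>|lborel. ?E \<xi> * fourier_integral f \<xi>)"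
  proof (rule integral_dominated_convergence[where w = "\<lambda>\<xi>. norm (fourier_integral f \<xi>)"])
    show "AE \<xi> in lborel. (\<lambda>n. fourier_integral f \<xi> * g n \<xi>) \<longlonglongrightarrow> ?E \<xi> * fourier_integral f \<xi>"
    proof (rule AE_I2)
      fix \<xi> :: 'a
      have "(\<lambda>n. fourier_integral f \<xi> * (?E \<xi> * of_real (gauss (\<xi> /\<^sub>R real (Suc n))))) \<longlonglongrightarrow> fourier_integral f \<xi> * (?E \<xi> * of_real 1)"
        by (intro tendsto_intros gauss_dilate_tendsto)
      then show "(\<lambda>n. fourier_integral f \<xi> * g n \<xi>) \<longlonglongrightarrow> ?E \<xi> * fourier_integral f \<xi>"
        unfolding g_def gauss_wave_def by (simp add: mult.commute)
    qed
    show "AE \<xi> in lborel. norm (fourier_integral f \<xi> * g n \<xi>) \<le> norm (fourier_integral f \<xi>)" for n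
    proof (rule AE_I2)
      fix \<xi> :: 'a
      have "norm (g n \<xi>) \<le> 1"
        unfolding g_def gauss_wave_def norm_mult norm_of_real norm_character
        using gauss_pos[of "\<xi> /\<^sub>R real (Suc n)"] gauss_le_1[of "\<xi> /\<^sub>R real (Suc n)"] by linarith
      then show "norm (fourier_integral f \<xi> * g n \<xi>) \<le> norm (fourier_integral f \<xi>)"
        unfolding norm_mult by (simp add: mult_left_le)
    qed
    show "(\<lambda>\<xi>. fourier_integral f \<xi> * g n \<xi>) \<in> borel_measurable lborel" for n
      using gi[of n] by simp
  qed (use Ff in auto)
  have "(LINT \<xi>|lborel. fourier_integral f \<xi> * g n \<xi>) = (LINT u|lborel. f (- x + inverse (real (Suc n)) *\<^sub>R u) * of_real (gauss u))" for n
  proof -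
    have "(LINT \<xi>|lborel. fourier_integral f \<xi> * g n \<xi>) = (LINT y|lborel. f y * of_real (real (Suc n) ^ DIM('a) * gauss (real (Suc n) *\<^sub>R (x + y))))"
      unfolding fourier_integral_multiplication[OF f gi] g_ft ..
    also have "\<dots> = \<bar>inverse (real (Suc n))\<bar> ^ DIM('a) *\<^sub>R (LINT u|lborel. f (- x + inverse (real (Suc n)) *\<^sub>R u) * of_real (real (Suc n) ^ DIM('a) * gauss (real (Suc n) *\<^sub>R (x + (- x + inverse (real (Suc n)) *\<^sub>R u)))))"
      by (rule integral_lborel_affine) auto
    also have "\<dots> = \<bar>inverse (real (Suc n))\<bar> ^ DIM('a) *\<^sub>R (LINT u|lborel. of_real (real (Suc n) ^ DIM('a)) * (f (- x + inverse (real (Suc n)) *\<^sub>R u) * of_real (gauss u)))"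
      by (simp add: mult_ac del: of_nat_Suc)
    also have "\<dots> = (LINT u|lborel. f (- x + inverse (real (Suc n)) *\<^sub>R u) * of_real (gauss u))"
      unfolding integral_mult_right_zero by (simp add: scaleR_conv_of_real power_inverse del: of_nat_Suc)
    finally show ?thesis .
  qed
  moreover have "(\<lambda>n. LINT u|lborel. f (- x + inverse (real (Suc n)) *\<^sub>R u) * of_real (gauss u)) \<longlonglongrightarrow> (LINT u|lborel. f (- x) * of_real (gauss (u::'a)))"
  proof (rule integral_dominated_convergence[where w = "\<lambda>u. C * gauss u"])
    show "AE u in lborel. (\<lambda>n. f (- x + inverse (real (Suc n)) *\<^sub>R u) * of_real (gauss u)) \<longlonglongrightarrow> f (- x) * of_real (gauss u)"
    proof (rule AE_I2)
      fix u :: 'a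
      have "(\<lambda>n. - x + inverse (real (Suc n)) *\<^sub>R u) \<longlonglongrightarrow> - x + 0 *\<^sub>R u"
        by (intro tendsto_intros LIMSEQ_inverse_real_of_nat)
      then have "(\<lambda>n. f (- x + inverse (real (Suc n)) *\<^sub>R u)) \<longlonglongrightarrow> f (- x)"
        using cont by (intro continuous_on_tendsto_compose[OF cont]) auto
      then show "(\<lambda>n. f (- x + inverse (real (Suc n)) *\<^sub>R u) * of_real (gauss u)) \<longlonglongrightarrow> f (- x) * of_real (gauss u)"
        by (intro tendsto_intros)
    qed
    show "AE u in lborel. norm (f (- x + inverse (real (Suc n)) *\<^sub>R u) * of_real (gauss u)) \<le> C * gauss u" for n
      unfolding norm_mult norm_of_real abs_of_pos[OF gauss_pos]
      by (intro AE_I2 mult_right_mono bd less_imp_le[OF gauss_pos])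
    show "integrable lborel (\<lambda>u::'a. C * gauss u)" by (intro integrable_mult_right integrable_gauss)
  qed auto
  ultimately have "(LINT \<xi>|lborel. ?E \<xi> * fourier_integral f \<xi>) = (LINT u|lborel. f (- x) * of_real (gauss (u::'a)))"
    using LIMSEQ_unique[OF lhs] by simp
  then show ?thesis
    unfolding fourier_integral_def[of "fourier_integral f"]
    by (simp add: integral_gauss powr_minus field_simps)
qed

corollary schwartz_inversion: "f \<in> schwartz \<Longrightarrow> fourier_integral (fourier_integral f) x = f (- x)"
  using schwartz_bounded by (metis fourier_inversion schwartz_integrable schwartz_continuous fourier_integral_schwartz)

lemma fourier_integral_reflect:
  assumes [measurable]: "h \<in> borel_measurable borel"
  shows "fourier_integral (\<lambda>x. h (- x)) \<xi> = fourier_integral h (- \<xi>)"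
  unfolding fourier_integral_def
  by (subst integral_lborel_affine[of "-1" _ 0]) auto

lemma schwartz_is_fourier_integral:
  assumes "f \<in> schwartz" shows "\<exists>g\<in>schwartz. fourier_integral g = f"
proof
  show "(\<lambda>x. fourier_integral f (- x)) \<in> schwartz"
    by (intro schwartz_reflect fourier_integral_schwartz assms)
  have "fourier_integral (\<lambda>x. fourier_integral f (- x)) \<xi> = fourier_integral (fourier_integral f) (- \<xi>)" for \<xi>
    by (rule fourier_integral_reflect) (intro schwartz_measurable fourier_integral_schwartz assms)
  then show "fourier_integral (\<lambda>x. fourier_integral f (- x)) = f"
    using schwartz_inversion[OF assms] by auto
qed

section \<open>Uniqueness of the Fourier transform of tempered functions\<close>

text \<open>The positive and the negative part of \<open>h\<close> are densities of two measures that agree on boxes, and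
  boxes generate the Borel sets.\<close>

lemma AE_zero_if_integral_boxes_zero_real:
  fixes h :: "'a::euclidean_space \<Rightarrow> real"
  assumes [measurable]: "h \<in> borel_measurable borel"
    and int: "\<And>a b. integrable lborel (\<lambda>x. indicator (box a b) x * h x)"
    and zero: "\<And>a b. (LINT x|lborel. indicator (box a b) x * h x) = 0"
  shows "AE x in lborel. h x = 0"
proof -
  let ?P = "density lborel (\<lambda>x. ennreal (h x))" and ?N = "density lborel (\<lambda>x. ennreal (- h x))"
  have em: "emeasure (density lborel (\<lambda>x. ennreal (c * h x))) (box a b) = ennreal (LINT x|lborel. indicator (box a b) x * max 0 (c * h x))"
    "emeasure (density lborel (\<lambda>x. ennreal (c * h x))) (box a b) \<noteq> \<infinity>"
    "integrable lborel (\<lambda>x. indicator (box a b) x * max 0 (c * h x))"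
    if c: "\<bar>c\<bar> = 1" for a b c
  proof -
    have "c = 1 \<or> c = -1" using c by auto
    then show i: "integrable lborel (\<lambda>x. indicator (box a b) x * max 0 (c * h x))"
      by (intro Bochner_Integration.integrable_bound[OF int[of a b]] AE_I2) (auto simp: indicator_def)
    have "emeasure (density lborel (\<lambda>x. ennreal (c * h x))) (box a b) = (\<integral>\<^sup>+x. ennreal (c * h x) * indicator (box a b) x \<partial>lborel)"
      by (rule emeasure_density) auto
    also have "\<dots> = (\<integral>\<^sup>+x. ennreal (indicator (box a b) x * max 0 (c * h x)) \<partial>lborel)"
      by (intro nn_integral_cong) (auto simp: indicator_def max_def ennreal_neg)
    also have "\<dots> = ennreal (LINT x|lborel. indicator (box a b) x * max 0 (c * h x))"
      by (rule nn_integral_eq_integral[OF i]) (auto simp: indicator_def)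
    finally show eq: "emeasure (density lborel (\<lambda>x. ennreal (c * h x))) (box a b) = ennreal (LINT x|lborel. indicator (box a b) x * max 0 (c * h x))" .
    then show "emeasure (density lborel (\<lambda>x. ennreal (c * h x))) (box a b) \<noteq> \<infinity>" by simp
  qed
  have "?P = ?N"
  proof (rule measure_eqI_generator_eq)
    let ?E = "range (\<lambda>(a, b). box a b::'a set)"
    show "Int_stable ?E"
      by (auto simp: Int_stable_def box_Int_box)
    show "?E \<subseteq> Pow UNIV" "sets ?P = sigma_sets UNIV ?E" "sets ?N = sigma_sets UNIV ?E"
      by (simp_all add: borel_eq_box)
    let ?A = "\<lambda>n::nat. box (- (real n *\<^sub>R One)) (real n *\<^sub>R One) :: 'a set"
    show "range ?A \<subseteq> ?E" "(\<Union>i. ?A i) = UNIV"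
      unfolding UN_box_eq_UNIV by auto
    show "emeasure ?P (?A i) \<noteq> \<infinity>" for i
      using em(2)[of 1] by simp
    show "emeasure ?P X = emeasure ?N X" if XE: "X \<in> ?E" for X
    proof -
      from XE obtain a b where X: "X = box a b" by auto
      have "(LINT x|lborel. indicator (box a b) x * max 0 (h x)) - (LINT x|lborel. indicator (box a b) x * max 0 (- h x))
          = (LINT x|lborel. indicator (box a b) x * max 0 (h x) - indicator (box a b) x * max 0 (- h x))"
        using em(3)[of 1 a b] em(3)[of "-1" a b] by simp
      also have "\<dots> = (LINT x|lborel. indicator (box a b) x * h x)"
        by (intro Bochner_Integration.integral_cong refl) (auto simp: max_def indicator_def)
      finally show ?thesis
        unfolding X using em(1)[of 1 a b] em(1)[of "-1" a b] zero[of a b] by simp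
    qed
  qed
  then have "AE x in lborel. ennreal (h x) = ennreal (- h x)"
    by (rule sigma_finite_measure.density_unique[OF sigma_finite_lborel, rotated 2]) auto
  then show ?thesis
  proof eventually_elim
    case (elim x)
    then show ?case
      by (cases "0 \<le> h x") (auto simp: ennreal_neg ennreal_eq_0_iff)
  qed
qed

lemma AE_zero_if_integral_boxes_zero:
  fixes g :: "'a::euclidean_space \<Rightarrow> complex"
  assumes [measurable]: "g \<in> borel_measurable borel"
    and int: "\<And>a b. integrable lborel (\<lambda>x. indicator (box a b) x * g x)"
    and zero: "\<And>a b. (LINT x|lborel. indicator (box a b) x * g x) = 0"
  shows "AE x in lborel. g x = 0"
proof -
  have R: "Re (indicator (box a b) x * g x) = indicator (box a b) x * Re (g x)"
    and I: "Im (indicator (box a b) x * g x) = indicator (box a b) x * Im (g x)" for a b x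
    by (auto simp: indicator_def)
  have "AE x in lborel. Re (g x) = 0"
  proof (rule AE_zero_if_integral_boxes_zero_real)
    fix a b :: 'a
    show "integrable lborel (\<lambda>x. indicator (box a b) x * Re (g x))"
      using integrable_Re[OF int[of a b]] unfolding R .
    show "(LINT x|lborel. indicator (box a b) x * Re (g x)) = 0"
      using integral_Re[OF int[of a b]] unfolding R zero by simp
  qed simp
  moreover have "AE x in lborel. Im (g x) = 0"
  proof (rule AE_zero_if_integral_boxes_zero_real)
    fix a b :: 'a
    show "integrable lborel (\<lambda>x. indicator (box a b) x * Im (g x))"
      using integrable_Im[OF int[of a b]] unfolding I .
    show "(LINT x|lborel. indicator (box a b) x * Im (g x)) = 0"
      using integral_Im[OF int[of a b]] unfolding I zero by simp
  qed simp
  ultimately show ?thesis by eventually_elim (simp add: complex_eq_iff)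
qed

text \<open>The indicator of \<open>B\<close> convolved with an unnormalised Gaussian of width \<open>r\<close>. As a function of \<open>x\<close>,
  for bounded \<open>B\<close>, it is dominated, uniformly in \<open>r \<le> 1\<close>, by any power of \<open>1 / (1 + |x|)\<close>; so pairing it with a
  tempered function commutes with \<open>r \<rightarrow> 0\<close>.\<close>

definition smear :: "'a::euclidean_space set \<Rightarrow> real \<Rightarrow> 'a \<Rightarrow> real" where
  "smear B r x = (LINT u|lborel. indicator B (x + r *\<^sub>R u) * gauss u)"

lemma integrable_smear: 
  assumes [measurable]: "B \<in> sets borel"
  shows "integrable lborel (\<lambda>u::'a::euclidean_space. indicator B (x + r *\<^sub>R u) * gauss u)"
  by (rule Bochner_Integration.integrable_bound[OF integrable_gauss])
    (auto simp: indicator_def)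

lemma smear_measurable [measurable]:
  assumes [measurable]: "B \<in> sets borel"
  shows "smear B r \<in> borel_measurable borel"
  unfolding smear_def[abs_def] by (rule lborel.borel_measurable_lebesgue_integral) measurable

lemma smear_nonneg: "0 \<le> smear B r x"
  unfolding smear_def by (intro integral_nonneg_AE) (auto intro!: mult_nonneg_nonneg less_imp_le[OF gauss_pos])

lemma integrable_gauss_power: "integrable lborel (\<lambda>u::'a::euclidean_space. (1 + norm u) ^ N * gauss u)"
proof -
  have "rapid (\<lambda>u::'a. complex_of_real ((1 + norm u) ^ N) * of_real (gauss u))"
    by (rule rapid_mult[OF schwartz_rapid[OF schwartz_gauss], where C = 1 and k = N])
      (simp only: norm_of_real, simp)
  then have "integrable lborel (\<lambda>u::'a. complex_of_real ((1 + norm u) ^ N) * of_real (gauss u))"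
    by (intro rapid_integrable) measurable
  then have "integrable lborel (\<lambda>u::'a. complex_of_real ((1 + norm u) ^ N * gauss u))"
    by simp
  then show ?thesis unfolding complex_of_real_integrable_eq .
qed

lemma smear_bound:
  fixes B :: "'a::euclidean_space set"
  assumes B: "\<And>x. x \<in> B \<Longrightarrow> norm x \<le> R" and [measurable]: "B \<in> sets borel" and r: "0 \<le> r" "r \<le> 1" and "0 \<le> R"
  shows "smear B r x \<le> ((1 + R) ^ N * (LINT u|lborel. (1 + norm (u::'a)) ^ N * gauss u)) / (1 + norm x) ^ N"
proof -
  have "smear B r x \<le> (LINT u|lborel. ((1 + R) ^ N / (1 + norm x) ^ N) * ((1 + norm (u::'a)) ^ N * gauss u))"
    unfolding smear_def
  proof (rule integral_mono)
    fix u :: 'a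
    show "indicator B (x + r *\<^sub>R u) * gauss u \<le> ((1 + R) ^ N / (1 + norm x) ^ N) * ((1 + norm u) ^ N * gauss u)"
    proof (cases "x + r *\<^sub>R u \<in> B")
      case True
      have "norm (r *\<^sub>R u) \<le> norm u" using r by (simp add: mult_left_le_one_le)
      moreover have "norm x \<le> norm (x + r *\<^sub>R u) + norm (r *\<^sub>R u)"
        using norm_triangle_ineq4[of "x + r *\<^sub>R u" "r *\<^sub>R u"] by simp
      ultimately have "1 + norm x \<le> 1 + R + norm u" using B[OF True] by argo
      also have "\<dots> \<le> (1 + R) * (1 + norm u)" using \<open>0 \<le> R\<close> by (simp add: algebra_simps)
      finally have "(1 + norm x) ^ N \<le> (1 + R) ^ N * (1 + norm u) ^ N"
        unfolding power_mult_distrib[symmetric] by (intro power_mono) auto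
      moreover have "0 < (1 + norm x) ^ N" by (rule one_plus_norm_power_pos)
      ultimately have "1 \<le> ((1 + R) ^ N / (1 + norm x) ^ N) * (1 + norm u) ^ N" by (simp add: field_simps)
      from mult_right_mono[OF this less_imp_le[OF gauss_pos[of u]]] True show ?thesis by (simp add: mult.assoc)
    next
      case False
      then show ?thesis using \<open>0 \<le> R\<close> gauss_pos[of u] by simp
    qed
  qed (intro integrable_smear integrable_mult_right integrable_gauss_power; simp)+
  then show ?thesis by simp
qed

lemma smear_limit:
  fixes a b x :: "'a::euclidean_space"
  assumes "x \<notin> cbox a b - box a b"
  shows "(\<lambda>n. smear (box a b) (inverse (real (Suc n))) x) \<longlonglongrightarrow> indicator (box a b) x * (2 * pi) powr (real DIM('a) / 2)"
proof -
  have "(\<lambda>n. smear (box a b) (inverse (real (Suc n))) x) \<longlonglongrightarrow> (LINT u|lborel. indicator (box a b) x * gauss (u::'a))"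
    unfolding smear_def
  proof (rule integral_dominated_convergence[where w = gauss])
    show "AE u in lborel. (\<lambda>n. indicator (box a b) (x + inverse (real (Suc n)) *\<^sub>R u) * gauss u) \<longlonglongrightarrow> indicator (box a b) x * gauss u"
    proof (rule AE_I2)
      fix u :: 'a
      have "(\<lambda>n. x + inverse (real (Suc n)) *\<^sub>R u) \<longlonglongrightarrow> x + 0 *\<^sub>R u"
        by (intro tendsto_intros LIMSEQ_inverse_real_of_nat)
      then have lim: "(\<lambda>n. x + inverse (real (Suc n)) *\<^sub>R u) \<longlonglongrightarrow> x" by simp
      have "eventually (\<lambda>n. indicator (box a b) (x + inverse (real (Suc n)) *\<^sub>R u) = (indicator (box a b) x :: real)) sequentially"
      proof (cases "x \<in> box a b")
        case True
        from topological_tendstoD[OF lim open_box True] show ?thesis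
          by eventually_elim (simp add: True)
      next
        case False
        then have "x \<in> - cbox a b" using assms by auto
        from topological_tendstoD[OF lim _ this] have "eventually (\<lambda>n. x + inverse (real (Suc n)) *\<^sub>R u \<in> - cbox a b) sequentially"
          by (simp add: open_Compl closed_cbox)
        then show ?thesis
          by eventually_elim (use False box_subset_cbox[of a b] in \<open>auto simp: indicator_def simp del: of_nat_Suc\<close>)
      qed
      then have "eventually (\<lambda>n. indicator (box a b) (x + inverse (real (Suc n)) *\<^sub>R u) * gauss u = indicator (box a b) x * gauss u) sequentially"
        by eventually_elim simp
      then show "(\<lambda>n. indicator (box a b) (x + inverse (real (Suc n)) *\<^sub>R u) * gauss u) \<longlonglongrightarrow> indicator (box a b) x * gauss u"
        by (rule tendsto_eventually)
    qed
    show "AE u in lborel. norm (indicator (box a b) (x + inverse (real (Suc n)) *\<^sub>R u) * gauss u) \<le> gauss u" for n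
      by (intro AE_I2) (simp add: indicator_def less_imp_le[OF gauss_pos])
  qed (auto intro: integrable_gauss)
  then show ?thesis by (simp add: integral_gauss)
qed

lemma tempered_smear_integrable:
  fixes g :: "'a::euclidean_space \<Rightarrow> complex"
  assumes g: "tempered_fun g" and [measurable]: "B \<in> sets borel" and B: "\<And>x. x \<in> B \<Longrightarrow> norm x \<le> R" "0 \<le> R"
  obtains w where "integrable lborel w" "\<And>x r. 0 \<le> r \<Longrightarrow> r \<le> 1 \<Longrightarrow> norm (g x) * smear B r x \<le> w x"
proof -
  obtain N where N: "integrable lborel (\<lambda>x. norm (g x) / (1 + norm x) ^ N)"
    using g by (auto simp: tempered_fun_def)
  define C where "C = (1 + R) ^ N * (LINT u|lborel. (1 + norm (u::'a)) ^ N * gauss u)"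
  show ?thesis
  proof (rule that)
    show "integrable lborel (\<lambda>x. C * (norm (g x) / (1 + norm x) ^ N))" using N by (rule integrable_mult_right)
    show "norm (g x) * smear B r x \<le> C * (norm (g x) / (1 + norm x) ^ N)" if "0 \<le> r" "r \<le> 1" for x r
      using mult_left_mono[OF smear_bound[OF B(1) assms(2) that B(2), of x N] norm_ge_zero[of "g x"]]
      by (simp add: C_def mult.commute)
  qed
qed

text \<open>By Fubini the integral is an average over \<open>y\<close> in \<open>B\<close> of the pairings of \<open>g\<close> with Gaussians centred
  at \<open>y\<close>.\<close>

lemma integral_tempered_smear_zero:
  fixes g :: "'a::euclidean_space \<Rightarrow> complex"
  assumes g: "tempered_fun g" and zero: "\<And>\<psi>. \<psi> \<in> schwartz \<Longrightarrow> (LINT x|lborel. g x * \<psi> x) = 0"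
    and [measurable]: "B \<in> sets borel" and B: "\<And>x. x \<in> B \<Longrightarrow> norm x \<le> R" "0 \<le> R" and r: "0 < r" "r \<le> 1"
  shows "(LINT x|lborel. g x * of_real (smear B r x)) = 0"
proof -
  note [measurable] = tempered_measurable[OF g]
  obtain w where w: "integrable lborel w" "\<And>x r. 0 \<le> r \<Longrightarrow> r \<le> 1 \<Longrightarrow> norm (g x) * smear B r x \<le> w x"
    using tempered_smear_integrable[OF g assms(3) B] by blast
  let ?F = "\<lambda>x y. g x * of_real (indicator B y * gauss (inverse r *\<^sub>R (y - x)))"
  have gi: "integrable lborel (\<lambda>y. indicator B y * gauss (inverse r *\<^sub>R (y - x)))" for x :: 'a
  proof (rule Bochner_Integration.integrable_bound)
    have "(\<lambda>y. complex_of_real (gauss (inverse r *\<^sub>R (y - x)))) \<in> schwartz"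
      using r by (intro gauss_shift_schwartz) simp
    from schwartz_integrable[OF this] show "integrable lborel (\<lambda>y. gauss (inverse r *\<^sub>R (y - x)))"
      unfolding complex_of_real_integrable_eq .
  qed (auto simp: indicator_def)
  have sm: "(LINT y|lborel. indicator B y * gauss (inverse r *\<^sub>R (y - x))) = r ^ DIM('a) * smear B r x" for x
  proof -
    have "complex_of_real (LINT y|lborel. indicator B y * gauss (inverse r *\<^sub>R (y - x)))
        = (LINT y|lborel. complex_of_real (indicator B y * gauss (inverse r *\<^sub>R (y - x))))"
      by (rule integral_complex_of_real[symmetric])
    also have "\<dots> = \<bar>r\<bar> ^ DIM('a) *\<^sub>R (LINT u|lborel. complex_of_real (indicator B (x + r *\<^sub>R u) * gauss (inverse r *\<^sub>R (x + r *\<^sub>R u - x))))"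
      by (rule integral_lborel_affine) (use r in auto)
    also have "\<dots> = complex_of_real (r ^ DIM('a) * smear B r x)"
      using r unfolding smear_def integral_complex_of_real by (simp add: scaleR_conv_of_real)
    finally show ?thesis unfolding of_real_eq_iff .
  qed
  have int: "integrable (lborel \<Otimes>\<^sub>M lborel) (\<lambda>(x, y). ?F x y)"
  proof (rule lborel_pair.Fubini_integrable)
    show "(\<lambda>(x, y). ?F x y) \<in> borel_measurable (lborel \<Otimes>\<^sub>M lborel)" by measurable
    show "AE x in lborel. integrable lborel (\<lambda>y. case (x, y) of (x, y) \<Rightarrow> ?F x y)"
      using gi by (intro AE_I2) (simp only: prod.case integrable_mult_right complex_of_real_integrable_eq)
    have "(LINT y|lborel. norm (case (x, y) of (x, y) \<Rightarrow> ?F x y)) = r ^ DIM('a) * (norm (g x) * smear B r x)" for x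
    proof -
      have "norm (?F x y) = norm (g x) * (indicator B y * gauss (inverse r *\<^sub>R (y - x)))" for y
        using gauss_pos[of "inverse r *\<^sub>R (y - x)"] unfolding norm_mult norm_of_real by (simp add: abs_mult)
      then show ?thesis by (simp add: sm)
    qed
    moreover have "integrable lborel (\<lambda>x. r ^ DIM('a) * (norm (g x) * smear B r x))"
      using w r by (intro integrable_mult_right Bochner_Integration.integrable_bound[OF w(1)])
        (auto simp: abs_mult smear_nonneg intro!: AE_I2 order_trans[OF w(2) abs_ge_self])
    ultimately show "integrable lborel (\<lambda>x. LINT y|lborel. norm (case (x, y) of (x, y) \<Rightarrow> ?F x y))"
      by simp
  qed
  have "of_real (r ^ DIM('a)) * (LINT x|lborel. g x * of_real (smear B r x)) = (LINT x|lborel. g x * of_real (r ^ DIM('a) * smear B r x))"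
    by (subst integral_mult_right_zero[symmetric]) (simp add: mult_ac)
  also have "\<dots> = (LINT x|lborel. (LINT y|lborel. ?F x y))"
    by (simp only: sm[symmetric] integral_mult_right_zero integral_complex_of_real)
  also have "\<dots> = (LINT y|lborel. (LINT x|lborel. ?F x y))"
    using lborel_pair.Fubini_integral[OF int] by simp
  also have "\<dots> = (LINT y|(lborel :: 'a measure). 0)"
  proof (intro Bochner_Integration.integral_cong refl)
    fix y :: 'a
    have "(\<lambda>x. complex_of_real (gauss (inverse r *\<^sub>R (x - y)))) \<in> schwartz"
      using r by (intro gauss_shift_schwartz) simp
    then have "(LINT x|lborel. g x * complex_of_real (gauss (inverse r *\<^sub>R (x - y)))) = 0" by (rule zero)
    moreover have "gauss (inverse r *\<^sub>R (y - x)) = gauss (inverse r *\<^sub>R (x - y))" for x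
      by (simp add: gauss_def norm_minus_commute)
    moreover have "(LINT x|lborel. ?F x y) = of_real (indicator B y) * (LINT x|lborel. g x * complex_of_real (gauss (inverse r *\<^sub>R (y - x))))"
      by (subst integral_mult_right_zero[symmetric]) (simp add: mult_ac)
    ultimately show "(LINT x|lborel. ?F x y) = 0" by simp
  qed
  finally show ?thesis using r by simp
qed

text \<open>Translated Gaussians separate tempered functions: testing against them and integrating over a box
  gives the smeared box, hence in the limit the integral over the box itself.\<close>

theorem tempered_AE_zero:
  fixes g :: "'a::euclidean_space \<Rightarrow> complex"
  assumes g: "tempered_fun g" and zero: "\<And>\<psi>. \<psi> \<in> schwartz \<Longrightarrow> (LINT x|lborel. g x * \<psi> x) = 0"
  shows "AE x in lborel. g x = 0"
proof (rule AE_zero_if_integral_boxes_zero)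
  show [measurable]: "g \<in> borel_measurable borel" using g by (rule tempered_measurable)
  fix a b :: 'a
  let ?k = "(2 * pi) powr (real DIM('a) / 2)"
  have bs: "box a b \<in> sets borel" by simp
  have "bounded (box a b)" by (rule bounded_box)
  then obtain R where R: "0 < R" "\<And>x. x \<in> box a b \<Longrightarrow> norm x \<le> R" by (auto simp: bounded_pos)
  obtain w where w: "integrable lborel w" "\<And>x r. 0 \<le> r \<Longrightarrow> r \<le> 1 \<Longrightarrow> norm (g x) * smear (box a b) r x \<le> w x"
    using tempered_smear_integrable[OF g bs R(2) less_imp_le[OF R(1)]] by blast
  have "AE x in lborel. x \<notin> cbox a b - box a b"
    using null_sets_cbox_Diff_box[of a b] by (rule AE_not_in)
  then have lim: "AE x in lborel. (\<lambda>n. g x * of_real (smear (box a b) (inverse (real (Suc n))) x)) \<longlonglongrightarrow> g x * of_real (indicator (box a b) x * ?k)"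
    by eventually_elim (intro tendsto_intros smear_limit)
  have dom: "AE x in lborel. norm (g x * of_real (smear (box a b) (inverse (real (Suc n))) x)) \<le> w x" for n
    using w(2)[of "inverse (real (Suc n))"] by (intro AE_I2) (simp add: norm_mult smear_nonneg inverse_le_1_iff)
  have int: "integrable lborel (\<lambda>x. g x * of_real (indicator (box a b) x * ?k))"
    by (rule integrable_dominated_convergence[OF _ _ w(1) lim dom]) auto
  have "(\<lambda>n. LINT x|lborel. g x * of_real (smear (box a b) (inverse (real (Suc n))) x)) \<longlonglongrightarrow> (LINT x|lborel. g x * of_real (indicator (box a b) x * ?k))"
    by (rule integral_dominated_convergence[OF _ _ w(1) lim dom]) auto
  moreover have "(LINT x|lborel. g x * of_real (smear (box a b) (inverse (real (Suc n))) x)) = 0" for n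
    by (rule integral_tempered_smear_zero[OF g zero bs R(2) less_imp_le[OF R(1)]]) (auto simp: inverse_le_1_iff)
  ultimately have "(LINT x|lborel. g x * of_real (indicator (box a b) x * ?k)) = 0"
    using LIMSEQ_unique[OF _ tendsto_const] by simp
  moreover have eq: "indicator (box a b) x * g x = of_real (inverse ?k) * (g x * of_real (indicator (box a b) x * ?k))" for x
    by (simp add: indicator_def)
  ultimately show "(LINT x|lborel. indicator (box a b) x * g x) = 0"
    unfolding eq integral_mult_right_zero by simp
  show "integrable lborel (\<lambda>x. indicator (box a b) x * g x)"
    unfolding eq by (rule integrable_mult_right[OF int])
qed

lemma has_fourierD:
  assumes "has_fourier f g"
  shows "tempered_fun f" "tempered_fun g"
    "\<psi> \<in> schwartz \<Longrightarrow> (LINT \<xi>|lborel. g \<xi> * \<psi> \<xi>) = (LINT x|lborel. f x * fourier_integral \<psi> x)"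
  using assms by (auto simp: has_fourier_def)

lemma tempered_lincomb:
  assumes f: "tempered_fun f" and g: "tempered_fun g"
  shows "tempered_fun (\<lambda>x. a * f x + b * g x)"
proof -
  note [measurable] = tempered_measurable[OF f] tempered_measurable[OF g]
  obtain N where N: "integrable lborel (\<lambda>x. norm (f x) / (1 + norm x) ^ N)"
    using f by (auto simp: tempered_fun_def)
  obtain M where M: "integrable lborel (\<lambda>x. norm (g x) / (1 + norm x) ^ M)"
    using g by (auto simp: tempered_fun_def)
  have "integrable lborel (\<lambda>x. norm (a * f x + b * g x) / (1 + norm x) ^ (N + M))"
  proof (rule Bochner_Integration.integrable_bound)
    show "integrable lborel (\<lambda>x. norm a * (norm (f x) / (1 + norm x) ^ N) + norm b * (norm (g x) / (1 + norm x) ^ M))"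
      using N M by (intro Bochner_Integration.integrable_add integrable_mult_right)
    have "norm (norm (a * f x + b * g x) / (1 + norm x) ^ (N + M))
        \<le> norm (norm a * (norm (f x) / (1 + norm x) ^ N) + norm b * (norm (g x) / (1 + norm x) ^ M))" for x
    proof -
      let ?d = "1 + norm x"
      have d: "1 \<le> ?d" by simp
      have "norm (a * f x + b * g x) / ?d ^ (N + M) \<le> (norm a * norm (f x) + norm b * norm (g x)) / ?d ^ (N + M)"
        by (intro divide_right_mono order_trans[OF norm_triangle_ineq]) (auto simp: norm_mult)
      also have "\<dots> = norm a * norm (f x) / ?d ^ (N + M) + norm b * norm (g x) / ?d ^ (N + M)"
        by (rule add_divide_distrib)
      also have "\<dots> \<le> norm a * norm (f x) / ?d ^ N + norm b * norm (g x) / ?d ^ M"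
        using d by (intro add_mono divide_left_mono power_increasing mult_pos_pos zero_less_power)
          (auto simp: add_pos_nonneg)
      finally show ?thesis by simp
    qed
    then show "AE x in lborel. norm (norm (a * f x + b * g x) / (1 + norm x) ^ (N + M))
        \<le> norm (norm a * (norm (f x) / (1 + norm x) ^ N) + norm b * (norm (g x) / (1 + norm x) ^ M))" by simp
  qed simp
  then show ?thesis unfolding tempered_fun_def by auto
qed

lemma tempered_cong_AE:
  assumes f: "tempered_fun f" and [measurable]: "g \<in> borel_measurable borel" and ae: "AE x in lborel. f x = g x"
  shows "tempered_fun g"
proof -
  note [measurable] = tempered_measurable[OF f]
  obtain N where N: "integrable lborel (\<lambda>x. norm (f x) / (1 + norm x) ^ N)"
    using f by (auto simp: tempered_fun_def)
  have "integrable lborel (\<lambda>x. norm (g x) / (1 + norm x) ^ N)"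
    using N by (rule integrable_cong_AE_imp) (use ae in auto)
  then show ?thesis unfolding tempered_fun_def by auto
qed

lemma tempered_eq_AE:
  assumes f: "tempered_fun f" and g: "tempered_fun g"
    and eq: "\<And>\<psi>. \<psi> \<in> schwartz \<Longrightarrow> (LINT x|lborel. f x * \<psi> x) = (LINT x|lborel. g x * \<psi> x)"
  shows "AE x in lborel. f x = g x"
proof -
  have "AE x in lborel. 1 * f x + (- 1) * g x = 0"
  proof (rule tempered_AE_zero)
    show "tempered_fun (\<lambda>x. 1 * f x + (- 1) * g x)" by (rule tempered_lincomb[OF f g])
    fix \<psi> :: "'a \<Rightarrow> complex" assume \<psi>: "\<psi> \<in> schwartz"
    have "(LINT x|lborel. (1 * f x + (- 1) * g x) * \<psi> x) = (LINT x|lborel. f x * \<psi> x - g x * \<psi> x)"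
      by (simp add: algebra_simps)
    also have "\<dots> = 0"
      using eq[OF \<psi>] schwartz_tempered_integrable[OF f \<psi>] schwartz_tempered_integrable[OF g \<psi>] by simp
    finally show "(LINT x|lborel. (1 * f x + (- 1) * g x) * \<psi> x) = 0" .
  qed
  then show ?thesis by eventually_elim simp
qed

lemma has_fourier_unique:
  assumes "has_fourier f g" "has_fourier f h"
  shows "AE x in lborel. g x = h x"
  by (rule tempered_eq_AE) (use assms in \<open>auto simp: has_fourier_def\<close>)

lemma has_fourier_inj:
  assumes "has_fourier f h" "has_fourier g h"
  shows "AE x in lborel. f x = g x"
proof (rule tempered_eq_AE)
  fix \<psi> :: "'a \<Rightarrow> complex" assume "\<psi> \<in> schwartz"
  then obtain q where "q \<in> schwartz" "\<psi> = fourier_integral q" using schwartz_is_fourier_integral by metis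
  then show "(LINT x|lborel. f x * \<psi> x) = (LINT x|lborel. g x * \<psi> x)"
    using assms by (simp add: has_fourierD(3)[symmetric])
qed (use assms in \<open>auto simp: has_fourier_def\<close>)

lemma has_fourier_cong_AE:
  assumes fg: "has_fourier f g" and [measurable]: "f' \<in> borel_measurable borel" "g' \<in> borel_measurable borel"
    and f: "AE x in lborel. f x = f' x" and g: "AE x in lborel. g x = g' x"
  shows "has_fourier f' g'"
  unfolding has_fourier_def
proof (intro conjI ballI)
  note [measurable] = tempered_measurable[OF has_fourierD(1)[OF fg]] tempered_measurable[OF has_fourierD(2)[OF fg]]
  show "tempered_fun f'" "tempered_fun g'"
    by (rule tempered_cong_AE; use has_fourierD(1,2)[OF fg] f g in simp)+
  fix \<psi> :: "'a \<Rightarrow> complex" assume \<psi>: "\<psi> \<in> schwartz"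
  note [measurable] = schwartz_measurable[OF \<psi>]
  have "(LINT \<xi>|lborel. g' \<xi> * \<psi> \<xi>) = (LINT \<xi>|lborel. g \<xi> * \<psi> \<xi>)"
    by (rule integral_cong_AE) (use g in auto)
  also have "\<dots> = (LINT x|lborel. f x * fourier_integral \<psi> x)" by (rule has_fourierD(3)[OF fg \<psi>])
  also have "\<dots> = (LINT x|lborel. f' x * fourier_integral \<psi> x)"
    by (rule integral_cong_AE) (use f in auto)
  finally show "(LINT \<xi>|lborel. g' \<xi> * \<psi> \<xi>) = (LINT x|lborel. f' x * fourier_integral \<psi> x)" .
qed

lemma has_fourier_lincomb:
  assumes fg: "has_fourier f g" and fg': "has_fourier f' g'"
  shows "has_fourier (\<lambda>x. a * f x + b * f' x) (\<lambda>x. a * g x + b * g' x)"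
proof -
  have lin: "(LINT x|lborel. (a * u x + b * v x) * \<psi> x) = a * (LINT x|lborel. u x * \<psi> x) + b * (LINT x|lborel. v x * \<psi> x)"
    if "tempered_fun u" "tempered_fun v" "\<psi> \<in> schwartz" for u v \<psi> :: "'a \<Rightarrow> complex"
  proof -
    note schwartz_tempered_integrable[OF that(1,3)] schwartz_tempered_integrable[OF that(2,3)]
    then have "a * (LINT x|lborel. u x * \<psi> x) + b * (LINT x|lborel. v x * \<psi> x) = (LINT x|lborel. a * (u x * \<psi> x) + b * (v x * \<psi> x))"
      by simp
    then show ?thesis by (simp add: algebra_simps)
  qed
  show ?thesis
    unfolding has_fourier_def
    using has_fourierD[OF fg] has_fourierD[OF fg']
    by (auto intro!: tempered_lincomb simp: lin fourier_integral_schwartz)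
qed

lemma has_fourier_diff:
  "has_fourier f g \<Longrightarrow> has_fourier f' g' \<Longrightarrow> has_fourier (\<lambda>x. f x - f' x) (\<lambda>x. g x - g' x)"
  using has_fourier_lincomb[of f g f' g' 1 "-1"] by simp

lemma has_fourier_fourier: "has_fourier f g \<Longrightarrow> has_fourier f (fourier f)"
  unfolding fourier_def by (rule someI[of "has_fourier f"])

lemma integral_lborel_reflect:
  fixes f :: "'a::euclidean_space \<Rightarrow> complex"
  assumes [measurable]: "f \<in> borel_measurable borel"
  shows "(LINT x|lborel. f (- x)) = (LINT x|lborel. f x)"
  using integral_lborel_affine[of "-1" f 0] by simp

lemma lborel_distr_uminus_euclidean: "distr lborel borel uminus = (lborel :: 'a::euclidean_space measure)"
  using lborel_affine[of "-1" "0::'a"] by (simp add: density_1 one_ennreal_def[symmetric])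

lemma tempered_reflect:
  assumes "tempered_fun f" shows "tempered_fun (\<lambda>x. f (- x))"
proof -
  note [measurable] = tempered_measurable[OF assms]
  obtain N where N: "integrable lborel (\<lambda>x. norm (f x) / (1 + norm x) ^ N)"
    using assms by (auto simp: tempered_fun_def)
  then have "integrable (distr lborel borel uminus) (\<lambda>x. norm (f x) / (1 + norm x) ^ N)"
    by (simp only: lborel_distr_uminus_euclidean)
  then have "integrable lborel (\<lambda>x. norm (f (- x)) / (1 + norm (- x)) ^ N)"
    by (subst (asm) integrable_distr_eq) auto
  then show ?thesis unfolding tempered_fun_def by auto
qed

text \<open>The inverse transform is the transform followed by a reflection, by inversion for the test
  function.\<close>

lemma has_fourier_inverse:
  assumes gf: "has_fourier g f" shows "has_fourier (\<lambda>x. f (- x)) g"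
  unfolding has_fourier_def
proof (intro conjI ballI tempered_reflect has_fourierD(1,2)[OF gf])
  note [measurable] = tempered_measurable[OF has_fourierD(1)[OF gf]] tempered_measurable[OF has_fourierD(2)[OF gf]]
  fix \<psi> :: "'a \<Rightarrow> complex" assume \<psi>: "\<psi> \<in> schwartz"
  note [measurable] = schwartz_measurable[OF \<psi>]
  have "(LINT x|lborel. f (- x) * fourier_integral \<psi> x) = (LINT x|lborel. f x * fourier_integral \<psi> (- x))"
    using integral_lborel_reflect[of "\<lambda>x. f x * fourier_integral \<psi> (- x)"] by simp
  also have "\<dots> = (LINT x|lborel. g x * fourier_integral (\<lambda>x. fourier_integral \<psi> (- x)) x)"
    by (rule has_fourierD(3)[OF gf]) (intro schwartz_reflect fourier_integral_schwartz \<psi>)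
  also have "\<dots> = (LINT x|lborel. g x * \<psi> x)"
    by (simp add: fourier_integral_reflect schwartz_inversion[OF \<psi>])
  finally show "(LINT x|lborel. g x * \<psi> x) = (LINT x|lborel. f (- x) * fourier_integral \<psi> x)" ..
qed

section \<open>The Fourier transform on square-integrable functions\<close>

lemma has_fourier_integrable:
  assumes f: "integrable lborel f" shows "has_fourier f (fourier_integral f)"
  unfolding has_fourier_def
proof (intro conjI ballI)
  have [measurable]: "f \<in> borel_measurable borel" using f by auto
  show "tempered_fun (fourier_integral f)"
    by (rule bounded_imp_tempered[OF _ fourier_integral_bound]) simp
  have "integrable lborel (\<lambda>x. norm (f x) / (1 + norm x) ^ 0)" using f by simp
  then show "tempered_fun f" unfolding tempered_fun_def by (intro conjI exI[of _ 0]) auto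
  show "(LINT \<xi>|lborel. fourier_integral f \<xi> * \<psi> \<xi>) = (LINT x|lborel. f x * fourier_integral \<psi> x)"
    if "\<psi> \<in> schwartz" for \<psi>
    by (rule fourier_integral_multiplication[OF f schwartz_integrable[OF that]])
qed

lemma nn_integral_lborel_affine:
  fixes t :: "'a::euclidean_space"
  assumes [measurable]: "f \<in> borel_measurable borel" and c: "c \<noteq> 0"
  shows "(\<integral>\<^sup>+x. f x \<partial>lborel) = ennreal (\<bar>c\<bar> ^ DIM('a)) * (\<integral>\<^sup>+x. f (t + c *\<^sub>R x) \<partial>lborel)"
  by (subst lborel_affine[OF c, of t]) (simp add: nn_integral_density nn_integral_distr nn_integral_cmult ennreal_power)

lemma norm_integral_le_nn_integral:
  fixes f :: "'a \<Rightarrow> complex"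
  shows "ennreal (norm (integral\<^sup>L M f)) \<le> (\<integral>\<^sup>+x. ennreal (norm (f x)) \<partial>M)"
  by (cases "integrable M f") (auto simp: integral_norm_bound_ennreal not_integrable_integral_eq)

lemma nn_integral_gauss_kernel:
  fixes x :: "'a::euclidean_space"
  assumes r: "0 < r"
  shows "(\<integral>\<^sup>+y. ennreal (r ^ DIM('a) * gauss (r *\<^sub>R (x + y))) \<partial>lborel) = ennreal ((2 * pi) powr (real DIM('a) / 2))"
proof -
  have "(\<integral>\<^sup>+y. ennreal (r ^ DIM('a) * gauss (r *\<^sub>R (x + y))) \<partial>lborel)
      = ennreal (\<bar>inverse r\<bar> ^ DIM('a)) * (\<integral>\<^sup>+u. ennreal (r ^ DIM('a) * gauss (r *\<^sub>R (x + (- x + inverse r *\<^sub>R u)))) \<partial>lborel)"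
    by (rule nn_integral_lborel_affine) (use r in auto)
  also have "\<dots> = ennreal (\<bar>inverse r\<bar> ^ DIM('a)) * (ennreal (r ^ DIM('a)) * (\<integral>\<^sup>+u. ennreal (gauss (u::'a)) \<partial>lborel))"
    using r by (subst nn_integral_cmult[symmetric]) (auto simp: ennreal_mult less_imp_le[OF gauss_pos])
  also have "\<dots> = ennreal (\<bar>inverse r\<bar> ^ DIM('a)) * (ennreal (r ^ DIM('a)) * ennreal ((2 * pi) powr (real DIM('a) / 2)))"
    by (subst nn_integral_eq_integral[OF integrable_gauss]) (auto simp: integral_gauss less_imp_le[OF gauss_pos])
  also have "\<dots> = ennreal ((2 * pi) powr (real DIM('a) / 2))"
    using r by (simp add: ennreal_mult[symmetric] power_inverse mult.assoc[symmetric])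
  finally show ?thesis .
qed

text \<open>Bessel's inequality. Regularised by a Gaussian, \<open>\<integral>|f^|\<^sup>2\<close> is a double integral of
  \<open>f(x) f(y)\<^sup>*\<close> against an approximate identity in \<open>x - y\<close>; bounding the product by
  \<open>(|f(x)|\<^sup>2 + |f(y)|\<^sup>2) / 2\<close> already gives the constant \<open>1\<close>.\<close>

lemma fourier_integral_L2:
  fixes f :: "'a::euclidean_space \<Rightarrow> complex"
  assumes f: "integrable lborel f" and f2: "f \<in> L2"
  shows "fourier_integral f \<in> L2" "L2_norm (fourier_integral f) \<le> L2_norm f"
proof -
  have [measurable]: "f \<in> borel_measurable borel" using f by auto
  let ?F = "fourier_integral f"
  let ?K = "(2 * pi) powr (- real DIM('a) / 2)"
  let ?D = "(2 * pi) powr (real DIM('a) / 2)"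
  define h where "h y = cnj (f (- y))" for y
  have h: "integrable lborel h"
    unfolding h_def using integrable_lborel_affine[of "-1" f 0] f by simp
  have [measurable]: "h \<in> borel_measurable borel" using h by auto
  have [measurable]: "(cnj :: complex \<Rightarrow> complex) \<in> borel_measurable borel"
    by (intro borel_measurable_continuous_onI continuous_intros)
  have Fh: "fourier_integral h \<xi> = cnj (?F \<xi>)" for \<xi>
  proof -
    have "fourier_integral h \<xi> = fourier_integral (\<lambda>y. cnj (f y)) (- \<xi>)"
      unfolding h_def by (rule fourier_integral_reflect[where h = "\<lambda>y. cnj (f y)"]) measurable
    also have "\<dots> = cnj (?F \<xi>)"
    proof -
      have "(LINT x|lborel. exp (- \<i> * of_real (x \<bullet> - \<xi>)) * cnj (f x)) = (LINT x|lborel. cnj (exp (- \<i> * of_real (x \<bullet> \<xi>)) * f x))"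
        by (intro Bochner_Integration.integral_cong refl) (simp add: exp_cnj)
      also have "\<dots> = cnj (LINT x|lborel. exp (- \<i> * of_real (x \<bullet> \<xi>)) * f x)"
        by (rule integral_bounded_linear'[OF bounded_linear_cnj bounded_linear_cnj]) simp
      finally show ?thesis unfolding fourier_integral_def by simp
    qed
    finally show ?thesis .
  qed
  define k where "k n \<xi> = (norm (?F \<xi>))\<^sup>2 * gauss (\<xi> /\<^sub>R real (Suc n))" for n \<xi>
  have ft: "fourier_integral (\<lambda>\<xi>. fourier_integral h \<xi> * complex_of_real (gauss (\<xi> /\<^sub>R real (Suc n)))) x
      = of_real ?K * (LINT y|lborel. h y * of_real (real (Suc n) ^ DIM('a) * gauss (real (Suc n) *\<^sub>R (x + y))))" for n x
  proof -
    have "(LINT \<xi>|lborel. exp (- \<i> * of_real (\<xi> \<bullet> x)) * (fourier_integral h \<xi> * complex_of_real (gauss (\<xi> /\<^sub>R real (Suc n)))))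
        = (LINT \<xi>|lborel. fourier_integral h \<xi> * gauss_wave (real (Suc n)) x \<xi>)"
      unfolding gauss_wave_def by (simp add: mult_ac)
    also have "\<dots> = (LINT y|lborel. h y * fourier_integral (gauss_wave (real (Suc n)) x) y)"
      by (rule fourier_integral_multiplication[OF h integrable_gauss_wave]) simp
    finally show ?thesis
      unfolding fourier_integral_def[of "\<lambda>\<xi>. fourier_integral h \<xi> * complex_of_real (gauss (\<xi> /\<^sub>R real (Suc n)))"]
      by (simp add: fourier_gauss_wave)
  qed
  have gi: "integrable lborel (\<lambda>\<xi>. fourier_integral h \<xi> * complex_of_real (gauss (\<xi> /\<^sub>R real (Suc n))))" for n
  proof (rule schwartz_tempered_integrable)
    show "tempered_fun (fourier_integral h)" using has_fourierD(2)[OF has_fourier_integrable[OF h]] .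
    show "(\<lambda>\<xi>::'a. complex_of_real (gauss (\<xi> /\<^sub>R real (Suc n)))) \<in> schwartz"
      using gauss_shift_schwartz[of "inverse (real (Suc n))" "0::'a"] by simp
  qed
  have keq: "complex_of_real (k n \<xi>) = ?F \<xi> * (fourier_integral h \<xi> * complex_of_real (gauss (\<xi> /\<^sub>R real (Suc n))))" for n \<xi>
    by (simp only: k_def Fh of_real_mult complex_norm_square mult.assoc)
  have kint: "integrable lborel (k n)" for n
  proof -
    have "integrable lborel (\<lambda>\<xi>. ?F \<xi> * (fourier_integral h \<xi> * complex_of_real (gauss (\<xi> /\<^sub>R real (Suc n)))))"
    proof (rule Bochner_Integration.integrable_bound)
      show "integrable lborel (\<lambda>\<xi>. (?K * (LINT x|lborel. norm (f x))) *\<^sub>R (fourier_integral h \<xi> * complex_of_real (gauss (\<xi> /\<^sub>R real (Suc n)))))"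
        using gi by (rule integrable_scaleR_right)
      have "norm (?F \<xi>) \<le> \<bar>?K * (LINT x|lborel. norm (f x))\<bar>" for \<xi>
        using fourier_integral_bound[of f \<xi>] by (rule order_trans[OF _ abs_ge_self])
      then show "AE \<xi> in lborel. norm (?F \<xi> * (fourier_integral h \<xi> * complex_of_real (gauss (\<xi> /\<^sub>R real (Suc n)))))
          \<le> norm ((?K * (LINT x|lborel. norm (f x))) *\<^sub>R (fourier_integral h \<xi> * complex_of_real (gauss (\<xi> /\<^sub>R real (Suc n)))))"
        unfolding norm_mult norm_scaleR by (intro AE_I2 mult_right_mono) auto
    qed measurable
    then have "integrable lborel (\<lambda>\<xi>. complex_of_real (k n \<xi>))" unfolding keq .
    then show ?thesis unfolding complex_of_real_integrable_eq .
  qed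
  have kle: "(\<integral>\<^sup>+\<xi>. ennreal (k n \<xi>) \<partial>lborel) \<le> ennreal ((L2_norm f)\<^sup>2)" for n
  proof -
    let ?r = "real (Suc n)"
    let ?g = "\<lambda>x y. ?r ^ DIM('a) * gauss (?r *\<^sub>R (x + y))"
    have g0: "0 \<le> ?g x y" for x y :: 'a by (simp add: less_imp_le[OF gauss_pos])
    have k0: "0 \<le> k n \<xi>" for \<xi> unfolding k_def by (simp add: less_imp_le[OF gauss_pos])
    have "complex_of_real (LINT \<xi>|lborel. k n \<xi>) = (LINT \<xi>|lborel. ?F \<xi> * (fourier_integral h \<xi> * complex_of_real (gauss (\<xi> /\<^sub>R ?r))))"
      unfolding integral_complex_of_real[symmetric] keq ..
    also have "\<dots> = (LINT x|lborel. f x * (of_real ?K * (LINT y|lborel. h y * of_real (?g x y))))"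
      unfolding fourier_integral_multiplication[OF f gi] ft ..
    finally have I: "complex_of_real (LINT \<xi>|lborel. k n \<xi>) = \<dots>" .
    have "0 \<le> (LINT \<xi>|lborel. k n \<xi>)"
      by (rule integral_nonneg_AE) (simp add: k0)
    with arg_cong[OF I, of norm] have "ennreal (LINT \<xi>|lborel. k n \<xi>) = ennreal (norm (LINT x|lborel. f x * (of_real ?K * (LINT y|lborel. h y * of_real (?g x y)))))"
      unfolding norm_of_real by (simp only: abs_of_nonneg)
    also have "\<dots> \<le> (\<integral>\<^sup>+x. ennreal (norm (f x * (of_real ?K * (LINT y|lborel. h y * of_real (?g x y))))) \<partial>lborel)"
      by (rule norm_integral_le_nn_integral)
    also have "\<dots> \<le> (\<integral>\<^sup>+x. (\<integral>\<^sup>+y. ennreal ?K * (ennreal ((norm (f x))\<^sup>2 / 2) * ennreal (?g x y) + ennreal ((norm (h y))\<^sup>2 / 2) * ennreal (?g x y)) \<partial>lborel) \<partial>lborel)"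
    proof (rule nn_integral_mono)
      fix x :: 'a
      have "ennreal (norm (f x * (of_real ?K * (LINT y|lborel. h y * of_real (?g x y)))))
          = ennreal (norm (f x)) * (ennreal ?K * ennreal (norm (LINT y|lborel. h y * of_real (?g x y))))"
        by (simp add: norm_mult ennreal_mult)
      also have "\<dots> \<le> ennreal (norm (f x)) * (ennreal ?K * (\<integral>\<^sup>+y. ennreal (norm (h y * of_real (?g x y))) \<partial>lborel))"
        by (intro mult_left_mono norm_integral_le_nn_integral) auto
      also have "\<dots> = (\<integral>\<^sup>+y. ennreal (norm (f x)) * (ennreal ?K * ennreal (norm (h y * of_real (?g x y)))) \<partial>lborel)"
        by (simp add: nn_integral_cmult del: of_nat_Suc)
      also have "\<dots> \<le> (\<integral>\<^sup>+y. ennreal ?K * (ennreal ((norm (f x))\<^sup>2 / 2) * ennreal (?g x y) + ennreal ((norm (h y))\<^sup>2 / 2) * ennreal (?g x y)) \<partial>lborel)"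
      proof (rule nn_integral_mono)
        fix y :: 'a
        have "norm (f x) * norm (h y) \<le> (norm (f x))\<^sup>2 / 2 + (norm (h y))\<^sup>2 / 2"
          using sum_squares_bound[of "norm (f x)" "norm (h y)"] by simp
        from mult_right_mono[OF this g0[of x y]]
        have *: "norm (f x) * norm (h y) * ?g x y \<le> (norm (f x))\<^sup>2 / 2 * ?g x y + (norm (h y))\<^sup>2 / 2 * ?g x y"
          by (simp only: distrib_right)
        have "ennreal (norm (f x)) * (ennreal ?K * ennreal (norm (h y * of_real (?g x y)))) = ennreal (?K * (norm (f x) * norm (h y) * ?g x y))"
          unfolding norm_mult[of "h y"] norm_of_real abs_of_nonneg[OF g0]
          using g0[of x y] by (subst ennreal_mult[symmetric], simp, simp)+ (simp add: mult_ac)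
        also have "\<dots> \<le> ennreal (?K * ((norm (f x))\<^sup>2 / 2 * ?g x y + (norm (h y))\<^sup>2 / 2 * ?g x y))"
          by (intro ennreal_leI mult_left_mono *) simp
        also have "\<dots> = ennreal ?K * (ennreal ((norm (f x))\<^sup>2 / 2) * ennreal (?g x y) + ennreal ((norm (h y))\<^sup>2 / 2) * ennreal (?g x y))"
          using g0[of x y] by (simp add: ennreal_mult[symmetric] ennreal_plus[symmetric] del: ennreal_plus of_nat_Suc)
        finally show "ennreal (norm (f x)) * (ennreal ?K * ennreal (norm (h y * of_real (?g x y)))) \<le> \<dots>" .
      qed
      finally show "ennreal (norm (f x * (of_real ?K * (LINT y|lborel. h y * of_real (?g x y))))) \<le> \<dots>" .
    qed
    also have "\<dots> = ennreal ?K * ((\<integral>\<^sup>+x. (\<integral>\<^sup>+y. ennreal ((norm (f x))\<^sup>2 / 2) * ennreal (?g x y) \<partial>lborel) \<partial>lborel)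
        + (\<integral>\<^sup>+x. (\<integral>\<^sup>+y. ennreal ((norm (h y))\<^sup>2 / 2) * ennreal (?g x y) \<partial>lborel) \<partial>lborel))"
      by (simp add: nn_integral_cmult nn_integral_add del: of_nat_Suc)
    also have "(\<integral>\<^sup>+x. (\<integral>\<^sup>+y. ennreal ((norm (f x))\<^sup>2 / 2) * ennreal (?g x y) \<partial>lborel) \<partial>lborel) = ennreal ((L2_norm f)\<^sup>2 / 2) * ennreal ?D"
    proof -
      have "(\<integral>\<^sup>+x. (\<integral>\<^sup>+y. ennreal ((norm (f x))\<^sup>2 / 2) * ennreal (?g x y) \<partial>lborel) \<partial>lborel) = (\<integral>\<^sup>+x. ennreal ((norm (f x))\<^sup>2 / 2) * ennreal ?D \<partial>lborel)"
        by (intro nn_integral_cong) (subst nn_integral_cmult, simp, simp only: nn_integral_gauss_kernel[of ?r] of_nat_0_less_iff zero_less_Suc)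
      also have "\<dots> = (\<integral>\<^sup>+x. ennreal ((norm (f x))\<^sup>2 / 2) \<partial>lborel) * ennreal ?D" by (rule nn_integral_multc) measurable
      also have "(\<integral>\<^sup>+x. ennreal ((norm (f x))\<^sup>2 / 2) \<partial>lborel) = ennreal ((L2_norm f)\<^sup>2 / 2)"
        by (subst nn_integral_eq_integral) (use L2_integrable_sq[OF f2] in \<open>auto simp: L2_norm_sq\<close>)
      finally show ?thesis .
    qed
    also have "(\<integral>\<^sup>+x. (\<integral>\<^sup>+y. ennreal ((norm (h y))\<^sup>2 / 2) * ennreal (?g x y) \<partial>lborel) \<partial>lborel) = ennreal ((L2_norm f)\<^sup>2 / 2) * ennreal ?D"
    proof -
      have "(\<integral>\<^sup>+x. (\<integral>\<^sup>+y. ennreal ((norm (h y))\<^sup>2 / 2) * ennreal (?g x y) \<partial>lborel) \<partial>lborel) = (\<integral>\<^sup>+y. (\<integral>\<^sup>+x. ennreal ((norm (h y))\<^sup>2 / 2) * ennreal (?g y x) \<partial>lborel) \<partial>lborel)"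
        by (subst lborel_pair.Fubini') (auto simp: add.commute simp del: of_nat_Suc)
      also have "\<dots> = (\<integral>\<^sup>+y. ennreal ((norm (h y))\<^sup>2 / 2) * ennreal ?D \<partial>lborel)"
        by (intro nn_integral_cong) (subst nn_integral_cmult, simp, simp only: nn_integral_gauss_kernel[of ?r] of_nat_0_less_iff zero_less_Suc)
      also have "\<dots> = (\<integral>\<^sup>+y. ennreal ((norm (h y))\<^sup>2 / 2) \<partial>lborel) * ennreal ?D" by (rule nn_integral_multc) measurable
      also have "(\<integral>\<^sup>+y. ennreal ((norm (h y))\<^sup>2 / 2) \<partial>lborel) = (\<integral>\<^sup>+x. ennreal ((norm (f x))\<^sup>2 / 2) \<partial>lborel)"
        by (subst nn_integral_lborel_affine[of _ "-1" 0]) (auto simp: h_def)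
      also have "(\<integral>\<^sup>+x. ennreal ((norm (f x))\<^sup>2 / 2) \<partial>lborel) = ennreal ((L2_norm f)\<^sup>2 / 2)"
        by (subst nn_integral_eq_integral) (use L2_integrable_sq[OF f2] in \<open>auto simp: L2_norm_sq\<close>)
      finally show ?thesis .
    qed
    also have "ennreal ?K * (ennreal ((L2_norm f)\<^sup>2 / 2) * ennreal ?D + ennreal ((L2_norm f)\<^sup>2 / 2) * ennreal ?D) = ennreal ((L2_norm f)\<^sup>2)"
      by (simp add: ennreal_mult[symmetric] ennreal_plus[symmetric] powr_minus del: ennreal_plus)
    finally show ?thesis
      using nn_integral_eq_integral[OF kint[of n]] k0 by simp
  qed
  have "(\<integral>\<^sup>+\<xi>. ennreal ((norm (?F \<xi>))\<^sup>2) \<partial>lborel) = (\<integral>\<^sup>+\<xi>. liminf (\<lambda>n. ennreal (k n \<xi>)) \<partial>lborel)"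
  proof (rule nn_integral_cong)
    fix \<xi> :: 'a
    have "(\<lambda>n. ennreal (k n \<xi>)) \<longlonglongrightarrow> ennreal ((norm (?F \<xi>))\<^sup>2 * 1)"
      unfolding k_def by (intro tendsto_intros gauss_dilate_tendsto)
    then show "ennreal ((norm (?F \<xi>))\<^sup>2) = liminf (\<lambda>n. ennreal (k n \<xi>))"
      by (intro lim_imp_Liminf[symmetric]) auto
  qed
  also have "\<dots> \<le> liminf (\<lambda>n. \<integral>\<^sup>+\<xi>. ennreal (k n \<xi>) \<partial>lborel)"
    by (rule nn_integral_liminf) (use kint in measurable)
  also have "\<dots> \<le> ennreal ((L2_norm f)\<^sup>2)"
    by (intro Liminf_le) (auto simp: kle)
  finally show "?F \<in> L2" "L2_norm ?F \<le> L2_norm f"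
    using L2_bound_nn[of ?F "L2_norm f"] by auto
qed


lemma L2_pairing_limit:
  assumes X: "\<And>n. X n \<in> L2" and f: "f \<in> L2" and lim: "(\<lambda>n. L2_norm (\<lambda>x. X n x - f x)) \<longlonglongrightarrow> 0" and \<psi>: "\<psi> \<in> L2"
  shows "(\<lambda>n. LINT x|lborel. X n x * \<psi> x) \<longlonglongrightarrow> (LINT x|lborel. f x * \<psi> x)"
proof (rule LIM_zero_cancel, rule Lim_null_comparison)
  show "(\<lambda>n. L2_norm (\<lambda>x. X n x - f x) * L2_norm \<psi>) \<longlonglongrightarrow> 0"
    using tendsto_mult_left_zero[OF lim] .
  have "(LINT x|lborel. X n x * \<psi> x) - (LINT x|lborel. f x * \<psi> x) = (LINT x|lborel. (X n x - f x) * \<psi> x)" for n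
    using L2_Cauchy_Schwarz(1)[OF X \<psi>, of n] L2_Cauchy_Schwarz(1)[OF f \<psi>] by (simp add: left_diff_distrib)
  then show "eventually (\<lambda>n. norm ((LINT x|lborel. X n x * \<psi> x) - (LINT x|lborel. f x * \<psi> x)) \<le> L2_norm (\<lambda>x. X n x - f x) * L2_norm \<psi>) sequentially"
    using L2_Cauchy_Schwarz(3)[OF L2_diff_mem[OF X f] \<psi>] by simp
qed

lemma L2_truncate:
  assumes f: "f \<in> L2"
  shows "(\<lambda>n. L2_norm (\<lambda>x. indicator (cball 0 (real n)) x * f x - f x)) \<longlonglongrightarrow> 0"
proof -
  note [measurable] = L2_measurable[OF f]
  have [measurable]: "cball (0::'a) r \<in> sets borel" for r by simp
  have "(\<lambda>n. LINT x|lborel. (norm (indicator (cball 0 (real n)) x * f x - f x))\<^sup>2) \<longlonglongrightarrow> (LINT x|(lborel::'a measure). 0)"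
  proof (rule integral_dominated_convergence[where w = "\<lambda>x. (norm (f x))\<^sup>2"])
    show "AE x in lborel. (\<lambda>n. (norm (indicator (cball 0 (real n)) x * f x - f x))\<^sup>2) \<longlonglongrightarrow> 0"
    proof (rule AE_I2)
      fix x :: 'a
      obtain N where N: "norm x \<le> real N" using real_arch_simple by blast
      have "eventually (\<lambda>n. (norm (indicator (cball 0 (real n)) x * f x - f x))\<^sup>2 = 0) sequentially"
        using eventually_ge_at_top[of N] by eventually_elim (use N in auto)
      then show "(\<lambda>n. (norm (indicator (cball 0 (real n)) x * f x - f x))\<^sup>2) \<longlonglongrightarrow> 0"
        by (rule tendsto_eventually)
    qed
    show "AE x in lborel. norm ((norm (indicator (cball 0 (real n)) x * f x - f x))\<^sup>2) \<le> (norm (f x))\<^sup>2" for n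
      by (intro AE_I2) (auto simp: indicator_def)
  qed (use L2_integrable_sq[OF f] in auto)
  then have "(\<lambda>n. sqrt (LINT x|lborel. (norm (indicator (cball 0 (real n)) x * f x - f x))\<^sup>2)) \<longlonglongrightarrow> sqrt 0"
    by (intro tendsto_real_sqrt) simp
  then show ?thesis by (simp add: L2_norm_def)
qed

lemma L2_norm_limit_le:
  assumes F: "F \<in> L2" and G: "\<And>n. G n \<in> L2" and le: "\<And>n. L2_norm (G n) \<le> c"
    and lim: "(\<lambda>n. L2_norm (\<lambda>x. G n x - F x)) \<longlonglongrightarrow> 0"
  shows "L2_norm F \<le> c"
proof (rule LIMSEQ_le_const)
  show "(\<lambda>n. L2_norm (\<lambda>x. G n x - F x) + c) \<longlonglongrightarrow> c"
    using tendsto_add[OF lim tendsto_const[of c]] by simp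
  have "L2_norm F \<le> L2_norm (\<lambda>x. F x - G n x) + L2_norm (G n)" for n
    using L2_triangle[OF L2_diff_mem[OF F G[of n]] G[of n]] by simp
  then show "\<exists>N. \<forall>n\<ge>N. L2_norm F \<le> L2_norm (\<lambda>x. G n x - F x) + c"
    using le by (metis L2_norm_minus_commute add_left_mono order_trans)
qed

text \<open>Truncations of \<open>f\<close> to balls are integrable and converge to \<open>f\<close>; by Bessel's inequality their
  transforms form a Cauchy sequence, whose limit inherits the pairing with test functions.\<close>

theorem L2_has_fourier:
  fixes f :: "'a::euclidean_space \<Rightarrow> complex"
  assumes f: "f \<in> L2"
  shows "\<exists>g\<in>L2. has_fourier f g \<and> L2_norm g \<le> L2_norm f"
proof -
  define X where "X n x = indicator (cball 0 (real n)) x * f x" for n x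
  have X2: "X n \<in> L2" "L2_norm (X n) \<le> L2_norm f" for n
    unfolding X_def[abs_def] by (rule L2_indicator[OF f]; simp)+
  have Xi: "integrable lborel (X n)" for n
  proof -
    have "(\<lambda>x::'a. indicator (cball 0 (real n)) x :: complex) \<in> L2"
    proof -
      have "integrable lborel (\<lambda>x::'a. indicator (cball 0 (real n)) x :: real)"
        by (rule integrable_real_indicator) (use emeasure_lborel_cball_finite in auto)
      moreover have "(norm (indicator A x :: complex))\<^sup>2 = indicator A x" for A and x :: 'a
        by (simp add: indicator_def)
      ultimately show ?thesis by (simp add: L2_def borel_measurable_indicator)
    qed
    from L2_Cauchy_Schwarz(1)[OF this f] show ?thesis unfolding X_def[abs_def] .
  qed
  have Xlim: "(\<lambda>n. L2_norm (\<lambda>x. X n x - f x)) \<longlonglongrightarrow> 0"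
    unfolding X_def by (rule L2_truncate[OF f])
  define Y where "Y n = fourier_integral (X n)" for n
  have Y2: "Y n \<in> L2" "L2_norm (Y n) \<le> L2_norm f" for n
    unfolding Y_def using fourier_integral_L2[OF Xi[of n] X2(1)] X2(2)[of n] by auto
  have XY: "has_fourier (X n) (Y n)" for n
    unfolding Y_def by (rule has_fourier_integrable[OF Xi])
  have diff: "L2_norm (\<lambda>x. Y m x - Y n x) \<le> L2_norm (\<lambda>x. X m x - X n x)" for m n
  proof -
    have i: "integrable lborel (\<lambda>x. X m x - X n x)" using Xi by simp
    have "Y m \<xi> - Y n \<xi> = fourier_integral (\<lambda>x. X m x - X n x) \<xi>" for \<xi>
      unfolding Y_def fourier_integral_def
      using integrable_character[OF Xi[of m]] integrable_character[OF Xi[of n]]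
      by (simp add: right_diff_distrib)
    then have "(\<lambda>x. Y m x - Y n x) = fourier_integral (\<lambda>x. X m x - X n x)" by blast
    then show ?thesis using fourier_integral_L2(2)[OF i L2_diff_mem[OF X2(1) X2(1)]] by simp
  qed
  obtain g where g: "g \<in> L2" "(\<lambda>n. L2_norm (\<lambda>x. Y n x - g x)) \<longlonglongrightarrow> 0"
  proof (rule L2_complete[OF Y2(1)])
    fix e :: real assume "e > 0"
    then obtain N where N: "\<And>n. n \<ge> N \<Longrightarrow> L2_norm (\<lambda>x. X n x - f x) < e / 2"
      using LIMSEQ_D[OF Xlim, of "e / 2"] by auto
    have "L2_norm (\<lambda>x. Y m x - Y n x) < e" if "m \<ge> N" "n \<ge> N" for m n
      using diff[of m n] L2_triangle_diff[OF X2(1)[of m] f X2(1)[of n]] N[OF that(1)] N[OF that(2)]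
        L2_norm_minus_commute[of "X n" f] by simp
    then show "\<exists>N. \<forall>m\<ge>N. \<forall>n\<ge>N. L2_norm (\<lambda>x. Y m x - Y n x) < e" by blast
  qed
  have "has_fourier f g"
    unfolding has_fourier_def
  proof (intro conjI ballI L2_imp_tempered f g)
    fix \<psi> :: "'a \<Rightarrow> complex" assume \<psi>: "\<psi> \<in> schwartz"
    have "(\<lambda>n. LINT \<xi>|lborel. Y n \<xi> * \<psi> \<xi>) \<longlonglongrightarrow> (LINT \<xi>|lborel. g \<xi> * \<psi> \<xi>)"
      by (rule L2_pairing_limit[OF Y2(1) g schwartz_L2[OF \<psi>]])
    moreover have "(\<lambda>n. LINT \<xi>|lborel. Y n \<xi> * \<psi> \<xi>) \<longlonglongrightarrow> (LINT x|lborel. f x * fourier_integral \<psi> x)"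
      unfolding has_fourierD(3)[OF XY \<psi>]
      by (rule L2_pairing_limit[OF X2(1) f Xlim schwartz_L2[OF fourier_integral_schwartz[OF \<psi>]]])
    ultimately show "(LINT \<xi>|lborel. g \<xi> * \<psi> \<xi>) = (LINT x|lborel. f x * fourier_integral \<psi> x)"
      by (rule LIMSEQ_unique)
  qed
  moreover have "L2_norm g \<le> L2_norm f"
    by (rule L2_norm_limit_le[OF g(1) Y2 g(2)])
  ultimately show ?thesis using g(1) by blast
qed

lemma has_fourier_L2:
  assumes f: "f \<in> L2" and fg: "has_fourier f g"
  shows "g \<in> L2" "L2_norm g \<le> L2_norm f"
proof -
  obtain h where h: "h \<in> L2" "has_fourier f h" "L2_norm h \<le> L2_norm f" using L2_has_fourier[OF f] by blast
  have g: "g \<in> borel_measurable borel" using has_fourierD(2)[OF fg] by (rule tempered_measurable)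
  note c = L2_cong_AE[OF h(1) g has_fourier_unique[OF h(2) fg]]
  show "g \<in> L2" by (rule c(1))
  show "L2_norm g \<le> L2_norm f" using c(2) h(3) by simp
qed

lemma L2_reflect:
  fixes f :: "'a::euclidean_space \<Rightarrow> complex"
  assumes f: "f \<in> L2" shows "(\<lambda>x. f (- x)) \<in> L2" "L2_norm (\<lambda>x. f (- x)) = L2_norm f"
proof -
  note [measurable] = L2_measurable[OF f]
  have "(\<integral>\<^sup>+x. ennreal ((norm (f (- x)))\<^sup>2) \<partial>lborel) = (\<integral>\<^sup>+x. ennreal ((norm (f x))\<^sup>2) \<partial>lborel)"
    by (subst (2) nn_integral_lborel_affine[of _ "-1" 0]) auto
  also have "\<dots> = ennreal ((L2_norm f)\<^sup>2)" by (rule L2_nn_integral[OF f])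
  finally have eq: "(\<integral>\<^sup>+x. ennreal ((norm (f (- x)))\<^sup>2) \<partial>lborel) = ennreal ((L2_norm f)\<^sup>2)" .
  show 1: "(\<lambda>x. f (- x)) \<in> L2"
    by (rule L2_bound_nn(1)[OF _ eq_refl[OF eq]]) auto
  show "L2_norm (\<lambda>x. f (- x)) = L2_norm f"
    using eq unfolding L2_nn_integral[OF 1] by simp
qed

lemma L2_has_inverse_fourier:
  assumes g: "g \<in> L2"
  shows "\<exists>f\<in>L2. has_fourier f g \<and> L2_norm f \<le> L2_norm g"
proof -
  obtain h where h: "h \<in> L2" "has_fourier g h" "L2_norm h \<le> L2_norm g" using L2_has_fourier[OF g] by blast
  then show ?thesis
    using L2_reflect[OF h(1)] has_fourier_inverse[OF h(2)] by (intro bexI[of _ "\<lambda>x. h (- x)"]) auto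
qed

lemma has_fourier_L2_rev:
  assumes g: "g \<in> L2" and fg: "has_fourier f g"
  shows "f \<in> L2" "L2_norm f \<le> L2_norm g"
proof -
  obtain h where h: "h \<in> L2" "has_fourier h g" "L2_norm h \<le> L2_norm g" using L2_has_inverse_fourier[OF g] by blast
  have f: "f \<in> borel_measurable borel" using has_fourierD(1)[OF fg] by (rule tempered_measurable)
  note c = L2_cong_AE[OF h(1) f has_fourier_inj[OF h(2) fg]]
  show "f \<in> L2" by (rule c(1))
  show "L2_norm f \<le> L2_norm g" using c(2) h(3) by simp
qed

lemma L2_fourier:
  assumes f: "f \<in> L2"
  shows "has_fourier f (fourier f)" "fourier f \<in> L2" "L2_norm (fourier f) \<le> L2_norm f"
proof -
  show 1: "has_fourier f (fourier f)" using L2_has_fourier[OF f] has_fourier_fourier by blast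
  show "fourier f \<in> L2" "L2_norm (fourier f) \<le> L2_norm f" by (rule has_fourier_L2[OF f 1])+
qed

section \<open>The Schroedinger group is a Fourier multiplier\<close>

lemma C0_group_L2: "C0_group W \<Longrightarrow> f \<in> L2 \<Longrightarrow> W t f \<in> L2"
  unfolding C0_group_def by blast

lemma C0_group_linear:
  "C0_group W \<Longrightarrow> f \<in> L2 \<Longrightarrow> g \<in> L2 \<Longrightarrow> AE x in lborel. W t (\<lambda>x. a * f x + b * g x) x = a * W t f x + b * W t g x"
  unfolding C0_group_def by blast

lemma C0_group_add:
  "C0_group W \<Longrightarrow> f \<in> L2 \<Longrightarrow> AE x in lborel. W (t + r) f x = W t (W r f) x"
  unfolding C0_group_def by blast

lemma C0_group_0: "C0_group W \<Longrightarrow> f \<in> L2 \<Longrightarrow> AE x in lborel. W 0 f x = f x"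
  unfolding C0_group_def by blast

lemma C0_group_bounded:
  assumes "C0_group W" obtains M where "\<And>f. f \<in> L2 \<Longrightarrow> L2_norm (W t f) \<le> M * L2_norm f"
proof -
  have "\<forall>t. \<exists>M. \<forall>f\<in>L2. L2_norm (W t f) \<le> M * L2_norm f"
    using assms unfolding C0_group_def by (elim conjE)
  then show ?thesis using that by meson
qed

lemma C0_group_diff:
  assumes "C0_group W" "f \<in> L2" "g \<in> L2"
  shows "AE x in lborel. W t (\<lambda>x. f x - g x) x = W t f x - W t g x"
  using C0_group_linear[OF assms, of t 1 "-1"] by simp

lemma generatorD:
  assumes "(f, a) \<in> generator W"
  shows "f \<in> L2" "a \<in> L2" "((\<lambda>h. L2_norm (\<lambda>x. (W h f x - f x) /\<^sub>R h - a x)) \<longlongrightarrow> 0) (at 0)"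
  using assms by (auto simp: generator_def)

lemma diff_quot_L2: "f \<in> L2 \<Longrightarrow> g \<in> L2 \<Longrightarrow> a \<in> L2 \<Longrightarrow> (\<lambda>x. (g x - f x) /\<^sub>R h - a x) \<in> L2"
  using L2_diff_mem[OF L2_scale(1)[OF L2_diff_mem[of g f], of "of_real (inverse h)"], of a]
  by (simp add: scaleR_conv_of_real)

text \<open>The bounded operator \<open>W r\<close> commutes with the difference quotients of the group, up to null sets.\<close>

lemma generator_invariant:
  assumes W: "C0_group W" and fa: "(f, a) \<in> generator W"
  shows "(W r f, W r a) \<in> generator W"
proof -
  note f = generatorD(1)[OF fa] and a = generatorD(2)[OF fa]
  note WL2 = C0_group_L2[OF W]
  let ?D = "\<lambda>h x. (W h f x - f x) /\<^sub>R h - a x"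
  let ?P = "\<lambda>h x. (W h (W r f) x - W r f x) /\<^sub>R h - W r a x"
  have D: "?D h \<in> L2" for h by (intro diff_quot_L2 f a WL2)
  have P: "?P h \<in> L2" for h by (intro diff_quot_L2 f a WL2)
  obtain M where M: "\<And>f. f \<in> L2 \<Longrightarrow> L2_norm (W r f) \<le> M * L2_norm f"
    using C0_group_bounded[OF W, of r] by blast
  have "AE x in lborel. W r (?D h) x = ?P h x" for h
  proof -
    let ?E = "\<lambda>x. of_real (inverse h) * W h f x + of_real (- inverse h) * f x"
    have E: "?E \<in> L2" by (intro L2_add_mem L2_scale f WL2)
    have De: "?D h = (\<lambda>x. ?E x - a x)"
      by (auto simp: scaleR_conv_of_real algebra_simps)
    have "AE x in lborel. W r (?D h) x = W r ?E x - W r a x"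
      unfolding De by (rule C0_group_diff[OF W E a])
    moreover have "AE x in lborel. W r ?E x = of_real (inverse h) * W r (W h f) x + of_real (- inverse h) * W r f x"
      by (rule C0_group_linear[OF W WL2[OF f] f])
    moreover have "AE x in lborel. W (r + h) f x = W r (W h f) x" by (rule C0_group_add[OF W f])
    moreover have "AE x in lborel. W (h + r) f x = W h (W r f) x" by (rule C0_group_add[OF W f])
    ultimately show ?thesis
    proof eventually_elim
      case (elim x)
      have "W r (W h f) x = W h (W r f) x" using elim(3,4) by (simp add: add.commute[of r h])
      then show ?case
        unfolding elim(1,2) by (simp only: scaleR_conv_of_real right_diff_distrib of_real_minus) simp
    qed
  qed
  then have "L2_norm (?P h) \<le> M * L2_norm (?D h)" for h
    using L2_cong_AE(2)[OF WL2[OF D[of h]] L2_measurable[OF P[of h]], of r] M[OF D[of h]] by simp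
  moreover have "((\<lambda>h. M * L2_norm (?D h)) \<longlongrightarrow> 0) (at 0)"
    by (rule tendsto_mult_right_zero[OF generatorD(3)[OF fa]])
  ultimately have "((\<lambda>h. L2_norm (?P h)) \<longlongrightarrow> 0) (at 0)"
    by (intro Lim_null_comparison[of "\<lambda>h. L2_norm (?P h)"]) (auto intro: always_eventually)
  then show ?thesis using WL2 f a by (simp add: generator_def)
qed

lemma tempered_norm_sq: "tempered_fun F \<Longrightarrow> tempered_fun (\<lambda>\<xi>. - \<i> * of_real ((norm \<xi>)\<^sup>2) * F \<xi>)"
proof (rule tempered_mult[where C = 1 and k = 2])
  fix \<xi> :: 'a
  have "(norm \<xi>)\<^sup>2 \<le> (1 + norm \<xi>) ^ 2" by (intro power_mono) auto
  then show "norm (- \<i> * complex_of_real ((norm \<xi>)\<^sup>2)) \<le> 1 * (1 + norm \<xi>) ^ 2"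
    by (simp only: norm_mult norm_minus_cancel norm_ii norm_of_real abs_power2 mult_1_left)
qed auto

lemma laplacian_pairing:
  assumes fF: "has_fourier f F" and \<psi>: "\<psi> \<in> schwartz"
  shows "(LINT \<xi>|lborel. (- \<i> * of_real ((norm \<xi>)\<^sup>2) * F \<xi>) * \<psi> \<xi>)
    = \<i> * (LINT x|lborel. f x * laplacian (fourier_integral \<psi>) x)"
proof -
  have s: "(\<lambda>x. - of_real ((norm x)\<^sup>2) * \<psi> x) \<in> schwartz"
    using schwartz_cmult[OF schwartz_norm_sq[OF \<psi>], of "-1"] by (simp add: mult.assoc)
  have "(LINT \<xi>|lborel. (- \<i> * of_real ((norm \<xi>)\<^sup>2) * F \<xi>) * \<psi> \<xi>) = (LINT \<xi>|lborel. \<i> * (F \<xi> * (- of_real ((norm \<xi>)\<^sup>2) * \<psi> \<xi>)))"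
    by (simp add: mult_ac)
  also have "\<dots> = \<i> * (LINT \<xi>|lborel. F \<xi> * (- of_real ((norm \<xi>)\<^sup>2) * \<psi> \<xi>))"
    by (rule integral_mult_right_zero)
  also have "\<dots> = \<i> * (LINT x|lborel. f x * laplacian (fourier_integral \<psi>) x)"
    using has_fourierD(3)[OF fF s] by (simp add: laplacian_fourier_integral[OF \<psi>])
  finally show ?thesis .
qed

text \<open>Every test function is a transform \<open>\<psi>^\<close>, and \<open>\<Delta> \<psi>^\<close> is the transform of \<open>- |x|\<^sup>2 \<psi>\<close>; so the weak
  equation says that \<open>g\<close> has the transform \<open>- i |\<xi>|\<^sup>2 f^\<close>.\<close>

lemma i_laplacian_fourier:
  assumes "(f, g) \<in> i_laplacian"
  shows "f \<in> L2" "g \<in> L2" "AE \<xi> in lborel. fourier g \<xi> = - \<i> * of_real ((norm \<xi>)\<^sup>2) * fourier f \<xi>"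
proof -
  show f: "f \<in> L2" and g: "g \<in> L2"
    using assms by (auto simp: i_laplacian_def sobolev_def)
  have "has_fourier g (\<lambda>\<xi>. - \<i> * of_real ((norm \<xi>)\<^sup>2) * fourier f \<xi>)"
    unfolding has_fourier_def
  proof (intro conjI ballI)
    show "tempered_fun g" by (rule L2_imp_tempered[OF g])
    show "tempered_fun (\<lambda>\<xi>. - \<i> * of_real ((norm \<xi>)\<^sup>2) * fourier f \<xi>)"
      by (intro tempered_norm_sq L2_imp_tempered L2_fourier f)
    fix \<psi> :: "'a \<Rightarrow> complex" assume \<psi>: "\<psi> \<in> schwartz"
    show "(LINT \<xi>|lborel. - \<i> * of_real ((norm \<xi>)\<^sup>2) * fourier f \<xi> * \<psi> \<xi>) = (LINT x|lborel. g x * fourier_integral \<psi> x)"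
      using laplacian_pairing[OF L2_fourier(1)[OF f] \<psi>] fourier_integral_schwartz[OF \<psi>] assms
      by (simp add: i_laplacian_def)
  qed
  with L2_fourier(1)[OF g] show "AE \<xi> in lborel. fourier g \<xi> = - \<i> * of_real ((norm \<xi>)\<^sup>2) * fourier f \<xi>"
    by (rule has_fourier_unique)
qed

lemma i_laplacianI:
  assumes f: "f \<in> L2" and g: "g \<in> L2" and fF: "has_fourier f F"
    and gF: "has_fourier g (\<lambda>\<xi>. - \<i> * of_real ((norm \<xi>)\<^sup>2) * F \<xi>)"
  shows "(f, g) \<in> i_laplacian"
proof -
  note F = has_fourier_L2(1)[OF f fF] and G = has_fourier_L2(1)[OF g gF]
  have "(\<lambda>\<xi>. F \<xi> + \<i> * (- \<i> * of_real ((norm \<xi>)\<^sup>2) * F \<xi>)) \<in> L2"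
    by (intro L2_add_mem F L2_scale G)
  then have "(\<lambda>\<xi>. (1 + (norm \<xi>)\<^sup>2) powr (2 / 2) *\<^sub>R F \<xi>) \<in> L2"
    by (simp add: scaleR_conv_of_real algebra_simps add_nonneg_pos powr_one)
  then have "sobolev_weighted 2 f \<in> L2"
    unfolding sobolev_weighted_def
    by (rule L2_cong_AE) (use L2_measurable[OF L2_fourier(2)[OF f]] has_fourier_unique[OF fF L2_fourier(1)[OF f]] in auto)
  moreover have "(LINT x|lborel. g x * \<psi> x) = \<i> * (LINT x|lborel. f x * laplacian \<psi> x)" if \<psi>: "\<psi> \<in> schwartz" for \<psi>
  proof -
    obtain q where q: "q \<in> schwartz" "\<psi> = fourier_integral q" using schwartz_is_fourier_integral[OF \<psi>] by metis
    show ?thesis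
      unfolding q(2) has_fourierD(3)[OF gF q(1), symmetric] laplacian_pairing[OF fF q(1)] ..
  qed
  ultimately show ?thesis using f g by (simp add: i_laplacian_def sobolev_def)
qed

lemma fourier_cong_AE:
  assumes f: "f \<in> L2" and g: "g \<in> L2" and eq: "AE x in lborel. f x = g x"
  shows "AE \<xi> in lborel. fourier f \<xi> = fourier g \<xi>"
proof (rule has_fourier_unique)
  show "has_fourier g (fourier f)"
    by (rule has_fourier_cong_AE[OF L2_fourier(1)[OF f] L2_measurable[OF g] L2_measurable[OF L2_fourier(2)[OF f]] eq]) simp
  show "has_fourier g (fourier g)" by (rule L2_fourier(1)[OF g])
qed

lemma L2_norm_fourier_diff_quot:
  assumes f: "f \<in> L2" and g: "g \<in> L2" and a: "a \<in> L2"
  shows "L2_norm (\<lambda>\<xi>. (fourier g \<xi> - fourier f \<xi>) /\<^sub>R h - fourier a \<xi>) \<le> L2_norm (\<lambda>x. (g x - f x) /\<^sub>R h - a x)"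
proof -
  have "has_fourier (\<lambda>x. of_real (inverse h) * (g x - f x) + (-1) * a x) (\<lambda>\<xi>. of_real (inverse h) * (fourier g \<xi> - fourier f \<xi>) + (-1) * fourier a \<xi>)"
    by (intro has_fourier_lincomb has_fourier_diff L2_fourier f g a)
  then have "has_fourier (\<lambda>x. (g x - f x) /\<^sub>R h - a x) (\<lambda>\<xi>. (fourier g \<xi> - fourier f \<xi>) /\<^sub>R h - fourier a \<xi>)"
    by (simp add: scaleR_conv_of_real)
  from has_fourier_L2(2)[OF diff_quot_L2[OF f g a] this] show ?thesis .
qed

lemma norm_exp_i_times [simp]: "norm (exp (\<i> * complex_of_real r)) = 1"
  by (simp add: norm_exp_eq_Re)

text \<open>On the domain of the generator the transform \<open>U r\<close> of the orbit satisfies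
  \<open>\<partial>\<^sub>r U = - i |\<xi>|\<^sup>2 U\<close> in \<open>L\<^sup>2\<close>. So on a ball of frequencies, where \<open>|\<xi>|\<^sup>2\<close> is bounded, the distance of
  \<open>exp (i r |\<xi>|\<^sup>2) U r\<close> from its initial value has derivative zero.\<close>

lemma flow_on_domain:
  fixes W :: "real \<Rightarrow> ('a::euclidean_space \<Rightarrow> complex) \<Rightarrow> 'a \<Rightarrow> complex"
  assumes W: "schroedinger_group W" and fa: "(f, a) \<in> generator W"
  shows "AE \<xi> in lborel. fourier (W t f) \<xi> = exp (- \<i> * of_real (t * (norm \<xi>)\<^sup>2)) * fourier f \<xi>"
proof -
  have C0: "C0_group W" and gen: "generator W = i_laplacian"
    using W by (auto simp: schroedinger_group_def)
  note f = generatorD(1)[OF fa]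
  note WL2 = C0_group_L2[OF C0]
  define U where "U r = fourier (W r f)" for r
  define B where "B r = fourier (W r a)" for r
  have U: "U r \<in> L2" for r unfolding U_def by (intro L2_fourier WL2 f)
  note [measurable] = L2_measurable[OF U]
  have BU: "AE \<xi> in lborel. B r \<xi> = - \<i> * of_real ((norm \<xi>)\<^sup>2) * U r \<xi>" for r
    unfolding U_def B_def using generator_invariant[OF C0 fa, of r] unfolding gen by (rule i_laplacian_fourier(3))
  have B: "B r \<in> L2" for r unfolding B_def by (intro L2_fourier WL2 generatorD(2)[OF fa])
  note [measurable] = L2_measurable[OF B]
  have Ulim: "((\<lambda>h. L2_norm (\<lambda>\<xi>. (U (r + h) \<xi> - U r \<xi>) /\<^sub>R h - B r \<xi>)) \<longlongrightarrow> 0) (at 0)" for r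
  proof (rule Lim_null_comparison)
    show "((\<lambda>h. L2_norm (\<lambda>x. (W h (W r f) x - W r f x) /\<^sub>R h - W r a x)) \<longlongrightarrow> 0) (at 0)"
      by (rule generatorD(3)[OF generator_invariant[OF C0 fa]])
    have "L2_norm (\<lambda>\<xi>. (U (r + h) \<xi> - U r \<xi>) /\<^sub>R h - B r \<xi>) \<le> L2_norm (\<lambda>x. (W h (W r f) x - W r f x) /\<^sub>R h - W r a x)" for h
    proof -
      have "AE \<xi> in lborel. U (h + r) \<xi> = fourier (W h (W r f)) \<xi>"
        unfolding U_def by (rule fourier_cong_AE[OF WL2[OF f] WL2[OF WL2[OF f]] C0_group_add[OF C0 f]])
      then have "AE \<xi> in lborel. (U (r + h) \<xi> - U r \<xi>) /\<^sub>R h - B r \<xi> = (fourier (W h (W r f)) \<xi> - U r \<xi>) /\<^sub>R h - B r \<xi>"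
        by eventually_elim (simp add: add.commute)
      from L2_cong_AE(2)[OF diff_quot_L2[OF U U B] _ this]
      have "L2_norm (\<lambda>\<xi>. (U (r + h) \<xi> - U r \<xi>) /\<^sub>R h - B r \<xi>) = L2_norm (\<lambda>\<xi>. (fourier (W h (W r f)) \<xi> - U r \<xi>) /\<^sub>R h - B r \<xi>)"
        using L2_measurable[OF diff_quot_L2[OF U L2_fourier(2)[OF WL2[OF WL2[OF f]]] B]] by simp
      then show ?thesis
        using L2_norm_fourier_diff_quot[OF WL2[OF f, of r] WL2[OF WL2[OF f, of r], of h] WL2[OF generatorD(2)[OF fa], of r], of h]
        unfolding U_def B_def by simp
    qed
    then show "eventually (\<lambda>h. norm (L2_norm (\<lambda>\<xi>. (U (r + h) \<xi> - U r \<xi>) /\<^sub>R h - B r \<xi>)) \<le> L2_norm (\<lambda>x. (W h (W r f) x - W r f x) /\<^sub>R h - W r a x)) (at 0)"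
      by simp
  qed
  have ball: "AE \<xi> in lborel. \<xi> \<in> cball 0 \<rho> \<longrightarrow> U t \<xi> * exp (\<i> * of_real (t * (norm \<xi>)\<^sup>2)) = U 0 \<xi>" for \<rho> :: real
  proof -
    have [measurable]: "cball (0::'a) \<rho> \<in> sets borel" by simp
    define V where "V r \<xi> = indicator (cball 0 \<rho>) \<xi> * (exp (\<i> * of_real (r * (norm \<xi>)\<^sup>2)) * U r \<xi>)" for r and \<xi> :: 'a
    have V: "V r \<in> L2" for r
      unfolding V_def[abs_def]
      by (rule L2_norm_mono(1)[OF U[of r], where c = 1]) (auto simp: norm_mult indicator_def)
    define N where "N r = L2_norm (\<lambda>\<xi>. V r \<xi> - V 0 \<xi>)" for r
    have step: "norm ((N (r + h) - N r) / h) \<le> L2_norm (\<lambda>\<xi>. (U (r + h) \<xi> - U r \<xi>) /\<^sub>R h - B r \<xi>) + \<bar>h\<bar> * (\<rho> ^ 4 * L2_norm (U r))"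
      if h: "h \<noteq> 0" for r h
    proof -
      let ?Q = "\<lambda>\<xi>. (U (r + h) \<xi> - U r \<xi>) /\<^sub>R h - B r \<xi>"
      let ?S = "\<lambda>\<xi>. of_real (h\<^sup>2 * \<rho> ^ 4) * U r \<xi>"
      have Q: "?Q \<in> L2" by (intro diff_quot_L2 U B)
      have "L2_norm (\<lambda>\<xi>. V (r + h) \<xi> - V r \<xi>) \<le> 1 * L2_norm (\<lambda>\<xi>. complex_of_real (norm (of_real h * ?Q \<xi>)) + of_real (norm (?S \<xi>)))"
      proof (rule L2_norm_mono(2))
        have n: "(\<lambda>x. complex_of_real (norm (u x))) \<in> L2" if "u \<in> L2" for u :: "'a \<Rightarrow> complex"
          by (rule L2_norm_mono(1)[OF that, of _ 1]) (use L2_measurable[OF that] in auto)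
        show "(\<lambda>\<xi>. complex_of_real (norm (of_real h * ?Q \<xi>)) + of_real (norm (?S \<xi>))) \<in> L2"
          by (intro L2_add_mem n L2_scale Q U)
        show "(\<lambda>\<xi>. V (r + h) \<xi> - V r \<xi>) \<in> borel_measurable borel"
          by (intro L2_measurable L2_diff_mem V)
        show "AE \<xi> in lborel. norm (V (r + h) \<xi> - V r \<xi>) \<le> 1 * norm (complex_of_real (norm (of_real h * ?Q \<xi>)) + of_real (norm (?S \<xi>)))"
          using BU[of r]
        proof eventually_elim
          case (elim \<xi>)
          show ?case
          proof (cases "\<xi> \<in> cball 0 \<rho>")
            case True
            then have \<rho>: "norm \<xi> \<le> \<rho>" by simp
            define q where "q = (norm \<xi>)\<^sup>2"
            have q: "0 \<le> q" "q \<le> \<rho>\<^sup>2" using \<rho> by (auto simp: q_def intro!: power_mono)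
            let ?e = "\<lambda>y. exp (\<i> * complex_of_real y)"
            \<comment> \<open>The remainder of the first-order Taylor expansion of the phase, of size \<open>h\<^sup>2\<close>.\<close>
            have e1: "norm (?e (- (h * q)) - (1 - \<i> * of_real (h * q))) \<le> (h * q)\<^sup>2"
              using iexp_approx1[of "- (h * q)" 1]
              by (simp add: power2_eq_square) (erule order_trans[rotated], simp)
            have e2: "(h * q)\<^sup>2 \<le> h\<^sup>2 * \<rho> ^ 4"
              using power_mono[OF q(2,1), of 2] by (simp add: power_mult_distrib power_mult[symmetric] mult_left_mono)
            have "V (r + h) \<xi> - V r \<xi> = ?e ((r + h) * q) * (U (r + h) \<xi> - ?e (- (h * q)) * U r \<xi>)"
            proof -
              have "?e ((r + h) * q) * ?e (- (h * q)) = ?e (r * q)"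
                unfolding exp_add[symmetric] by (simp add: algebra_simps)
              then show ?thesis
                using True by (simp add: V_def q_def[symmetric] right_diff_distrib mult.assoc[symmetric])
            qed
            also have "U (r + h) \<xi> - ?e (- (h * q)) * U r \<xi> = of_real h * ?Q \<xi> - (?e (- (h * q)) - (1 - \<i> * of_real (h * q))) * U r \<xi>"
              using h elim by (simp add: q_def scaleR_conv_of_real field_simps)
            also have "norm (?e ((r + h) * q) * (of_real h * ?Q \<xi> - (?e (- (h * q)) - (1 - \<i> * of_real (h * q))) * U r \<xi>))
                \<le> norm (of_real h * ?Q \<xi>) + norm ((?e (- (h * q)) - (1 - \<i> * of_real (h * q))) * U r \<xi>)"
              unfolding norm_mult[of "?e ((r + h) * q)"] norm_exp_i_times mult_1_left by (rule norm_triangle_ineq4)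
            also have "norm ((?e (- (h * q)) - (1 - \<i> * of_real (h * q))) * U r \<xi>) \<le> h\<^sup>2 * \<rho> ^ 4 * norm (U r \<xi>)"
              unfolding norm_mult using e1 e2 by (intro mult_right_mono) auto
            also have "h\<^sup>2 * \<rho> ^ 4 * norm (U r \<xi>) = norm (?S \<xi>)"
              unfolding norm_mult[of _ "U r \<xi>"] norm_of_real by simp
            also have "norm (of_real h * ?Q \<xi>) + norm (?S \<xi>) = 1 * norm (complex_of_real (norm (of_real h * ?Q \<xi>)) + of_real (norm (?S \<xi>)))"
              unfolding of_real_add[symmetric] norm_of_real by simp
            finally show ?thesis by simp
          next
            case False
            then show ?thesis by (simp add: V_def)
          qed
        qed
      qed simp
      also have "\<dots> \<le> L2_norm (\<lambda>\<xi>. of_real h * ?Q \<xi>) + L2_norm ?S"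
      proof -
        have n: "(\<lambda>x. complex_of_real (norm (u x))) \<in> L2" "L2_norm (\<lambda>x. complex_of_real (norm (u x))) = L2_norm u" if "u \<in> L2" for u :: "'a \<Rightarrow> complex"
          by (rule L2_norm_mono(1)[OF that, of _ 1], use L2_measurable[OF that] in auto) (simp add: L2_norm_def)
        show ?thesis
          using L2_triangle[OF n(1)[OF L2_scale(1)[OF Q]] n(1)[OF L2_scale(1)[OF U]], of "of_real h" "of_real (h\<^sup>2 * \<rho> ^ 4)" r]
          unfolding n(2)[OF L2_scale(1)[OF Q]] n(2)[OF L2_scale(1)[OF U]] by simp
      qed
      also have "\<dots> = \<bar>h\<bar> * L2_norm ?Q + h\<^sup>2 * \<rho> ^ 4 * L2_norm (U r)"
        unfolding L2_scale(2)[OF Q] L2_scale(2)[OF U] norm_of_real by simp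
      also have "\<dots> = \<bar>h\<bar> * (L2_norm ?Q + \<bar>h\<bar> * (\<rho> ^ 4 * L2_norm (U r)))"
        by (simp add: distrib_left power2_eq_square abs_mult_self_eq mult.assoc[symmetric])
      finally have le: "L2_norm (\<lambda>\<xi>. V (r + h) \<xi> - V r \<xi>) \<le> \<bar>h\<bar> * (L2_norm ?Q + \<bar>h\<bar> * (\<rho> ^ 4 * L2_norm (U r)))" .
      have "\<bar>N (r + h) - N r\<bar> \<le> L2_norm (\<lambda>\<xi>. V (r + h) \<xi> - V r \<xi>)"
        using L2_triangle_diff[OF V[of "r + h"] V[of r] V[of 0]] L2_triangle_diff[OF V[of r] V[of "r + h"] V[of 0]]
          L2_norm_minus_commute[of "V r" "V (r + h)"] unfolding N_def by simp
      with le have "\<bar>N (r + h) - N r\<bar> \<le> \<bar>h\<bar> * (L2_norm ?Q + \<bar>h\<bar> * (\<rho> ^ 4 * L2_norm (U r)))" by (rule order_trans[rotated])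
      then show ?thesis
        using h by (simp add: pos_divide_le_eq mult.commute)
    qed
    have "DERIV N r :> 0" for r
      unfolding DERIV_def
    proof (rule Lim_null_comparison)
      show "((\<lambda>h. L2_norm (\<lambda>\<xi>. (U (r + h) \<xi> - U r \<xi>) /\<^sub>R h - B r \<xi>) + \<bar>h\<bar> * (\<rho> ^ 4 * L2_norm (U r))) \<longlongrightarrow> 0) (at 0)"
        by (rule tendsto_eq_intros Ulim refl)+ simp
      show "eventually (\<lambda>h. norm ((N (r + h) - N r) / h) \<le> L2_norm (\<lambda>\<xi>. (U (r + h) \<xi> - U r \<xi>) /\<^sub>R h - B r \<xi>) + \<bar>h\<bar> * (\<rho> ^ 4 * L2_norm (U r))) (at 0)"
        using step by (auto simp: eventually_at_filter)
    qed
    then have "N t = N 0" by (intro DERIV_isconst_all) auto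
    then have "L2_norm (\<lambda>\<xi>. V t \<xi> - V 0 \<xi>) = 0" by (simp add: N_def)
    from L2_norm_eq_0[OF L2_diff_mem[OF V V] this] show ?thesis
      by eventually_elim (auto simp: V_def mult.commute)
  qed
  have "AE \<xi> in lborel. \<forall>n::nat. \<xi> \<in> cball 0 (real n) \<longrightarrow> U t \<xi> * exp (\<i> * of_real (t * (norm \<xi>)\<^sup>2)) = U 0 \<xi>"
    unfolding AE_all_countable using ball by blast
  moreover have "AE \<xi> in lborel. U 0 \<xi> = fourier f \<xi>"
    unfolding U_def by (rule fourier_cong_AE[OF WL2[OF f] f C0_group_0[OF C0 f]])
  ultimately show ?thesis
  proof eventually_elim
    case (elim \<xi>)
    obtain n where "norm \<xi> \<le> real n" using real_arch_simple by blast
    with elim have "U t \<xi> * exp (\<i> * of_real (t * (norm \<xi>)\<^sup>2)) = fourier f \<xi>" by auto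
    then have "exp (- \<i> * of_real (t * (norm \<xi>)\<^sup>2)) * fourier f \<xi> = U t \<xi> * (exp (\<i> * of_real (t * (norm \<xi>)\<^sup>2)) * exp (- \<i> * of_real (t * (norm \<xi>)\<^sup>2)))"
      by (simp add: mult_ac)
    also have "\<dots> = U t \<xi>" by (simp add: exp_minus)
    finally show ?case by (simp add: U_def)
  qed
qed

text \<open>Functions with compactly supported transform are dense in \<open>L\<^sup>2\<close> and lie in the domain of
  \<open>i \<Delta>\<close>.\<close>

theorem schroedinger_group_fourier:
  fixes W :: "real \<Rightarrow> ('a::euclidean_space \<Rightarrow> complex) \<Rightarrow> 'a \<Rightarrow> complex"
  assumes W: "schroedinger_group W" and f: "f \<in> L2"
  shows "has_fourier (W t f) (\<lambda>\<xi>. exp (- \<i> * of_real (t * (norm \<xi>)\<^sup>2)) * fourier f \<xi>)"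
proof -
  have C0: "C0_group W" and gen: "generator W = i_laplacian"
    using W by (auto simp: schroedinger_group_def)
  note WL2 = C0_group_L2[OF C0]
  let ?F = "fourier f"
  let ?e = "\<lambda>\<xi>::'a. exp (- \<i> * complex_of_real (t * (norm \<xi>)\<^sup>2))"
  have F: "?F \<in> L2" by (rule L2_fourier[OF f])
  note [measurable] = L2_measurable[OF F]
  have [measurable]: "cball (0::'a) r \<in> sets borel" for r by simp
  let ?G = "\<lambda>n \<xi>. indicator (cball 0 (real n)) \<xi> * ?F \<xi>"
  have G: "?G n \<in> L2" for n by (rule L2_indicator[OF F]) simp
  have eL2: "(\<lambda>\<xi>. ?e \<xi> * u \<xi>) \<in> L2" "L2_norm (\<lambda>\<xi>. ?e \<xi> * u \<xi>) = L2_norm u" if "u \<in> L2" for u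
    by (rule L2_norm_mono(1)[OF that, of _ 1], use L2_measurable[OF that] in \<open>auto simp: norm_mult simp del: mult_minus_left\<close>)
      (simp add: L2_norm_def norm_mult del: mult_minus_left)
  have "\<forall>n. \<exists>g\<in>L2. has_fourier g (?G n)" using L2_has_inverse_fourier[OF G] by blast
  then obtain g where g: "\<And>n. g n \<in> L2" "\<And>n. has_fourier (g n) (?G n)" by metis
  have dom: "\<exists>a. (g n, a) \<in> generator W" for n
  proof -
    have "(\<lambda>\<xi>. - \<i> * of_real ((norm \<xi>)\<^sup>2) * ?G n \<xi>) \<in> L2"
    proof (rule L2_norm_mono(1)[OF F, where c = "(real n)\<^sup>2"])
      show "AE \<xi> in lborel. norm (- \<i> * of_real ((norm \<xi>)\<^sup>2) * ?G n \<xi>) \<le> (real n)\<^sup>2 * norm (?F \<xi>)"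
        by (intro AE_I2) (auto simp: norm_mult norm_power indicator_def intro!: mult_right_mono power_mono simp del: mult_minus_left)
    qed auto
    then obtain a where "a \<in> L2" "has_fourier a (\<lambda>\<xi>. - \<i> * of_real ((norm \<xi>)\<^sup>2) * ?G n \<xi>)"
      using L2_has_inverse_fourier by blast
    with g[of n] have "(g n, a) \<in> i_laplacian" by (intro i_laplacianI)
    then show ?thesis unfolding gen by blast
  qed
  have Glim: "(\<lambda>n. L2_norm (\<lambda>\<xi>. ?G n \<xi> - ?F \<xi>)) \<longlonglongrightarrow> 0" by (rule L2_truncate[OF F])
  obtain M where M: "\<And>f. f \<in> L2 \<Longrightarrow> L2_norm (W t f) \<le> M * L2_norm f"
    using C0_group_bounded[OF C0, of t] by blast
  let ?M = "max M 0"
  have est: "L2_norm (\<lambda>\<xi>. fourier (W t f) \<xi> - ?e \<xi> * ?F \<xi>) \<le> (?M + 1) * L2_norm (\<lambda>\<xi>. ?G n \<xi> - ?F \<xi>)" for n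
  proof -
    have gf: "L2_norm (\<lambda>x. g n x - f x) \<le> L2_norm (\<lambda>\<xi>. ?G n \<xi> - ?F \<xi>)"
      by (rule has_fourier_L2_rev(2)[OF L2_diff_mem[OF G F] has_fourier_diff[OF g(2) L2_fourier(1)[OF f]]])
    have "L2_norm (\<lambda>\<xi>. fourier (W t f) \<xi> - fourier (W t (g n)) \<xi>) \<le> L2_norm (\<lambda>x. W t f x - W t (g n) x)"
      by (rule has_fourier_L2(2)[OF L2_diff_mem has_fourier_diff]) (intro WL2 f g L2_fourier)+
    also have "\<dots> = L2_norm (\<lambda>x. W t (g n) x - W t f x)" by (rule L2_norm_minus_commute)
    also have "\<dots> = L2_norm (W t (\<lambda>x. g n x - f x))"
      by (rule L2_cong_AE(2)[symmetric, OF WL2[OF L2_diff_mem[OF g(1) f]] L2_measurable[OF L2_diff_mem[OF WL2[OF g(1)] WL2[OF f]]] C0_group_diff[OF C0 g(1) f]])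
    also have "\<dots> \<le> M * L2_norm (\<lambda>x. g n x - f x)" by (rule M[OF L2_diff_mem[OF g(1) f]])
    also have "\<dots> \<le> ?M * L2_norm (\<lambda>\<xi>. ?G n \<xi> - ?F \<xi>)"
      using gf by (intro mult_mono) auto
    finally have 1: "L2_norm (\<lambda>\<xi>. fourier (W t f) \<xi> - fourier (W t (g n)) \<xi>) \<le> ?M * L2_norm (\<lambda>\<xi>. ?G n \<xi> - ?F \<xi>)" .
    obtain a where a: "(g n, a) \<in> generator W" using dom by blast
    have "AE \<xi> in lborel. fourier (W t (g n)) \<xi> - ?e \<xi> * ?F \<xi> = ?e \<xi> * (?G n \<xi> - ?F \<xi>)"
      using flow_on_domain[OF W a, of t] has_fourier_unique[OF L2_fourier(1)[OF g(1)] g(2)[of n]]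
      by eventually_elim (simp add: right_diff_distrib)
    from L2_cong_AE(2)[OF L2_diff_mem[OF L2_fourier(2)[OF WL2[OF g(1)]] eL2(1)[OF F]] L2_measurable[OF eL2(1)[OF L2_diff_mem[OF G F]]] this]
    have 2: "L2_norm (\<lambda>\<xi>. fourier (W t (g n)) \<xi> - ?e \<xi> * ?F \<xi>) = L2_norm (\<lambda>\<xi>. ?G n \<xi> - ?F \<xi>)"
      using eL2(2)[OF L2_diff_mem[OF G F]] by simp
    have "L2_norm (\<lambda>\<xi>. fourier (W t f) \<xi> - ?e \<xi> * ?F \<xi>)
        \<le> L2_norm (\<lambda>\<xi>. fourier (W t f) \<xi> - fourier (W t (g n)) \<xi>) + L2_norm (\<lambda>\<xi>. fourier (W t (g n)) \<xi> - ?e \<xi> * ?F \<xi>)"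
      by (intro L2_triangle_diff L2_fourier WL2 g f eL2 F)
    with 1 2 show ?thesis by (simp add: distrib_right)
  qed
  have "(\<lambda>n. (?M + 1) * L2_norm (\<lambda>\<xi>. ?G n \<xi> - ?F \<xi>)) \<longlonglongrightarrow> 0"
    by (rule tendsto_mult_right_zero[OF Glim])
  then have "L2_norm (\<lambda>\<xi>. fourier (W t f) \<xi> - ?e \<xi> * ?F \<xi>) \<le> 0"
    by (rule LIMSEQ_le_const) (use est in auto)
  then have "L2_norm (\<lambda>\<xi>. fourier (W t f) \<xi> - ?e \<xi> * ?F \<xi>) = 0" using L2_norm_nonneg[of "\<lambda>\<xi>. fourier (W t f) \<xi> - ?e \<xi> * ?F \<xi>"] by linarith
  from L2_norm_eq_0[OF L2_diff_mem[OF L2_fourier(2)[OF WL2[OF f]] eL2(1)[OF F]] this]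
  have ae: "AE \<xi> in lborel. fourier (W t f) \<xi> = ?e \<xi> * ?F \<xi>" by eventually_elim simp
  show ?thesis
    by (rule has_fourier_cong_AE[OF L2_fourier(1)[OF WL2[OF f]] L2_measurable[OF WL2[OF f]] L2_measurable[OF eL2(1)[OF F]] _ ae]) simp
qed

section \<open>The trace as a pairing over the paraboloid\<close>

lemma borel_measurable_fst_snd [measurable]:
  "(fst :: real \<times> real \<Rightarrow> real) \<in> borel_measurable borel"
  "(snd :: real \<times> real \<Rightarrow> real) \<in> borel_measurable borel"
  by (intro borel_measurable_continuous_onI continuous_intros)+

definition paraboloid :: "real \<times> real \<Rightarrow> real \<times> real" where
  "paraboloid \<zeta> = (fst \<zeta>, - (norm \<zeta>)\<^sup>2)"

lemma norm_sq_Pair: "(norm (z :: real \<times> real))\<^sup>2 = (fst z)\<^sup>2 + (snd z)\<^sup>2"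
  by (cases z) (simp add: norm_Pair)

lemma paraboloid_measurable [measurable]: "paraboloid \<in> borel_measurable borel"
  unfolding paraboloid_def[abs_def] by measurable

lemma one_plus_norm_le_paraboloid: "1 + norm \<zeta> \<le> 2 * (1 + norm (paraboloid \<zeta>))"
proof -
  have "(norm \<zeta>)\<^sup>2 \<le> norm (paraboloid \<zeta>)"
    using norm_snd_le[of "- (norm \<zeta>)\<^sup>2" "fst \<zeta>"] by (simp add: paraboloid_def)
  moreover have "2 * norm \<zeta> \<le> (norm \<zeta>)\<^sup>2 + 1"
    using sum_squares_bound[of "norm \<zeta>" 1] by simp
  ultimately show ?thesis using norm_ge_zero[of \<zeta>] norm_ge_zero[of "paraboloid \<zeta>"] by argo
qed

lemma rapid_paraboloid:
  assumes "rapid \<psi>" and s: "\<bar>s\<bar> = 1"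
  shows "rapid (\<lambda>\<zeta>. \<psi> (s *\<^sub>R paraboloid \<zeta>))"
  unfolding rapid_def
proof
  fix N
  obtain C where C: "0 \<le> C" "\<And>x. norm (\<psi> x) \<le> C / (1 + norm x) ^ N" using rapidE[OF assms(1)] by blast
  have "norm (\<psi> (s *\<^sub>R paraboloid \<zeta>)) \<le> (C * 2 ^ N) / (1 + norm \<zeta>) ^ N" for \<zeta>
  proof -
    let ?r = "norm \<zeta>" and ?p = "norm (s *\<^sub>R paraboloid \<zeta>)"
    have "1 + ?r \<le> 2 * (1 + ?p)"
      using one_plus_norm_le_paraboloid[of \<zeta>] unfolding norm_scaleR s by simp
    then have "(1 + ?r) ^ N \<le> 2 ^ N * (1 + ?p) ^ N"
      unfolding power_mult_distrib[symmetric] by (intro power_mono) auto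
    moreover have "0 < (1 + ?r) ^ N" "0 < (1 + ?p) ^ N"
      by (rule one_plus_norm_power_pos)+
    ultimately have "1 / (1 + ?p) ^ N \<le> 2 ^ N / (1 + ?r) ^ N" by (simp add: field_simps)
    from mult_left_mono[OF this C(1)] C(2)[of "s *\<^sub>R paraboloid \<zeta>"] show ?thesis by simp
  qed
  then show "\<exists>C. \<forall>\<zeta>. norm (\<psi> (s *\<^sub>R paraboloid \<zeta>)) \<le> C / (1 + norm \<zeta>) ^ N" by blast
qed

lemma paraboloid_L2:
  assumes \<psi>: "\<psi> \<in> schwartz"
  shows "(\<lambda>\<zeta>. \<psi> (paraboloid \<zeta>)) \<in> L2" "(\<lambda>\<zeta>. \<psi> (- paraboloid \<zeta>)) \<in> L2"
proof -
  note [measurable] = schwartz_measurable[OF \<psi>]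
  show "(\<lambda>\<zeta>. \<psi> (paraboloid \<zeta>)) \<in> L2"
    using rapid_paraboloid[OF schwartz_rapid[OF \<psi>], of 1] by (intro rapid_L2) simp_all
  show "(\<lambda>\<zeta>. \<psi> (- paraboloid \<zeta>)) \<in> L2"
    using rapid_paraboloid[OF schwartz_rapid[OF \<psi>], of "-1"] by (intro rapid_L2) simp_all
qed

text \<open>\<open>\<integral> \<Phi>(\<xi>,\<eta>) \<psi>^(-\<xi>, \<xi>\<^sup>2 + \<eta>\<^sup>2) e\<^sup>i\<^sup>y\<^sup>\<eta> d\<xi> d\<eta>\<close>: the pairing of \<open>\<psi>\<close> with the restriction to height
  \<open>y\<close> of the flow whose initial datum has transform \<open>\<Phi>\<close>.\<close>

definition slice :: "(real \<times> real \<Rightarrow> complex) \<Rightarrow> (real \<times> real \<Rightarrow> complex) \<Rightarrow> real \<Rightarrow> complex" where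
  "slice \<Phi> \<psi> y = (LINT \<zeta>|lborel. \<Phi> \<zeta> * fourier_integral \<psi> (- paraboloid \<zeta>) * exp (\<i> * of_real (y * snd \<zeta>)))"

lemma slice_integrable:
  assumes \<Phi>: "\<Phi> \<in> L2" and \<psi>: "\<psi> \<in> schwartz"
  shows "integrable lborel (\<lambda>\<zeta>. \<Phi> \<zeta> * fourier_integral \<psi> (- paraboloid \<zeta>))"
  by (rule L2_Cauchy_Schwarz(1)[OF \<Phi> paraboloid_L2(2)[OF fourier_integral_schwartz[OF \<psi>]]])

lemma slice_measurable_integrand [measurable]:
  assumes \<Phi>: "\<Phi> \<in> L2" and \<psi>: "\<psi> \<in> schwartz"
  shows "(\<lambda>\<zeta>. \<Phi> \<zeta> * fourier_integral \<psi> (- paraboloid \<zeta>)) \<in> borel_measurable borel"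
  using slice_integrable[OF assms] by auto

lemma slice_continuous:
  assumes \<Phi>: "\<Phi> \<in> L2" and \<psi>: "\<psi> \<in> schwartz"
  shows "continuous_on UNIV (slice \<Phi> \<psi>)"
  unfolding continuous_on_sequentially
proof (intro allI ballI impI)
  note [measurable] = slice_measurable_integrand[OF assms]
  fix Y :: "nat \<Rightarrow> real" and y assume "(\<forall>n. Y n \<in> UNIV) \<and> Y \<longlonglongrightarrow> y"
  then have Y: "Y \<longlonglongrightarrow> y" by simp
  let ?A = "\<lambda>\<zeta>. \<Phi> \<zeta> * fourier_integral \<psi> (- paraboloid \<zeta>)"
  have "(\<lambda>n. LINT \<zeta>|lborel. ?A \<zeta> * exp (\<i> * of_real (Y n * snd \<zeta>))) \<longlonglongrightarrow> (LINT \<zeta>|lborel. ?A \<zeta> * exp (\<i> * of_real (y * snd \<zeta>)))"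
  proof (rule integral_dominated_convergence[where w = "\<lambda>\<zeta>. norm (?A \<zeta>)"])
    show "AE \<zeta> in lborel. (\<lambda>n. ?A \<zeta> * exp (\<i> * of_real (Y n * snd \<zeta>))) \<longlonglongrightarrow> ?A \<zeta> * exp (\<i> * of_real (y * snd \<zeta>))"
      by (intro AE_I2 tendsto_intros Y)
    show "integrable lborel (\<lambda>\<zeta>. norm (?A \<zeta>))" by (intro integrable_norm slice_integrable assms)
    show "AE \<zeta> in lborel. norm (?A \<zeta> * exp (\<i> * of_real (Y n * snd \<zeta>))) \<le> norm (?A \<zeta>)" for n
      unfolding norm_mult[of _ "exp _"] norm_exp_i_times by simp
  qed measurable
  then show "(slice \<Phi> \<psi> \<circ> Y) \<longlonglongrightarrow> slice \<Phi> \<psi> y"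
    by (simp add: slice_def comp_def)
qed

lemma slice_tempered:
  assumes \<Phi>: "\<Phi> \<in> L2" and \<psi>: "\<psi> \<in> schwartz"
  shows "tempered_fun (slice \<Phi> \<psi>)"
proof (rule bounded_imp_tempered)
  show "slice \<Phi> \<psi> \<in> borel_measurable borel"
    by (intro borel_measurable_continuous_onI slice_continuous assms)
  fix y
  let ?A = "\<lambda>\<zeta>. \<Phi> \<zeta> * fourier_integral \<psi> (- paraboloid \<zeta>)"
  have "norm (slice \<Phi> \<psi> y) \<le> (LINT \<zeta>|lborel. norm (?A \<zeta> * exp (\<i> * of_real (y * snd \<zeta>))))"
    unfolding slice_def by (rule integral_norm_bound)
  then show "norm (slice \<Phi> \<psi> y) \<le> (LINT \<zeta>|lborel. norm (?A \<zeta>))"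
    unfolding norm_mult[of _ "exp _"] norm_exp_i_times by simp
qed

lemma integral_lborel_tensor:
  fixes u v :: "real \<Rightarrow> complex"
  assumes u: "integrable lborel u" and v: "integrable lborel v"
  shows "(LINT z|lborel. u (fst z) * v (snd z)) = (LINT x|lborel. u x) * (LINT y|lborel. v y)"
proof -
  have [measurable]: "u \<in> borel_measurable borel" "v \<in> borel_measurable borel" using u v by auto
  have "integrable (lborel \<Otimes>\<^sub>M lborel) (\<lambda>(x, y). u x * v y)"
  proof (rule lborel_pair.Fubini_integrable)
    show "integrable lborel (\<lambda>x. LINT y|lborel. norm (case (x, y) of (x, y) \<Rightarrow> u x * v y))"
      using u by (simp add: norm_mult)
  qed (use v in auto)
  from lborel_pair.integral_fst[OF this] show ?thesis
    by (simp add: lborel_prod case_prod_unfold)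
qed

text \<open>Uniform decay in time of the test functions of the trace: \<open>t\<close> and \<open>x\<close> share the decay of \<open>\<psi>\<close>.\<close>

lemma tensor_bound:
  fixes \<psi> :: "real \<times> real \<Rightarrow> complex" and \<theta> :: "real \<Rightarrow> complex"
  assumes \<psi>: "rapid \<psi>" and \<theta>: "rapid \<theta>"
  obtains C where "0 \<le> C" "\<And>t z. norm (\<psi> (fst z, t) * \<theta> (snd z)) \<le> (C / (1 + \<bar>t\<bar>) ^ 2) * (1 / (1 + norm z) ^ 2)"
proof -
  obtain C where C: "0 \<le> C" "\<And>x. norm (\<psi> x) \<le> C / (1 + norm x) ^ 4" using rapidE[OF \<psi>] by blast
  obtain D where D: "0 \<le> D" "\<And>x. norm (\<theta> x) \<le> D / (1 + norm x) ^ 2" using rapidE[OF \<theta>] by blast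
  show ?thesis
  proof (rule that)
    show "0 \<le> C * D" using C D by simp
    fix t and z :: "real \<times> real"
    have z: "norm z \<le> \<bar>fst z\<bar> + \<bar>snd z\<bar>" by (metis norm_Pair_le prod.collapse real_norm_def)
    then have zz: "1 + norm z \<le> (1 + \<bar>fst z\<bar>) * (1 + \<bar>snd z\<bar>)"
      by (simp add: algebra_simps) (erule order_trans, simp)
    have x: "1 + \<bar>fst z\<bar> \<le> 1 + norm (fst z, t)" "1 + \<bar>t\<bar> \<le> 1 + norm (fst z, t)"
      using norm_fst_le[of "fst z" t] norm_snd_le[of t "fst z"] by auto
    have "(1 + \<bar>t\<bar>) ^ 2 * (1 + norm z) ^ 2 \<le> (1 + \<bar>t\<bar>) ^ 2 * ((1 + \<bar>fst z\<bar>) * (1 + \<bar>snd z\<bar>)) ^ 2"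
      using zz by (intro mult_left_mono power_mono) auto
    also have "\<dots> = ((1 + \<bar>t\<bar>) ^ 2 * (1 + \<bar>fst z\<bar>) ^ 2) * (1 + \<bar>snd z\<bar>) ^ 2"
      by (simp add: power_mult_distrib)
    also have "\<dots> \<le> ((1 + norm (fst z, t)) ^ 2 * (1 + norm (fst z, t)) ^ 2) * (1 + \<bar>snd z\<bar>) ^ 2"
      using x by (intro mult_right_mono mult_mono power_mono) auto
    also have "\<dots> = (1 + norm (fst z, t)) ^ 4 * (1 + \<bar>snd z\<bar>) ^ 2"
      by (simp add: power_add[symmetric])
    finally have le: "(1 + \<bar>t\<bar>) ^ 2 * (1 + norm z) ^ 2 \<le> (1 + norm (fst z, t)) ^ 4 * (1 + \<bar>snd z\<bar>) ^ 2" .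
    have pos: "0 < (1 + \<bar>t\<bar>) ^ 2 * (1 + norm z) ^ 2" by (intro mult_pos_pos zero_less_power; simp add: add_pos_nonneg)
    have "norm (\<psi> (fst z, t) * \<theta> (snd z)) \<le> (C / (1 + norm (fst z, t)) ^ 4) * (D / (1 + norm (snd z)) ^ 2)"
      unfolding norm_mult using C D by (intro mult_mono) auto
    also have "\<dots> = (C * D) / ((1 + norm (fst z, t)) ^ 4 * (1 + \<bar>snd z\<bar>) ^ 2)" by simp
    also have "\<dots> \<le> (C * D) / ((1 + \<bar>t\<bar>) ^ 2 * (1 + norm z) ^ 2)"
      using le pos C D by (intro divide_left_mono mult_pos_pos) auto
    finally show "norm (\<psi> (fst z, t) * \<theta> (snd z)) \<le> ((C * D) / (1 + \<bar>t\<bar>) ^ 2) * (1 / (1 + norm z) ^ 2)" by simp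
  qed
qed

lemma schwartz_section_integrable:
  fixes \<psi> :: "real \<times> real \<Rightarrow> complex"
  assumes \<psi>: "\<psi> \<in> schwartz"
  shows "integrable lborel (\<lambda>x. \<psi> (x, t))"
proof -
  note [measurable] = schwartz_measurable[OF \<psi>]
  obtain C where C: "0 \<le> C" "\<And>x. norm (\<psi> x) \<le> C / (1 + norm x) ^ 2" using rapidE[OF schwartz_rapid[OF \<psi>]] by blast
  show ?thesis
  proof (rule Bochner_Integration.integrable_bound)
    show "integrable lborel (\<lambda>x::real. C * (1 / (1 + norm x) ^ 2))"
      by (intro integrable_mult_right integrable_weight) simp
    have "norm (\<psi> (x, t)) \<le> norm (C * (1 / (1 + norm x) ^ 2))" for x
    proof -
      have "C / (1 + norm (x, t)) ^ 2 \<le> C / (1 + norm x) ^ 2"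
        using norm_fst_le[of x t] C(1) by (intro divide_left_mono power_mono mult_pos_pos zero_less_power) (auto simp: add_pos_nonneg)
      then show ?thesis using C(1) C(2)[of "(x, t)"] by simp
    qed
    then show "AE x in lborel. norm (\<psi> (x, t)) \<le> norm (C * (1 / (1 + norm x) ^ 2))" by simp
  qed measurable
qed

lemma integrable_phase: "integrable lborel f \<Longrightarrow> g \<in> borel_measurable borel \<Longrightarrow> integrable lborel (\<lambda>x. exp (\<i> * complex_of_real (g x)) * f x)"
  for f :: "'a::euclidean_space \<Rightarrow> complex"
  by (rule Bochner_Integration.integrable_bound[where f = f]) (auto simp: norm_mult)

text \<open>Integrated over time, the oscillation \<open>exp (- i t |\<zeta>|\<^sup>2)\<close> of the flow turns the transform of
  \<open>\<psi>(x,t) \<theta>(y)\<close> in the two space variables into the space-time transform of \<open>\<psi>\<close> on the paraboloid.\<close>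

lemma time_integral_tensor:
  fixes \<psi> :: "real \<times> real \<Rightarrow> complex" and \<theta> :: "real \<Rightarrow> complex"
  assumes \<psi>: "\<psi> \<in> schwartz" and \<theta>: "\<theta> \<in> schwartz"
  shows "(LINT t|lborel. exp (- \<i> * of_real (t * (norm \<zeta>)\<^sup>2)) * fourier_integral (\<lambda>z. \<psi> (fst z, t) * \<theta> (snd z)) (- \<zeta>))
    = fourier_integral \<psi> (- paraboloid \<zeta>) * (LINT y|lborel. exp (\<i> * of_real (y * snd \<zeta>)) * \<theta> y)"
proof -
  note [measurable] = schwartz_measurable[OF \<psi>] schwartz_measurable[OF \<theta>]
  let ?k = "complex_of_real ((2 * pi) powr (- real DIM(real \<times> real) / 2))"
  let ?q = "(norm \<zeta>)\<^sup>2"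
  let ?\<Theta> = "LINT y|lborel. exp (\<i> * of_real (y * snd \<zeta>)) * \<theta> y"
  let ?X = "\<lambda>t. LINT x|lborel. exp (\<i> * of_real (x * fst \<zeta>)) * \<psi> (x, t)"
  have 1: "fourier_integral (\<lambda>z. \<psi> (fst z, t) * \<theta> (snd z)) (- \<zeta>) = ?k * (?X t * ?\<Theta>)" for t
  proof -
    have "(LINT z|lborel. exp (- \<i> * of_real (z \<bullet> - \<zeta>)) * (\<psi> (fst z, t) * \<theta> (snd z)))
        = (LINT z|lborel. (exp (\<i> * of_real (fst z * fst \<zeta>)) * \<psi> (fst z, t)) * (exp (\<i> * of_real (snd z * snd \<zeta>)) * \<theta> (snd z)))"
    proof (intro Bochner_Integration.integral_cong refl)
      fix z :: "real \<times> real"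
      have "exp (- \<i> * complex_of_real (z \<bullet> - \<zeta>)) = exp (\<i> * of_real (fst z * fst \<zeta>)) * exp (\<i> * of_real (snd z * snd \<zeta>))"
        by (subst exp_add[symmetric]) (simp add: inner_prod_def algebra_simps)
      then show "exp (- \<i> * of_real (z \<bullet> - \<zeta>)) * (\<psi> (fst z, t) * \<theta> (snd z))
          = (exp (\<i> * of_real (fst z * fst \<zeta>)) * \<psi> (fst z, t)) * (exp (\<i> * of_real (snd z * snd \<zeta>)) * \<theta> (snd z))"
        by (simp only: mult_ac)
    qed
    also have "\<dots> = ?X t * ?\<Theta>"
      by (rule integral_lborel_tensor) (intro integrable_phase schwartz_section_integrable \<psi> schwartz_integrable \<theta>; simp)+
    finally show ?thesis unfolding fourier_integral_def by simp
  qed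
  have "(LINT t|lborel. exp (- \<i> * of_real (t * ?q)) * ?X t) = (LINT t|lborel. (LINT x|lborel. exp (\<i> * of_real (x * fst \<zeta> - t * ?q)) * \<psi> (x, t)))"
  proof (intro Bochner_Integration.integral_cong refl)
    fix t
    have "exp (- \<i> * of_real (t * ?q)) * ?X t = (LINT x|lborel. exp (- \<i> * of_real (t * ?q)) * (exp (\<i> * of_real (x * fst \<zeta>)) * \<psi> (x, t)))"
      by (rule integral_mult_right_zero[symmetric])
    also have "\<dots> = (LINT x|lborel. exp (\<i> * of_real (x * fst \<zeta> - t * ?q)) * \<psi> (x, t))"
    proof (intro Bochner_Integration.integral_cong refl)
      fix x :: real
      have "exp (\<i> * complex_of_real (x * fst \<zeta> - t * ?q)) = exp (- \<i> * of_real (t * ?q)) * exp (\<i> * of_real (x * fst \<zeta>))"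
        by (subst exp_add[symmetric]) (simp add: right_diff_distrib)
      then show "exp (- \<i> * of_real (t * ?q)) * (exp (\<i> * of_real (x * fst \<zeta>)) * \<psi> (x, t)) = exp (\<i> * of_real (x * fst \<zeta> - t * ?q)) * \<psi> (x, t)"
        by (simp only: mult.assoc)
    qed
    finally show "exp (- \<i> * of_real (t * ?q)) * ?X t = \<dots>" .
  qed
  also have "\<dots> = (LINT p|lborel. exp (\<i> * of_real (fst p * fst \<zeta> - snd p * ?q)) * \<psi> p)"
  proof -
    have "integrable (lborel \<Otimes>\<^sub>M lborel) (\<lambda>(x, t). exp (\<i> * of_real (x * fst \<zeta> - t * ?q)) * \<psi> (x, t))"
      using integrable_phase[OF schwartz_integrable[OF \<psi>], of "\<lambda>p. fst p * fst \<zeta> - snd p * ?q"]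
      by (simp add: lborel_prod case_prod_unfold)
    from lborel_pair.integral_snd[OF this] show ?thesis by (simp add: lborel_prod case_prod_unfold)
  qed
  also have "?k * \<dots> = fourier_integral \<psi> (- paraboloid \<zeta>)"
    unfolding fourier_integral_def paraboloid_def
    by (intro arg_cong2[where f = "(*)"] Bochner_Integration.integral_cong refl) (simp add: inner_prod_def algebra_simps)
  finally have 2: "?k * (LINT t|lborel. exp (- \<i> * of_real (t * ?q)) * ?X t) = fourier_integral \<psi> (- paraboloid \<zeta>)"
    by simp
  have "(LINT t|lborel. exp (- \<i> * of_real (t * ?q)) * (?k * (?X t * ?\<Theta>))) = (LINT t|lborel. (?k * ?\<Theta>) * (exp (- \<i> * of_real (t * ?q)) * ?X t))"
    by (intro Bochner_Integration.integral_cong refl) (simp add: mult_ac del: mult_minus_left)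
  also have "\<dots> = (?k * ?\<Theta>) * (LINT t|lborel. exp (- \<i> * of_real (t * ?q)) * ?X t)"
    by (rule integral_mult_right_zero)
  finally show ?thesis unfolding 1 2[symmetric] by (simp only: mult_ac)
qed

text \<open>The interchange of the integrals in \<open>t\<close> and \<open>\<zeta>\<close> is justified in \<open>L\<^sup>2\<close> alone: at time \<open>t\<close> the test function
  has norm \<open>O((1 + |t|)\<^sup>-\<^sup>2)\<close>, and Bessel's inequality passes this on to its transform.\<close>

lemma flow_pairing:
  fixes W :: "real \<Rightarrow> (real \<times> real \<Rightarrow> complex) \<Rightarrow> real \<times> real \<Rightarrow> complex"
  assumes W: "schroedinger_group W" and \<phi>: "\<phi> \<in> L2" and \<psi>: "\<psi> \<in> schwartz" and \<theta>: "\<theta> \<in> schwartz"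
  shows "(LINT t|lborel. LINT z|lborel. W t \<phi> z * \<psi> (fst z, t) * \<theta> (snd z)) = (LINT y|lborel. slice (fourier \<phi>) \<psi> y * \<theta> y)"
proof -
  note [measurable] = schwartz_measurable[OF \<psi>] schwartz_measurable[OF \<theta>]
  let ?\<Phi> = "fourier \<phi>"
  have \<Phi>: "?\<Phi> \<in> L2" by (rule L2_fourier[OF \<phi>])
  note [measurable] = L2_measurable[OF \<Phi>]
  let ?c = "\<lambda>t z. \<psi> (fst z, t) * \<theta> (snd z)"
  let ?e = "\<lambda>t \<zeta>. exp (- \<i> * complex_of_real (t * (norm \<zeta>)\<^sup>2))"
  let ?I = "\<lambda>t \<zeta>. ?\<Phi> \<zeta> * (?e t \<zeta> * fourier_integral (?c t) (- \<zeta>))"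
  have c: "?c t \<in> schwartz" for t by (rule schwartz_tensor[OF \<psi> \<theta>])
  have step1: "(LINT z|lborel. W t \<phi> z * \<psi> (fst z, t) * \<theta> (snd z)) = (LINT \<zeta>|lborel. ?I t \<zeta>)" for t
  proof -
    let ?p = "\<lambda>\<zeta>. fourier_integral (?c t) (- \<zeta>)"
    have p: "?p \<in> schwartz" by (intro schwartz_reflect fourier_integral_schwartz c)
    have "fourier_integral ?p z = ?c t z" for z
      using fourier_integral_reflect[OF schwartz_measurable[OF fourier_integral_schwartz[OF c[of t]]]] schwartz_inversion[OF c[of t]]
      by simp
    then have "(LINT z|lborel. W t \<phi> z * \<psi> (fst z, t) * \<theta> (snd z)) = (LINT z|lborel. W t \<phi> z * fourier_integral ?p z)"
      by (simp add: mult.assoc)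
    also have "\<dots> = (LINT \<zeta>|lborel. ?e t \<zeta> * ?\<Phi> \<zeta> * ?p \<zeta>)"
      by (rule has_fourierD(3)[OF schroedinger_group_fourier[OF W \<phi>] p, symmetric])
    finally show ?thesis by (simp only: mult_ac)
  qed
  have Fm [measurable]: "(\<lambda>(t, \<zeta>). fourier_integral (?c t) (- \<zeta>)) \<in> borel_measurable (borel \<Otimes>\<^sub>M borel)"
  proof -
    have "(\<lambda>p. LINT z|lborel. exp (- \<i> * of_real (z \<bullet> (- snd p))) * ?c (fst p) z) \<in> borel_measurable (borel \<Otimes>\<^sub>M borel)"
      by (rule lborel.borel_measurable_lebesgue_integral) measurable
    then show ?thesis unfolding fourier_integral_def case_prod_unfold by measurable
  qed
  have int: "integrable (lborel \<Otimes>\<^sub>M lborel) (\<lambda>(t, \<zeta>). ?I t \<zeta>)"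
  proof (rule lborel_pair.Fubini_integrable)
    show "(\<lambda>(t, \<zeta>). ?I t \<zeta>) \<in> borel_measurable (lborel \<Otimes>\<^sub>M lborel)"
      using Fm by measurable
    have r: "(\<lambda>\<zeta>. fourier_integral (?c t) (- \<zeta>)) \<in> L2" "L2_norm (\<lambda>\<zeta>. fourier_integral (?c t) (- \<zeta>)) \<le> L2_norm (?c t)" for t
      using L2_reflect[OF fourier_integral_L2(1)[OF schwartz_integrable[OF c[of t]] schwartz_L2[OF c[of t]]]]
        fourier_integral_L2(2)[OF schwartz_integrable[OF c[of t]] schwartz_L2[OF c[of t]]] by auto
    have nI: "norm (?I t \<zeta>) = norm (?\<Phi> \<zeta>) * norm (fourier_integral (?c t) (- \<zeta>))" for t \<zeta>
      unfolding norm_mult norm_character by simp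
    show "AE t in lborel. integrable lborel (\<lambda>\<zeta>. case (t, \<zeta>) of (t, \<zeta>) \<Rightarrow> ?I t \<zeta>)"
    proof (rule AE_I2)
      fix t
      have "(\<lambda>\<zeta>. ?e t \<zeta> * fourier_integral (?c t) (- \<zeta>)) \<in> L2"
        by (rule L2_norm_mono(1)[OF r(1)[of t], where c = 1])
          (use L2_measurable[OF r(1)[of t]] in \<open>auto simp: norm_mult simp del: mult_minus_left\<close>)
      from L2_Cauchy_Schwarz(1)[OF \<Phi> this] show "integrable lborel (\<lambda>\<zeta>. case (t, \<zeta>) of (t, \<zeta>) \<Rightarrow> ?I t \<zeta>)" by simp
    qed
    obtain C where C: "0 \<le> C" "\<And>t z. norm (?c t z) \<le> (C / (1 + \<bar>t\<bar>) ^ 2) * (1 / (1 + norm z) ^ 2)"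
      using tensor_bound[OF schwartz_rapid[OF \<psi>] schwartz_rapid[OF \<theta>]] by blast
    let ?w = "\<lambda>z::real \<times> real. complex_of_real (1 / (1 + norm z) ^ 2)"
    have w: "?w \<in> L2" by (rule L2_weight) simp
    show "integrable lborel (\<lambda>t. LINT \<zeta>|lborel. norm (case (t, \<zeta>) of (t, \<zeta>) \<Rightarrow> ?I t \<zeta>))"
    proof (rule Bochner_Integration.integrable_bound)
      show "integrable lborel (\<lambda>t::real. (L2_norm ?\<Phi> * C * L2_norm ?w) * (1 / (1 + norm t) ^ 2))"
        by (intro integrable_mult_right integrable_weight) simp
      show "(\<lambda>t. LINT \<zeta>|lborel. norm (case (t, \<zeta>) of (t, \<zeta>) \<Rightarrow> ?I t \<zeta>)) \<in> borel_measurable lborel"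
        using Fm by (intro lborel.borel_measurable_lebesgue_integral) measurable
      have "norm (LINT \<zeta>|lborel. norm (?I t \<zeta>)) \<le> norm ((L2_norm ?\<Phi> * C * L2_norm ?w) * (1 / (1 + norm t) ^ 2))" for t :: real
      proof -
        have "L2_norm (?c t) \<le> (C / (1 + \<bar>t\<bar>) ^ 2) * L2_norm ?w"
        proof (rule L2_norm_mono(2)[OF w])
          show "AE z in lborel. norm (?c t z) \<le> (C / (1 + \<bar>t\<bar>) ^ 2) * norm (?w z)"
            unfolding norm_of_real using C(2)[of _ t] by simp
        qed (use C in auto)
        then have "L2_norm ?\<Phi> * L2_norm (\<lambda>\<zeta>. fourier_integral (?c t) (- \<zeta>)) \<le> L2_norm ?\<Phi> * ((C / (1 + \<bar>t\<bar>) ^ 2) * L2_norm ?w)"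
          using r(2)[of t] by (intro mult_left_mono) auto
        moreover have "(LINT \<zeta>|lborel. norm (?I t \<zeta>)) \<le> L2_norm ?\<Phi> * L2_norm (\<lambda>\<zeta>. fourier_integral (?c t) (- \<zeta>))"
          unfolding nI by (rule L2_Cauchy_Schwarz(2)[OF \<Phi> r(1)])
        moreover have "0 \<le> (LINT \<zeta>|lborel. norm (?I t \<zeta>))" by simp
        ultimately show ?thesis using C(1) by (simp add: mult_ac)
      qed
      then show "AE t in lborel. norm (LINT \<zeta>|lborel. norm (case (t, \<zeta>) of (t, \<zeta>) \<Rightarrow> ?I t \<zeta>)) \<le> norm ((L2_norm ?\<Phi> * C * L2_norm ?w) * (1 / (1 + norm t) ^ 2))"
        by (intro AE_I2) (simp only: prod.case)
    qed
  qed
  let ?A = "\<lambda>\<zeta>. ?\<Phi> \<zeta> * fourier_integral \<psi> (- paraboloid \<zeta>)"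
  note [measurable] = slice_measurable_integrand[OF \<Phi> \<psi>]
  have int2: "integrable (lborel \<Otimes>\<^sub>M lborel) (\<lambda>(\<zeta>, y). ?A \<zeta> * (exp (\<i> * of_real (y * snd \<zeta>)) * \<theta> y))"
  proof (rule lborel_pair.Fubini_integrable)
    show "(\<lambda>(\<zeta>, y). ?A \<zeta> * (exp (\<i> * of_real (y * snd \<zeta>)) * \<theta> y)) \<in> borel_measurable (lborel \<Otimes>\<^sub>M lborel)"
      by measurable
    show "AE \<zeta> in lborel. integrable lborel (\<lambda>y. case (\<zeta>, y) of (\<zeta>, y) \<Rightarrow> ?A \<zeta> * (exp (\<i> * of_real (y * snd \<zeta>)) * \<theta> y))"
      unfolding prod.case by (intro AE_I2 integrable_mult_right integrable_phase schwartz_integrable \<theta>) simp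
    have "integrable lborel (\<lambda>\<zeta>. norm (?A \<zeta>) * (LINT y|lborel. norm (\<theta> y)))"
      by (intro integrable_mult_left integrable_norm slice_integrable \<Phi> \<psi>)
    then show "integrable lborel (\<lambda>\<zeta>. LINT y|lborel. norm (case (\<zeta>, y) of (\<zeta>, y) \<Rightarrow> ?A \<zeta> * (exp (\<i> * of_real (y * snd \<zeta>)) * \<theta> y)))"
      unfolding prod.case norm_mult[of "?A _"] norm_mult[of "exp _"] norm_exp_i_times by simp
  qed
  have "(LINT t|lborel. LINT z|lborel. W t \<phi> z * \<psi> (fst z, t) * \<theta> (snd z)) = (LINT t|lborel. LINT \<zeta>|lborel. ?I t \<zeta>)"
    by (simp only: step1)
  also have "\<dots> = (LINT \<zeta>|lborel. LINT t|lborel. ?I t \<zeta>)"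
    by (rule lborel_pair.Fubini_integral[OF int, symmetric])
  also have "\<dots> = (LINT \<zeta>|lborel. LINT y|lborel. ?A \<zeta> * (exp (\<i> * of_real (y * snd \<zeta>)) * \<theta> y))"
    unfolding integral_mult_right_zero time_integral_tensor[OF \<psi> \<theta>] by (simp only: mult.assoc)
  also have "\<dots> = (LINT y|lborel. LINT \<zeta>|lborel. ?A \<zeta> * (exp (\<i> * of_real (y * snd \<zeta>)) * \<theta> y))"
    by (rule lborel_pair.Fubini_integral[OF int2, symmetric])
  also have "\<dots> = (LINT y|lborel. slice ?\<Phi> \<psi> y * \<theta> y)"
    unfolding slice_def integral_mult_left_zero[symmetric] by (simp only: mult.assoc)
  finally show ?thesis .
qed

lemma continuous_eq_if_AE_eq:
  fixes u v :: "'a::euclidean_space \<Rightarrow> complex"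
  assumes "continuous_on UNIV u" "continuous_on UNIV v" "AE x in lborel. u x = v x"
  shows "u x = v x"
proof -
  have "closed {x. u x = v x}" using assms(1,2) by (rule closed_Collect_eq)
  moreover have "AE x in lebesgue. x \<in> {x. u x = v x}" using AE_completion[OF assms(3)] by simp
  ultimately show ?thesis using mem_closed_if_AE_lebesgue by blast
qed

text \<open>A continuous tempered function is determined by its pairings with Schwartz functions, so the
  function of \<open>y\<close> in the definition of the trace can only be \<open>slice\<close>, whose value at \<open>0\<close> is the
  right-hand side.\<close>

theorem has_trace_iff:
  fixes W :: "real \<Rightarrow> (real \<times> real \<Rightarrow> complex) \<Rightarrow> real \<times> real \<Rightarrow> complex"
  assumes W: "schroedinger_group W" and \<phi>: "\<phi> \<in> L2"
  shows "has_trace (\<lambda>t. W t \<phi>) w \<longleftrightarrow> tempered_fun w \<and>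
    (\<forall>\<psi>\<in>schwartz. (LINT z|lborel. w z * \<psi> z) = (LINT \<zeta>|lborel. fourier \<phi> \<zeta> * fourier_integral \<psi> (- paraboloid \<zeta>)))"
    (is "?L \<longleftrightarrow> ?R")
proof -
  have \<Phi>: "fourier \<phi> \<in> L2" by (rule L2_fourier[OF \<phi>])
  have s0: "slice (fourier \<phi>) \<psi> 0 = (LINT \<zeta>|lborel. fourier \<phi> \<zeta> * fourier_integral \<psi> (- paraboloid \<zeta>))" for \<psi>
    by (simp add: slice_def)
  show ?thesis
  proof
    assume L: ?L
    show ?R
    proof (intro conjI ballI)
      show "tempered_fun w" using L by (simp add: has_trace_def)
      fix \<psi> :: "real \<times> real \<Rightarrow> complex" assume \<psi>: "\<psi> \<in> schwartz"
      from L \<psi> obtain g where g: "continuous_on UNIV g" "tempered_fun g"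
        "\<And>\<theta>. \<theta> \<in> schwartz \<Longrightarrow> (LINT t|lborel. LINT z|lborel. W t \<phi> z * \<psi> (fst z, t) * \<theta> (snd z)) = (LINT y|lborel. g y * \<theta> y)"
        "g 0 = (LINT z|lborel. w z * \<psi> z)"
        unfolding has_trace_def by blast
      have "AE y in lborel. g y = slice (fourier \<phi>) \<psi> y"
      proof (rule tempered_eq_AE[OF g(2) slice_tempered[OF \<Phi> \<psi>]])
        fix \<theta> :: "real \<Rightarrow> complex" assume \<theta>: "\<theta> \<in> schwartz"
        show "(LINT y|lborel. g y * \<theta> y) = (LINT y|lborel. slice (fourier \<phi>) \<psi> y * \<theta> y)"
          unfolding g(3)[OF \<theta>, symmetric] by (rule flow_pairing[OF W \<phi> \<psi> \<theta>])
      qed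
      from continuous_eq_if_AE_eq[OF g(1) slice_continuous[OF \<Phi> \<psi>] this, of 0]
      show "(LINT z|lborel. w z * \<psi> z) = (LINT \<zeta>|lborel. fourier \<phi> \<zeta> * fourier_integral \<psi> (- paraboloid \<zeta>))"
        unfolding g(4) s0 .
    qed
  next
    assume R: ?R
    show ?L
      unfolding has_trace_def
    proof (intro conjI ballI)
      show "tempered_fun w" using R by blast
      fix \<psi> :: "real \<times> real \<Rightarrow> complex" assume \<psi>: "\<psi> \<in> schwartz"
      show "\<exists>g. continuous_on UNIV g \<and> tempered_fun g \<and>
        (\<forall>\<theta>\<in>schwartz. (LINT t|lborel. LINT z|lborel. W t \<phi> z * \<psi> (fst z, t) * \<theta> (snd z)) = (LINT y|lborel. g y * \<theta> y)) \<and>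
        g 0 = (LINT z|lborel. w z * \<psi> z)"
        using slice_continuous[OF \<Phi> \<psi>] slice_tempered[OF \<Phi> \<psi>] flow_pairing[OF W \<phi> \<psi>] R \<psi> s0[of \<psi>]
        by (intro exI[of _ "slice (fourier \<phi>) \<psi>"]) auto
    qed
  qed
qed

section \<open>Change of variables on the paraboloid\<close>

lemma nn_integral_square_substitution:
  fixes h :: "real \<Rightarrow> ennreal"
  assumes [measurable]: "h \<in> borel_measurable borel"
  shows "(\<integral>\<^sup>+x. h (x\<^sup>2) * ennreal (2 * x) * indicator {0<..} x \<partial>lborel) = (\<integral>\<^sup>+t. h t * indicator {0<..} t \<partial>lborel)"
proof -
  have mono: "(\<integral>\<^sup>+x. u x * indicator {0<..} x \<partial>lborel) = (SUP n. \<integral>\<^sup>+x. u x * indicator {0..a n} x \<partial>lborel)"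
    if [measurable]: "u \<in> borel_measurable borel" and a: "\<And>n. a n \<le> a (Suc n)" "\<And>x. \<exists>n. x \<le> a n"
    for u :: "real \<Rightarrow> ennreal" and a :: "nat \<Rightarrow> real"
  proof -
    have inc: "incseq (\<lambda>n x. u x * indicator {0..a n} x)"
      using a(1) by (intro incseq_SucI le_funI) (auto simp: indicator_def intro: order_trans)
    have "(SUP n. u x * indicator {0..a n} x) = u x * indicator {0..} x" for x
    proof (rule antisym)
      show "(SUP n. u x * indicator {0..a n} x) \<le> u x * indicator {0..} x"
        by (rule SUP_least) (auto simp: indicator_def)
      obtain n where "x \<le> a n" using a(2) by blast
      then have eq: "u x * indicator {0..} x = u x * indicator {0..a n} x" by (simp add: indicator_def)
      show "u x * indicator {0..} x \<le> (SUP n. u x * indicator {0..a n} x)"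
        unfolding eq by (rule SUP_upper) simp
    qed
    then have "(SUP n. \<integral>\<^sup>+x. u x * indicator {0..a n} x \<partial>lborel) = (\<integral>\<^sup>+x. u x * indicator {0..} x \<partial>lborel)"
      by (subst nn_integral_monotone_convergence_SUP[OF inc, symmetric]) auto
    also have "\<dots> = (\<integral>\<^sup>+x. u x * indicator {0<..} x \<partial>lborel)"
      by (rule nn_integral_cong_AE) (use AE_lborel_singleton[of "0::real"] in \<open>auto elim!: eventually_mono simp: indicator_def\<close>)
    finally show ?thesis ..
  qed
  have sub: "(\<integral>\<^sup>+t. h t * indicator {0..(real (Suc n))\<^sup>2} t \<partial>lborel)
      = (\<integral>\<^sup>+x. h (x\<^sup>2) * ennreal (2 * x) * indicator {0..real (Suc n)} x \<partial>lborel)" for n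
  proof -
    have "(\<integral>\<^sup>+t. h t * indicator {0\<^sup>2..(real (Suc n))\<^sup>2} t \<partial>lborel)
        = (\<integral>\<^sup>+x. h (x\<^sup>2) * ennreal (2 * x) * indicator {0..real (Suc n)} x \<partial>lborel)"
      by (rule nn_integral_substitution_aux) (auto intro!: derivative_eq_intros continuous_intros)
    then show ?thesis by simp
  qed
  have "(\<integral>\<^sup>+t. h t * indicator {0<..} t \<partial>lborel) = (SUP n. \<integral>\<^sup>+t. h t * indicator {0..(real (Suc n))\<^sup>2} t \<partial>lborel)"
  proof (rule mono)
    show "(real (Suc n))\<^sup>2 \<le> (real (Suc (Suc n)))\<^sup>2" for n by (intro power_mono) auto
    show "\<exists>n. x \<le> (real (Suc n))\<^sup>2" for x
    proof -
      obtain n where "x \<le> real n" using real_arch_simple by blast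
      also have "real n \<le> (real (Suc n))\<^sup>2" by (simp add: power2_eq_square algebra_simps)
      finally show ?thesis by blast
    qed
  qed simp
  also have "\<dots> = (SUP n. \<integral>\<^sup>+x. h (x\<^sup>2) * ennreal (2 * x) * indicator {0..real (Suc n)} x \<partial>lborel)"
    by (simp only: sub)
  also have "\<dots> = (\<integral>\<^sup>+x. h (x\<^sup>2) * ennreal (2 * x) * indicator {0<..} x \<partial>lborel)"
  proof (rule mono[symmetric])
    show "\<exists>n. x \<le> real (Suc n)" for x :: real
      using real_arch_simple[of x] by (metis le_Suc_eq of_nat_mono order_trans order_refl)
  qed auto
  finally show ?thesis ..
qed

definition below_paraboloid :: "(real \<times> real) set" where
  "below_paraboloid = {p. snd p < - (fst p)\<^sup>2}"

definition upper_half :: "(real \<times> real) set" where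
  "upper_half = {\<zeta>. 0 < snd \<zeta>}"

lemma regions_measurable [measurable]:
  "below_paraboloid \<in> sets borel" "upper_half \<in> sets borel"
  unfolding below_paraboloid_def upper_half_def by measurable

lemma nn_integral_lborel_pair:
  fixes u :: "real \<times> real \<Rightarrow> ennreal"
  assumes [measurable]: "u \<in> borel_measurable borel"
  shows "(\<integral>\<^sup>+p. u p \<partial>lborel) = (\<integral>\<^sup>+x. (\<integral>\<^sup>+y. u (x, y) \<partial>lborel) \<partial>lborel)"
  unfolding lborel_prod[symmetric] by (rule lborel.nn_integral_fst[symmetric]) (simp add: lborel_prod)

text \<open>For fixed \<open>\<xi>\<close> this is the substitution \<open>\<sigma> = - \<xi>\<^sup>2 - \<eta>\<^sup>2\<close> on \<open>\<eta> > 0\<close>.\<close>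

lemma nn_integral_paraboloid:
  fixes f :: "real \<times> real \<Rightarrow> ennreal"
  assumes [measurable]: "f \<in> borel_measurable borel"
  shows "(\<integral>\<^sup>+\<zeta>. f (paraboloid \<zeta>) * ennreal (2 * snd \<zeta>) * indicator upper_half \<zeta> \<partial>lborel)
    = (\<integral>\<^sup>+p. f p * indicator below_paraboloid p \<partial>lborel)"
proof -
  have "(\<integral>\<^sup>+\<zeta>. f (paraboloid \<zeta>) * ennreal (2 * snd \<zeta>) * indicator upper_half \<zeta> \<partial>lborel)
      = (\<integral>\<^sup>+\<xi>. (\<integral>\<^sup>+\<eta>. f (\<xi>, - \<xi>\<^sup>2 - \<eta>\<^sup>2) * ennreal (2 * \<eta>) * indicator {0<..} \<eta> \<partial>lborel) \<partial>lborel)"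
    by (subst nn_integral_lborel_pair) (auto intro!: nn_integral_cong simp: paraboloid_def norm_sq_Pair upper_half_def indicator_def algebra_simps)
  also have "\<dots> = (\<integral>\<^sup>+\<xi>. (\<integral>\<^sup>+\<tau>. f (\<xi>, - \<xi>\<^sup>2 - \<tau>) * indicator {0<..} \<tau> \<partial>lborel) \<partial>lborel)"
    by (intro nn_integral_cong nn_integral_square_substitution) measurable
  also have "\<dots> = (\<integral>\<^sup>+\<xi>. (\<integral>\<^sup>+\<sigma>. f (\<xi>, \<sigma>) * indicator below_paraboloid (\<xi>, \<sigma>) \<partial>lborel) \<partial>lborel)"
  proof (rule nn_integral_cong)
    fix \<xi> :: real
    show "(\<integral>\<^sup>+\<tau>. f (\<xi>, - \<xi>\<^sup>2 - \<tau>) * indicator {0<..} \<tau> \<partial>lborel) = (\<integral>\<^sup>+\<sigma>. f (\<xi>, \<sigma>) * indicator below_paraboloid (\<xi>, \<sigma>) \<partial>lborel)"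
      by (subst nn_integral_real_affine[of "\<lambda>\<sigma>. f (\<xi>, \<sigma>) * indicator below_paraboloid (\<xi>, \<sigma>)" "-1" "- \<xi>\<^sup>2"])
        (auto intro!: nn_integral_cong simp: below_paraboloid_def indicator_def)
  qed
  also have "\<dots> = (\<integral>\<^sup>+p. f p * indicator below_paraboloid p \<partial>lborel)"
    by (rule nn_integral_lborel_pair[symmetric]) measurable
  finally show ?thesis .
qed

lemma paraboloid_in_below: "\<zeta> \<in> upper_half \<Longrightarrow> paraboloid \<zeta> \<in> below_paraboloid"
  by (auto simp: paraboloid_def below_paraboloid_def upper_half_def norm_sq_Pair)

lemma paraboloid_distr:
  "distr (density lborel (\<lambda>\<zeta>. ennreal (indicator upper_half \<zeta> * (2 * snd \<zeta>)))) borel paraboloid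
    = density lborel (\<lambda>p. ennreal (indicator below_paraboloid p))" (is "?M = ?N")
proof (rule measure_eqI)
  fix A assume "A \<in> sets ?M"
  then have [measurable]: "A \<in> sets borel" by simp
  have "emeasure ?M A = (\<integral>\<^sup>+\<zeta>. ennreal (indicator upper_half \<zeta> * (2 * snd \<zeta>)) * indicator (paraboloid -` A) \<zeta> \<partial>lborel)"
    by (simp add: emeasure_distr emeasure_density measurable_sets_borel[OF paraboloid_measurable])
  also have "\<dots> = (\<integral>\<^sup>+\<zeta>. indicator A (paraboloid \<zeta>) * ennreal (2 * snd \<zeta>) * indicator upper_half \<zeta> \<partial>lborel)"
    by (intro nn_integral_cong) (auto simp: indicator_def)
  also have "\<dots> = (\<integral>\<^sup>+p. indicator A p * indicator below_paraboloid p \<partial>lborel)"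
    by (rule nn_integral_paraboloid) measurable
  also have "\<dots> = emeasure ?N A"
    by (subst emeasure_density) (auto intro!: nn_integral_cong simp: indicator_def)
  finally show "emeasure ?M A = emeasure ?N A" .
qed simp

lemma
  fixes f :: "real \<times> real \<Rightarrow> complex"
  assumes [measurable]: "f \<in> borel_measurable borel"
  shows integral_paraboloid: "(LINT p|lborel. indicator below_paraboloid p * f p)
      = (LINT \<zeta>|lborel. indicator upper_half \<zeta> * (of_real (2 * snd \<zeta>) * f (paraboloid \<zeta>)))"
    and integrable_paraboloid: "integrable lborel (\<lambda>p. indicator below_paraboloid p * f p)
      \<longleftrightarrow> integrable lborel (\<lambda>\<zeta>. indicator upper_half \<zeta> * (of_real (2 * snd \<zeta>) * f (paraboloid \<zeta>)))"
proof -
  let ?M = "density lborel (\<lambda>\<zeta>. ennreal (indicator upper_half \<zeta> * (2 * snd \<zeta>)))"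
  have pos: "AE \<zeta> in lborel. 0 \<le> indicator upper_half \<zeta> * (2 * snd \<zeta>)"
    by (auto simp: upper_half_def indicator_def)
  have 1: "indicator below_paraboloid p * f p = indicator below_paraboloid p *\<^sub>R f p" for p
    by (simp add: indicator_def)
  have 2: "indicator upper_half \<zeta> * (of_real (2 * snd \<zeta>) * f (paraboloid \<zeta>)) = (indicator upper_half \<zeta> * (2 * snd \<zeta>)) *\<^sub>R f (paraboloid \<zeta>)" for \<zeta>
    by (simp add: indicator_def scaleR_conv_of_real)
  have "(LINT p|lborel. indicator below_paraboloid p *\<^sub>R f p) = (LINT p|distr ?M borel paraboloid. f p)"
    unfolding paraboloid_distr by (subst integral_density) auto
  also have "\<dots> = (LINT \<zeta>|?M. f (paraboloid \<zeta>))" by (rule integral_distr) auto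
  also have "\<dots> = (LINT \<zeta>|lborel. (indicator upper_half \<zeta> * (2 * snd \<zeta>)) *\<^sub>R f (paraboloid \<zeta>))"
    by (rule integral_density) (use pos in auto)
  finally show "(LINT p|lborel. indicator below_paraboloid p * f p)
      = (LINT \<zeta>|lborel. indicator upper_half \<zeta> * (of_real (2 * snd \<zeta>) * f (paraboloid \<zeta>)))"
    unfolding 1 2 .
  have "integrable lborel (\<lambda>p. indicator below_paraboloid p *\<^sub>R f p) \<longleftrightarrow> integrable (distr ?M borel paraboloid) f"
    unfolding paraboloid_distr by (subst integrable_density) auto
  also have "\<dots> \<longleftrightarrow> integrable ?M (\<lambda>\<zeta>. f (paraboloid \<zeta>))" by (rule integrable_distr_eq) auto
  also have "\<dots> \<longleftrightarrow> integrable lborel (\<lambda>\<zeta>. (indicator upper_half \<zeta> * (2 * snd \<zeta>)) *\<^sub>R f (paraboloid \<zeta>))"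
    by (rule integrable_density) (use pos in auto)
  finally show "integrable lborel (\<lambda>p. indicator below_paraboloid p * f p)
      \<longleftrightarrow> integrable lborel (\<lambda>\<zeta>. indicator upper_half \<zeta> * (of_real (2 * snd \<zeta>) * f (paraboloid \<zeta>)))"
    unfolding 1 2 .
qed

subsection \<open>Reflection in the normal variable\<close>

definition flip :: "real \<times> real \<Rightarrow> real \<times> real" where
  "flip \<zeta> = (fst \<zeta>, - snd \<zeta>)"

lemma flip_measurable [measurable]: "flip \<in> borel_measurable borel"
  unfolding flip_def[abs_def] by measurable

lemma flip_simps [simp]: "fst (flip \<zeta>) = fst \<zeta>" "snd (flip \<zeta>) = - snd \<zeta>" "norm (flip \<zeta>) = norm \<zeta>" "paraboloid (flip \<zeta>) = paraboloid \<zeta>"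
  by (auto simp: flip_def paraboloid_def norm_prod_def)

lemma distr_flip: "distr lborel borel flip = lborel"
proof -
  have "(lborel :: (real \<times> real) measure) = density (distr lborel borel (\<lambda>x. 0 + (\<Sum>j\<in>Basis. ((if j = (0, 1) then - 1 else 1) * (x \<bullet> j)) *\<^sub>R j)))
      (\<lambda>_. (\<Prod>j\<in>(Basis :: (real \<times> real) set). \<bar>if j = (0, 1) then - 1 else 1 :: real\<bar>))"
    by (rule lborel_affine_euclidean) auto
  also have "(\<lambda>x. 0 + (\<Sum>j\<in>Basis. ((if j = (0, 1) then - 1 else 1) * (x \<bullet> j)) *\<^sub>R j)) = flip"
    by (auto simp: flip_def Basis_prod_def sum.union_disjoint inner_prod_def)
  also have "(\<Prod>j\<in>(Basis :: (real \<times> real) set). \<bar>if j = (0, 1) then - 1 else 1 :: real\<bar>) = 1"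
    by (intro prod.neutral) auto
  finally show ?thesis by (simp add: density_1 ennreal_1)
qed

lemma nn_integral_flip: "f \<in> borel_measurable borel \<Longrightarrow> (\<integral>\<^sup>+\<zeta>. f (flip \<zeta>) \<partial>lborel) = (\<integral>\<^sup>+\<zeta>. f \<zeta> \<partial>lborel)"
  using nn_integral_distr[of flip lborel borel f] by (simp add: distr_flip)

lemma integral_flip: "f \<in> borel_measurable borel \<Longrightarrow> (LINT \<zeta>|lborel. f (flip \<zeta>)) = (LINT \<zeta>|lborel. f \<zeta>)"
  for f :: "real \<times> real \<Rightarrow> complex"
  using integral_distr[of flip lborel borel f] by (simp add: distr_flip)

lemma integrable_flip: "f \<in> borel_measurable borel \<Longrightarrow> integrable lborel (\<lambda>\<zeta>. f (flip \<zeta>)) \<longleftrightarrow> integrable lborel f"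
  for f :: "real \<times> real \<Rightarrow> complex"
  using integrable_distr_eq[of flip lborel borel f] by (simp add: distr_flip)

lemma AE_normal_nonzero: "AE \<zeta> in lborel. snd (\<zeta> :: real \<times> real) \<noteq> 0"
proof -
  have "AE x in lborel. AE y in lborel. snd (x, y :: real) \<noteq> 0" for x :: real
    using AE_lborel_singleton[of "0::real"] by simp
  then have "AE \<zeta> in lborel \<Otimes>\<^sub>M lborel. snd (\<zeta> :: real \<times> real) \<noteq> 0"
  proof (intro lborel_pair.AE_pair_measure)
    show "{\<zeta> \<in> space (lborel \<Otimes>\<^sub>M lborel). snd (\<zeta> :: real \<times> real) \<noteq> 0} \<in> sets (lborel \<Otimes>\<^sub>M lborel)"
      by (simp only: lborel_prod) measurable
  qed auto
  then show ?thesis unfolding lborel_prod .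
qed

section \<open>The transform of the trace\<close>

text \<open>The push-forward of \<open>\<Phi> d\<xi> d\<eta>\<close> under the paraboloid map has this density: the two preimages
  \<open>(\<xi>, \<plusminus> \<eta>)\<close> of a point \<open>(\<xi>, - \<xi>\<^sup>2 - \<eta>\<^sup>2)\<close> contribute with the Jacobian \<open>1 / (2 \<eta>)\<close>.\<close>

definition trace_density :: "(real \<times> real \<Rightarrow> complex) \<Rightarrow> real \<times> real \<Rightarrow> complex" where
  "trace_density \<Phi> p = (let \<zeta> = (fst p, sqrt (- snd p - (fst p)\<^sup>2)) in
     indicator below_paraboloid p * ((\<Phi> \<zeta> + \<Phi> (flip \<zeta>)) / of_real (2 * snd \<zeta>)))"

lemma trace_density_measurable [measurable]:
  assumes [measurable]: "\<Phi> \<in> borel_measurable borel"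
  shows "trace_density \<Phi> \<in> borel_measurable borel"
  unfolding trace_density_def[abs_def] Let_def by measurable

lemma trace_density_paraboloid:
  assumes "\<zeta> \<in> upper_half"
  shows "trace_density \<Phi> (paraboloid \<zeta>) = (\<Phi> \<zeta> + \<Phi> (flip \<zeta>)) / of_real (2 * snd \<zeta>)"
proof -
  have "(fst (paraboloid \<zeta>), sqrt (- snd (paraboloid \<zeta>) - (fst (paraboloid \<zeta>))\<^sup>2)) = \<zeta>"
    using assms by (simp add: paraboloid_def norm_sq_Pair upper_half_def prod_eq_iff)
  then show ?thesis
    using paraboloid_in_below[OF assms] by (simp add: trace_density_def)
qed

lemma trace_density_outside: "p \<notin> below_paraboloid \<Longrightarrow> trace_density \<Phi> p = 0"
  by (simp add: trace_density_def)

text \<open>The Jacobian removes the denominator, and the reflected summand is the integral over \<open>\<eta> < 0\<close>.\<close>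

lemma
  assumes [measurable]: "\<Phi> \<in> borel_measurable borel" "u \<in> borel_measurable borel"
    and int: "integrable lborel (\<lambda>\<zeta>. \<Phi> \<zeta> * u (paraboloid \<zeta>))"
  shows trace_density_integrable: "integrable lborel (\<lambda>p. trace_density \<Phi> p * u p)"
    and trace_density_pairing: "(LINT p|lborel. trace_density \<Phi> p * u p) = (LINT \<zeta>|lborel. \<Phi> \<zeta> * u (paraboloid \<zeta>))"
proof -
  let ?v = "\<lambda>\<zeta>. \<Phi> \<zeta> * u (paraboloid \<zeta>)"
  let ?a = "\<lambda>\<zeta>. indicator upper_half \<zeta> * ?v \<zeta>" and ?b = "\<lambda>\<zeta>. indicator upper_half (flip \<zeta>) * ?v \<zeta>"
  have ind: "integrable lborel (\<lambda>\<zeta>. indicator A \<zeta> * ?v \<zeta>)" if [measurable]: "A \<in> sets borel" for A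
    by (rule Bochner_Integration.integrable_bound[OF int]) (auto simp: norm_mult indicator_def)
  have a: "integrable lborel ?a" by (rule ind) measurable
  have b: "integrable lborel ?b"
    by (rule Bochner_Integration.integrable_bound[OF int]) (auto simp: norm_mult indicator_def)
  have b': "integrable lborel (\<lambda>\<zeta>. ?b (flip \<zeta>))" using b by (subst integrable_flip) auto
  have eq: "indicator upper_half \<zeta> * (of_real (2 * snd \<zeta>) * (trace_density \<Phi> (paraboloid \<zeta>) * u (paraboloid \<zeta>))) = ?a \<zeta> + ?b (flip \<zeta>)" for \<zeta>
  proof (cases "\<zeta> \<in> upper_half")
    case True
    then have "snd \<zeta> \<noteq> 0" by (simp add: upper_half_def)
    moreover have "flip (flip \<zeta>) = \<zeta>" by (simp add: flip_def)
    ultimately show ?thesis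
      using True by (simp add: trace_density_paraboloid field_simps)
  next
    case False
    moreover have "flip (flip \<zeta>) = \<zeta>" by (simp add: flip_def)
    ultimately show ?thesis by simp
  qed
  have out: "trace_density \<Phi> p * u p = indicator below_paraboloid p * (trace_density \<Phi> p * u p)" for p
    by (cases "p \<in> below_paraboloid") (auto simp: trace_density_outside)
  show "integrable lborel (\<lambda>p. trace_density \<Phi> p * u p)"
    by (subst out, subst integrable_paraboloid) (use a b' in \<open>auto simp: eq simp del: of_real_mult\<close>)
  have "(LINT p|lborel. trace_density \<Phi> p * u p) = (LINT \<zeta>|lborel. ?a \<zeta> + ?b (flip \<zeta>))"
    by (subst out, subst integral_paraboloid) (auto simp: eq simp del: of_real_mult)
  also have "\<dots> = (LINT \<zeta>|lborel. ?a \<zeta>) + (LINT \<zeta>|lborel. ?b (flip \<zeta>))" by (rule Bochner_Integration.integral_add[OF a b'])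
  also have "(LINT \<zeta>|lborel. ?b (flip \<zeta>)) = (LINT \<zeta>|lborel. ?b \<zeta>)" by (rule integral_flip) measurable
  also have "(LINT \<zeta>|lborel. ?a \<zeta>) + (LINT \<zeta>|lborel. ?b \<zeta>) = (LINT \<zeta>|lborel. ?a \<zeta> + ?b \<zeta>)"
    using a b by simp
  also have "\<dots> = (LINT \<zeta>|lborel. ?v \<zeta>)"
    by (rule integral_cong_AE) (use AE_normal_nonzero in \<open>auto elim!: eventually_mono simp: upper_half_def indicator_def not_less\<close>)
  finally show "(LINT p|lborel. trace_density \<Phi> p * u p) = (LINT \<zeta>|lborel. ?v \<zeta>)" .
qed

text \<open>The weighted estimate. With \<open>E = \<Phi>(\<xi>,\<eta>) + \<Phi>(\<xi>,-\<eta>)\<close> the integrand is \<open>m |E|\<^sup>2 / (4 \<eta>\<^sup>2) \<cdot> 2 \<eta>\<close>, and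
  \<open>|E|\<^sup>2\<close> is at most twice the sum of the squares; what is left is the factor \<open>1 / |\<eta>|\<close>, which
  the weight \<open>|\<sigma> + \<xi>\<^sup>2|\<^sup>1\<^sup>/\<^sup>2 = |\<eta>|\<close> of the boundary norm compensates.\<close>

lemma trace_density_square:
  assumes [measurable]: "\<Phi> \<in> borel_measurable borel" "m \<in> borel_measurable borel" and m: "\<And>p. 0 \<le> m p"
  shows "(\<integral>\<^sup>+p. ennreal (m p * (norm (trace_density \<Phi> p))\<^sup>2) \<partial>lborel)
    \<le> (\<integral>\<^sup>+\<zeta>. ennreal (m (paraboloid \<zeta>) / \<bar>snd \<zeta>\<bar> * (norm (\<Phi> \<zeta>))\<^sup>2) \<partial>lborel)"
proof -
  let ?v = "\<lambda>\<zeta>. ennreal (m (paraboloid \<zeta>) / \<bar>snd \<zeta>\<bar> * (norm (\<Phi> \<zeta>))\<^sup>2)"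
  have "(\<integral>\<^sup>+p. ennreal (m p * (norm (trace_density \<Phi> p))\<^sup>2) \<partial>lborel)
      = (\<integral>\<^sup>+p. ennreal (m p * (norm (trace_density \<Phi> p))\<^sup>2) * indicator below_paraboloid p \<partial>lborel)"
    by (intro nn_integral_cong) (auto simp: indicator_def trace_density_outside)
  also have "\<dots> = (\<integral>\<^sup>+\<zeta>. ennreal (m (paraboloid \<zeta>) * (norm (trace_density \<Phi> (paraboloid \<zeta>)))\<^sup>2) * ennreal (2 * snd \<zeta>) * indicator upper_half \<zeta> \<partial>lborel)"
    by (rule nn_integral_paraboloid[symmetric]) measurable
  also have "\<dots> \<le> (\<integral>\<^sup>+\<zeta>. ?v \<zeta> * indicator upper_half \<zeta> + ?v (flip \<zeta>) * indicator upper_half \<zeta> \<partial>lborel)"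
  proof (rule nn_integral_mono)
    fix \<zeta> :: "real \<times> real"
    show "ennreal (m (paraboloid \<zeta>) * (norm (trace_density \<Phi> (paraboloid \<zeta>)))\<^sup>2) * ennreal (2 * snd \<zeta>) * indicator upper_half \<zeta>
        \<le> ?v \<zeta> * indicator upper_half \<zeta> + ?v (flip \<zeta>) * indicator upper_half \<zeta>"
    proof (cases "\<zeta> \<in> upper_half")
      case True
      then have \<eta>: "0 < snd \<zeta>" by (simp add: upper_half_def)
      let ?E = "\<Phi> \<zeta> + \<Phi> (flip \<zeta>)" and ?m = "m (paraboloid \<zeta>)"
      have "(norm ?E)\<^sup>2 \<le> (norm (\<Phi> \<zeta>) + norm (\<Phi> (flip \<zeta>)))\<^sup>2"
        by (intro power_mono norm_triangle_ineq) auto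
      also have "\<dots> \<le> 2 * ((norm (\<Phi> \<zeta>))\<^sup>2 + (norm (\<Phi> (flip \<zeta>)))\<^sup>2)"
        using sum_squares_bound[of "norm (\<Phi> \<zeta>)" "norm (\<Phi> (flip \<zeta>))"] by (simp add: power2_sum)
      finally have E: "(norm ?E)\<^sup>2 \<le> 2 * ((norm (\<Phi> \<zeta>))\<^sup>2 + (norm (\<Phi> (flip \<zeta>)))\<^sup>2)" .
      have "?m * (norm (trace_density \<Phi> (paraboloid \<zeta>)))\<^sup>2 * (2 * snd \<zeta>) = ?m / (2 * snd \<zeta>) * (norm ?E)\<^sup>2"
        unfolding trace_density_paraboloid[OF True] norm_divide norm_of_real
        using \<eta> by (simp add: power_divide power2_eq_square field_simps)
      also have "\<dots> \<le> ?m / (2 * snd \<zeta>) * (2 * ((norm (\<Phi> \<zeta>))\<^sup>2 + (norm (\<Phi> (flip \<zeta>)))\<^sup>2))"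
        using m \<eta> E by (intro mult_left_mono) auto
      also have "\<dots> = ?m / \<bar>snd \<zeta>\<bar> * (norm (\<Phi> \<zeta>))\<^sup>2 + ?m / \<bar>snd \<zeta>\<bar> * (norm (\<Phi> (flip \<zeta>)))\<^sup>2"
        using \<eta> by (simp add: field_simps)
      finally have "ennreal (?m * (norm (trace_density \<Phi> (paraboloid \<zeta>)))\<^sup>2 * (2 * snd \<zeta>))
          \<le> ennreal (?m / \<bar>snd \<zeta>\<bar> * (norm (\<Phi> \<zeta>))\<^sup>2 + ?m / \<bar>snd \<zeta>\<bar> * (norm (\<Phi> (flip \<zeta>)))\<^sup>2)"
        by (rule ennreal_leI)
      also have "\<dots> = ?v \<zeta> + ?v (flip \<zeta>)"
        using m by (simp add: ennreal_plus)
      finally show ?thesis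
        using True m \<eta> by (simp add: ennreal_mult)
    qed simp
  qed
  also have "\<dots> = (\<integral>\<^sup>+\<zeta>. ?v \<zeta> * indicator upper_half \<zeta> \<partial>lborel) + (\<integral>\<^sup>+\<zeta>. ?v (flip \<zeta>) * indicator upper_half (flip (flip \<zeta>)) \<partial>lborel)"
    by (subst nn_integral_add) (auto simp: flip_def)
  also have "(\<integral>\<^sup>+\<zeta>. ?v (flip \<zeta>) * indicator upper_half (flip (flip \<zeta>)) \<partial>lborel) = (\<integral>\<^sup>+\<zeta>. ?v \<zeta> * indicator upper_half (flip \<zeta>) \<partial>lborel)"
    by (rule nn_integral_flip[where f = "\<lambda>\<zeta>. ?v \<zeta> * indicator upper_half (flip \<zeta>)"]) measurable
  also have "(\<integral>\<^sup>+\<zeta>. ?v \<zeta> * indicator upper_half \<zeta> \<partial>lborel) + \<dots> = (\<integral>\<^sup>+\<zeta>. ?v \<zeta> * indicator upper_half \<zeta> + ?v \<zeta> * indicator upper_half (flip \<zeta>) \<partial>lborel)"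
    by (rule nn_integral_add[symmetric]) measurable
  also have "\<dots> \<le> (\<integral>\<^sup>+\<zeta>. ?v \<zeta> \<partial>lborel)"
    by (intro nn_integral_mono) (auto simp: upper_half_def indicator_def)
  finally show ?thesis .
qed

lemma paraboloid_pairing_integrable:
  "\<Phi> \<in> L2 \<Longrightarrow> \<psi> \<in> schwartz \<Longrightarrow> integrable lborel (\<lambda>\<zeta>. \<Phi> \<zeta> * \<psi> (paraboloid \<zeta>))"
  by (rule L2_Cauchy_Schwarz(1)[OF _ paraboloid_L2(1)])

text \<open>The singularity at the paraboloid is integrable: in the variables \<open>(\<xi>,\<eta>)\<close> it is cancelled by the
  Jacobian, and there both \<open>\<Phi>\<close> and the weight \<open>(1 + |paraboloid|)\<^sup>-\<^sup>2\<close> are square integrable.\<close>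

lemma trace_density_tempered:
  assumes \<Phi>: "\<Phi> \<in> L2" shows "tempered_fun (trace_density \<Phi>)"
proof -
  note [measurable] = L2_measurable[OF \<Phi>]
  let ?A = "\<lambda>\<zeta>. complex_of_real (norm (\<Phi> \<zeta>))" and ?w = "\<lambda>p::real \<times> real. complex_of_real (1 / (1 + norm p) ^ 2)"
  have A: "?A \<in> L2" by (rule L2_norm_mono(1)[OF \<Phi>, of _ 1]) auto
  have "integrable lborel (\<lambda>\<zeta>. ?A \<zeta> * ?w (paraboloid \<zeta>))"
  proof (rule L2_Cauchy_Schwarz(1)[OF A])
    show "(\<lambda>\<zeta>. ?w (paraboloid \<zeta>)) \<in> L2"
    proof (rule L2_norm_mono(1)[OF L2_weight[where 'a = "real \<times> real" and N = 2], where c = 4])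
      have "norm (?w (paraboloid \<zeta>)) \<le> 4 * norm (?w \<zeta>)" for \<zeta>
      proof -
        have "1 + norm \<zeta> \<le> 2 * (1 + norm (paraboloid \<zeta>))" by (rule one_plus_norm_le_paraboloid)
        then have "(1 + norm \<zeta>)\<^sup>2 \<le> 2\<^sup>2 * (1 + norm (paraboloid \<zeta>))\<^sup>2"
          unfolding power_mult_distrib[symmetric] by (intro power_mono) auto
        moreover have "0 < (1 + norm \<zeta>)\<^sup>2" "0 < (1 + norm (paraboloid \<zeta>))\<^sup>2"
          by (rule one_plus_norm_power_pos)+
        ultimately have "1 / (1 + norm (paraboloid \<zeta>))\<^sup>2 \<le> 4 * (1 / (1 + norm \<zeta>)\<^sup>2)"
          by (simp add: field_simps)
        then show ?thesis unfolding norm_of_real by simp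
      qed
      then show "AE \<zeta> in lborel. norm (?w (paraboloid \<zeta>)) \<le> 4 * norm (?w \<zeta>)" by simp
    qed auto
  qed
  then have int: "integrable lborel (\<lambda>p. trace_density ?A p * ?w p)"
    by (intro trace_density_integrable) measurable
  have "integrable lborel (\<lambda>p. norm (trace_density \<Phi> p) / (1 + norm p) ^ 2)"
  proof (rule Bochner_Integration.integrable_bound[OF int])
    have "norm (trace_density \<Phi> p) \<le> norm (trace_density ?A p)" for p
    proof -
      have "norm (\<Phi> \<zeta> + \<Phi> (flip \<zeta>)) \<le> norm (?A \<zeta> + ?A (flip \<zeta>))" for \<zeta>
        unfolding of_real_add[symmetric] norm_of_real using norm_triangle_ineq[of "\<Phi> \<zeta>" "\<Phi> (flip \<zeta>)"] by simp
      then show ?thesis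
        unfolding trace_density_def Let_def norm_mult norm_divide by (intro mult_left_mono divide_right_mono) auto
    qed
    then show "AE p in lborel. norm (norm (trace_density \<Phi> p) / (1 + norm p) ^ 2) \<le> norm (trace_density ?A p * ?w p)"
      unfolding norm_mult norm_of_real by (intro AE_I2) (simp add: divide_right_mono)
  qed measurable
  then show ?thesis unfolding tempered_fun_def by auto
qed

text \<open>The pairing that characterises the trace is applied to \<open>\<psi>^\<close>; inversion turns the transform of \<open>\<psi>^\<close> at
  \<open>- paraboloid \<zeta>\<close> back into \<open>\<psi>\<close> on the paraboloid, and the change of variables gives the density.\<close>

lemma has_fourier_trace_density:
  assumes \<Phi>: "\<Phi> \<in> L2" and w: "tempered_fun w"
    and tr: "\<And>\<psi>. \<psi> \<in> schwartz \<Longrightarrow> (LINT z|lborel. w z * \<psi> z) = (LINT \<zeta>|lborel. \<Phi> \<zeta> * fourier_integral \<psi> (- paraboloid \<zeta>))"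
  shows "has_fourier w (trace_density \<Phi>)"
  unfolding has_fourier_def
proof (intro conjI ballI w trace_density_tempered \<Phi>)
  fix \<psi> :: "real \<times> real \<Rightarrow> complex" assume \<psi>: "\<psi> \<in> schwartz"
  have "(LINT p|lborel. trace_density \<Phi> p * \<psi> p) = (LINT \<zeta>|lborel. \<Phi> \<zeta> * \<psi> (paraboloid \<zeta>))"
    by (intro trace_density_pairing L2_measurable schwartz_measurable paraboloid_pairing_integrable \<Phi> \<psi>)
  also have "\<dots> = (LINT z|lborel. w z * fourier_integral \<psi> z)"
    by (simp add: tr[OF fourier_integral_schwartz[OF \<psi>]] schwartz_inversion[OF \<psi>])
  finally show "(LINT p|lborel. trace_density \<Phi> p * \<psi> p) = \<dots>" .
qed


text \<open>On the paraboloid \<open>1 + |\<sigma>| + \<xi>\<^sup>2 = 1 + 2 \<xi>\<^sup>2 + \<eta>\<^sup>2 \<le> 2 (1 + |\<zeta>|\<^sup>2)\<close>, whence the constant.\<close>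

lemma boundary_norm_estimate:
  assumes s: "s \<ge> 0" and \<phi>: "\<phi> \<in> sobolev s" and wG: "has_fourier w (trace_density (fourier \<phi>))"
  shows "boundary_weighted s w \<in> L2" "boundary_norm s w \<le> 2 powr (s / 2) * sobolev_norm s \<phi>"
proof -
  have \<phi>2: "\<phi> \<in> L2" and S: "sobolev_weighted s \<phi> \<in> L2" using \<phi> by (auto simp: sobolev_def)
  let ?\<Phi> = "fourier \<phi>"
  let ?G = "trace_density ?\<Phi>"
  note [measurable] = L2_measurable[OF L2_fourier(2)[OF \<phi>2]] tempered_measurable[OF has_fourierD(2)[OF has_fourier_fourier[OF wG]]]
  let ?m = "\<lambda>p. (1 + \<bar>snd p\<bar> + (fst p)\<^sup>2) powr s * \<bar>snd p + (fst p)\<^sup>2\<bar> powr (1 / 2)"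
  have bw: "boundary_weighted s w p = ((1 + \<bar>snd p\<bar> + (fst p)\<^sup>2) powr (s / 2) * \<bar>snd p + (fst p)\<^sup>2\<bar> powr (1 / 4)) *\<^sub>R fourier w p" for p
    by (simp add: boundary_weighted_def case_prod_unfold)
  have bm: "boundary_weighted s w \<in> borel_measurable borel"
    unfolding bw[abs_def] by measurable
  have "AE p in lborel. fourier w p = ?G p" by (rule has_fourier_unique[OF has_fourier_fourier[OF wG] wG])
  then have "AE p in lborel. ennreal ((norm (boundary_weighted s w p))\<^sup>2) = ennreal (?m p * (norm (?G p))\<^sup>2)"
  proof eventually_elim
    case (elim p)
    have "((1 + \<bar>snd p\<bar> + (fst p)\<^sup>2) powr (s / 2))\<^sup>2 = (1 + \<bar>snd p\<bar> + (fst p)\<^sup>2) powr s"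
      "(\<bar>snd p + (fst p)\<^sup>2\<bar> powr (1 / 4))\<^sup>2 = \<bar>snd p + (fst p)\<^sup>2\<bar> powr (1 / 2)"
      by (simp_all add: power2_eq_square powr_add[symmetric])
    then show ?case
      unfolding bw elim norm_scaleR by (simp add: power_mult_distrib)
  qed
  then have "(\<integral>\<^sup>+p. ennreal ((norm (boundary_weighted s w p))\<^sup>2) \<partial>lborel) = (\<integral>\<^sup>+p. ennreal (?m p * (norm (?G p))\<^sup>2) \<partial>lborel)"
    by (rule nn_integral_cong_AE)
  also have "\<dots> \<le> (\<integral>\<^sup>+\<zeta>. ennreal (?m (paraboloid \<zeta>) / \<bar>snd \<zeta>\<bar> * (norm (?\<Phi> \<zeta>))\<^sup>2) \<partial>lborel)"
    by (rule trace_density_square) auto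
  also have "\<dots> \<le> (\<integral>\<^sup>+\<zeta>. ennreal (2 powr s) * ennreal ((norm (sobolev_weighted s \<phi> \<zeta>))\<^sup>2) \<partial>lborel)"
  proof (rule nn_integral_mono)
    fix \<zeta> :: "real \<times> real"
    have sq: "snd (paraboloid \<zeta>) + (fst (paraboloid \<zeta>))\<^sup>2 = - (snd \<zeta>)\<^sup>2"
      by (simp add: paraboloid_def norm_sq_Pair)
    have "\<bar>- (snd \<zeta>)\<^sup>2\<bar> powr (1 / 2) = \<bar>snd \<zeta>\<bar>"
      by (simp add: powr_half_sqrt)
    then have "?m (paraboloid \<zeta>) / \<bar>snd \<zeta>\<bar> \<le> (1 + \<bar>snd (paraboloid \<zeta>)\<bar> + (fst (paraboloid \<zeta>))\<^sup>2) powr s"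
      unfolding sq by simp
    also have "\<dots> \<le> (2 * (1 + (norm \<zeta>)\<^sup>2)) powr s"
      using s by (intro powr_mono2) (auto simp: paraboloid_def norm_sq_Pair)
    also have "\<dots> = 2 powr s * (1 + (norm \<zeta>)\<^sup>2) powr s"
      by (rule powr_mult)
    also have "(1 + (norm \<zeta>)\<^sup>2) powr s = ((1 + (norm \<zeta>)\<^sup>2) powr (s / 2))\<^sup>2"
      by (simp add: power2_eq_square powr_add[symmetric])
    finally have "?m (paraboloid \<zeta>) / \<bar>snd \<zeta>\<bar> * (norm (?\<Phi> \<zeta>))\<^sup>2 \<le> 2 powr s * ((1 + (norm \<zeta>)\<^sup>2) powr (s / 2))\<^sup>2 * (norm (?\<Phi> \<zeta>))\<^sup>2"
      by (rule mult_right_mono) simp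
    also have "\<dots> = 2 powr s * (norm (sobolev_weighted s \<phi> \<zeta>))\<^sup>2"
      by (simp add: sobolev_weighted_def power_mult_distrib)
    finally show "ennreal (?m (paraboloid \<zeta>) / \<bar>snd \<zeta>\<bar> * (norm (?\<Phi> \<zeta>))\<^sup>2) \<le> ennreal (2 powr s) * ennreal ((norm (sobolev_weighted s \<phi> \<zeta>))\<^sup>2)"
      by (simp add: ennreal_mult[symmetric] ennreal_leI)
  qed
  also have "\<dots> = ennreal (2 powr s) * ennreal ((L2_norm (sobolev_weighted s \<phi>))\<^sup>2)"
    using L2_measurable[OF S] by (subst nn_integral_cmult) (auto simp: L2_nn_integral[OF S])
  also have "\<dots> = ennreal ((2 powr (s / 2) * sobolev_norm s \<phi>)\<^sup>2)"
    by (simp add: ennreal_mult[symmetric] sobolev_norm_def power_mult_distrib power2_eq_square powr_add[symmetric] mult.assoc[symmetric])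
  finally show "boundary_weighted s w \<in> L2" "boundary_norm s w \<le> 2 powr (s / 2) * sobolev_norm s \<phi>"
    using L2_bound_nn[OF bm, of "2 powr (s / 2) * sobolev_norm s \<phi>"] by (auto simp: boundary_norm_def sobolev_norm_def)
qed

section \<open>Existence of the trace\<close>

text \<open>Normal frequencies \<open>|\<eta>| \<ge> 1\<close>: there \<open>1 / |\<eta>|\<close> is bounded, so the density is square integrable
  and has an inverse transform in \<open>L\<^sup>2\<close>.\<close>

lemma trace_exists_high:
  assumes \<Phi>: "\<Phi> \<in> L2" and hi: "\<And>\<zeta>. \<bar>snd \<zeta>\<bar> < 1 \<Longrightarrow> \<Phi> \<zeta> = 0"
  obtains w where "tempered_fun w"
    "\<And>\<psi>. \<psi> \<in> schwartz \<Longrightarrow> (LINT z|lborel. w z * fourier_integral \<psi> z) = (LINT \<zeta>|lborel. \<Phi> \<zeta> * \<psi> (paraboloid \<zeta>))"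
proof -
  note [measurable] = L2_measurable[OF \<Phi>]
  have "(\<integral>\<^sup>+p. ennreal ((norm (trace_density \<Phi> p))\<^sup>2) \<partial>lborel) \<le> (\<integral>\<^sup>+\<zeta>. ennreal (1 / \<bar>snd \<zeta>\<bar> * (norm (\<Phi> \<zeta>))\<^sup>2) \<partial>lborel)"
    using trace_density_square[of \<Phi> "\<lambda>_. 1"] by simp
  also have "\<dots> \<le> (\<integral>\<^sup>+\<zeta>. ennreal ((norm (\<Phi> \<zeta>))\<^sup>2) \<partial>lborel)"
  proof (intro nn_integral_mono ennreal_leI)
    fix \<zeta> :: "real \<times> real"
    show "1 / \<bar>snd \<zeta>\<bar> * (norm (\<Phi> \<zeta>))\<^sup>2 \<le> (norm (\<Phi> \<zeta>))\<^sup>2"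
    proof (cases "\<bar>snd \<zeta>\<bar> < 1")
      case False
      then have "1 / \<bar>snd \<zeta>\<bar> \<le> 1" by simp
      from mult_right_mono[OF this zero_le_power2] show ?thesis by simp
    qed (simp add: hi)
  qed
  also have "\<dots> = ennreal ((L2_norm \<Phi>)\<^sup>2)" by (rule L2_nn_integral[OF \<Phi>])
  finally have "trace_density \<Phi> \<in> L2" by (intro L2_bound_nn(1)[of _ "L2_norm \<Phi>"]) auto
  then obtain w where w: "w \<in> L2" "has_fourier w (trace_density \<Phi>)" using L2_has_inverse_fourier by blast
  show ?thesis
  proof (rule that[OF L2_imp_tempered[OF w(1)]])
    fix \<psi> :: "real \<times> real \<Rightarrow> complex" assume \<psi>: "\<psi> \<in> schwartz"
    have "(LINT p|lborel. trace_density \<Phi> p * \<psi> p) = (LINT \<zeta>|lborel. \<Phi> \<zeta> * \<psi> (paraboloid \<zeta>))"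
      by (intro trace_density_pairing L2_measurable schwartz_measurable paraboloid_pairing_integrable \<Phi> \<psi>)
    then show "(LINT z|lborel. w z * fourier_integral \<psi> z) = (LINT \<zeta>|lborel. \<Phi> \<zeta> * \<psi> (paraboloid \<zeta>))"
      using has_fourierD(3)[OF w(2) \<psi>] by simp
  qed
qed

definition halfline_exp :: "real \<Rightarrow> real" where
  "halfline_exp r = indicator {0..} r * exp (- r)"

lemma halfline_exp_measurable [measurable]: "halfline_exp \<in> borel_measurable borel"
  unfolding halfline_exp_def[abs_def] by measurable

lemma halfline_exp_bounds: "0 \<le> halfline_exp r" "halfline_exp r \<le> 1"
  by (auto simp: halfline_exp_def indicator_def)

lemma nn_integral_halfline_exp: "(\<integral>\<^sup>+r. ennreal (halfline_exp (r + c)) \<partial>lborel) = 1"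
proof -
  have "(\<integral>\<^sup>+r. ennreal (halfline_exp (r + c)) \<partial>lborel) = (\<integral>\<^sup>+r. ennreal (halfline_exp r) \<partial>lborel)"
    using nn_integral_real_affine[of "\<lambda>r. ennreal (halfline_exp r)" 1 c] by (simp add: add.commute)
  also have "\<dots> = (\<integral>\<^sup>+r. ennreal (r ^ 0 * exp (- r)) * indicator {0..} r \<partial>lborel)"
    by (intro nn_integral_cong) (auto simp: halfline_exp_def indicator_def)
  also have "\<dots> = 1" by (subst nn_intergal_power_times_exp_Ici) auto
  finally show ?thesis .
qed

text \<open>\<open>halfline_exp\<close> is the fundamental solution of \<open>1 + d/dr\<close>, tested here against \<open>\<psi> - \<partial>\<^sub>\<sigma> \<psi>\<close>.\<close>

lemma halfline_exp_fundamental: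
  fixes \<psi> :: "real \<times> real \<Rightarrow> complex"
  assumes \<psi>: "\<psi> \<in> schwartz"
  shows "(LINT \<sigma>|lborel. of_real (halfline_exp (\<sigma> + c)) * (\<psi> (\<xi>, \<sigma>) - pd (0, 1) \<psi> (\<xi>, \<sigma>))) = \<psi> (\<xi>, - c)"
    and "integrable lborel (\<lambda>\<sigma>. of_real (halfline_exp (\<sigma> + c)) * (\<psi> (\<xi>, \<sigma>) - pd (0, 1) \<psi> (\<xi>, \<sigma>)))"
proof -
  have b: "(0, 1) \<in> (Basis :: (real \<times> real) set)" unfolding Basis_prod_def by simp
  let ?q = "\<lambda>p. \<psi> p - pd (0, 1) \<psi> p"
  have q: "?q \<in> schwartz" by (intro schwartz_diff \<psi> schwartz_pd b)
  note [measurable] = schwartz_measurable[OF q]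
  obtain C where C: "0 \<le> C" "\<And>p. norm (?q p) \<le> C" using schwartz_bounded[OF q] by blast
  have he: "integrable lborel (\<lambda>\<sigma>. halfline_exp (\<sigma> + c))"
    by (rule integrableI_nonneg) (auto simp: halfline_exp_bounds nn_integral_halfline_exp)
  show int: "integrable lborel (\<lambda>\<sigma>. of_real (halfline_exp (\<sigma> + c)) * ?q (\<xi>, \<sigma>))"
    by (rule Bochner_Integration.integrable_bound[OF integrable_mult_left[OF he, of C]])
      (auto simp: norm_mult halfline_exp_bounds C intro!: AE_I2 mult_left_mono)
  let ?F = "\<lambda>\<sigma>. - (exp (- complex_of_real (\<sigma> + c)) * \<psi> (\<xi>, \<sigma>))"
  let ?f = "\<lambda>\<sigma>. exp (- complex_of_real (\<sigma> + c)) * ?q (\<xi>, \<sigma>)"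
  have cut: "of_real (halfline_exp (\<sigma> + c)) * ?q (\<xi>, \<sigma>) = indicator {- c..} \<sigma> *\<^sub>R ?f \<sigma>" for \<sigma>
    by (auto simp: halfline_exp_def indicator_def exp_of_real[symmetric])
  have "(LBINT \<sigma>=ereal (- c)..\<infinity>. ?f \<sigma>) = 0 - ?F (- c)"
  proof (rule interval_integral_FTC_integrable)
    have sec: "((\<lambda>\<sigma>. \<psi> (\<xi>, \<sigma>)) has_vector_derivative pd (0, 1) \<psi> (\<xi>, \<sigma>)) (at \<sigma>)" for \<sigma>
    proof -
      have d: "((\<lambda>\<sigma>. \<psi> (\<xi>, \<sigma>)) has_derivative (\<lambda>h. pd (0, h) \<psi> (\<xi>, \<sigma>))) (at \<sigma>)"
        by (rule has_derivative_compose[OF _ schwartz_has_derivative[OF \<psi>]]) (auto intro!: derivative_eq_intros)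
      have l: "pd (0, h) \<psi> (\<xi>, \<sigma>) = h *\<^sub>R pd (0, 1) \<psi> (\<xi>, \<sigma>)" for h
        using linear_scale[OF has_derivative_linear[OF schwartz_has_derivative[OF \<psi>, of "(\<xi>, \<sigma>)"]], of h "(0, 1)"] by simp
      show ?thesis
        unfolding has_vector_derivative_def by (rule has_derivative_eq_rhs[OF d]) (rule ext, rule l)
    qed
    have ex: "((\<lambda>\<sigma>. exp (- complex_of_real (\<sigma> + c))) has_vector_derivative - exp (- complex_of_real (\<sigma> + c))) (at \<sigma>)" for \<sigma>
    proof -
      have "((\<lambda>z. exp (- (z + complex_of_real c))) has_field_derivative - exp (- (complex_of_real \<sigma> + complex_of_real c))) (at (complex_of_real \<sigma>))"
        by (auto intro!: derivative_eq_intros)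
      from has_vector_derivative_real_field[OF this] show ?thesis by simp
    qed
    show "(?F has_vector_derivative ?f \<sigma>) (at \<sigma>)" for \<sigma>
      using has_vector_derivative_minus[OF has_vector_derivative_mult[OF ex sec]] by (simp add: algebra_simps)
    show "isCont ?f \<sigma>" for \<sigma>
    proof -
      have q: "isCont (\<lambda>\<sigma>. ?q (\<xi>, \<sigma>)) \<sigma>"
        by (rule isCont_o2[where g = ?q]) (use schwartz_continuous[OF q] in \<open>auto intro!: continuous_intros simp: continuous_on_eq_continuous_at\<close>)
      show ?thesis by (intro continuous_mult[OF _ q] continuous_intros)
    qed
    show "set_integrable lborel (einterval (ereal (- c)) \<infinity>) ?f"
    proof -
      have e: "einterval (ereal (- c)) \<infinity> = {- c<..}" by (auto simp: einterval_def)
      have I: "integrable lborel (\<lambda>\<sigma>. indicator {- c<..} \<sigma> *\<^sub>R (indicator {- c..} \<sigma> *\<^sub>R ?f \<sigma>))"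
        by (rule integrable_mult_indicator) (use int in \<open>simp_all add: cut\<close>)
      have E: "indicator {- c<..} \<sigma> *\<^sub>R (indicator {- c..} \<sigma> *\<^sub>R ?f \<sigma>) = indicator {- c<..} \<sigma> *\<^sub>R ?f \<sigma>" for \<sigma>
        by (auto simp: indicator_def)
      show ?thesis unfolding set_integrable_def e using I unfolding E .
    qed
    have "isCont ?F (- c)"
      using sec[of "- c"] by (intro continuous_intros) (auto dest: has_vector_derivative_continuous)
    then have "(?F \<longlongrightarrow> ?F (- c)) (at_right (- c))"
      unfolding isCont_def by (rule tendsto_within_subset) auto
    then show "((?F \<circ> real_of_ereal) \<longlongrightarrow> ?F (- c)) (at_right (ereal (- c)))"
      by (simp add: ereal_tendsto_simps)
    obtain D where D: "0 \<le> D" "\<And>p. norm (\<psi> p) \<le> D" using schwartz_bounded[OF \<psi>] by blast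
    have "(?F \<longlongrightarrow> 0) at_top"
    proof (rule Lim_null_comparison)
      show "((\<lambda>\<sigma>. exp (- (\<sigma> + c)) * D) \<longlongrightarrow> 0) at_top" by real_asymp
      have "norm (?F \<sigma>) \<le> exp (- (\<sigma> + c)) * D" for \<sigma>
        using D by (simp add: norm_mult norm_exp_eq_Re mult_left_mono)
      then show "eventually (\<lambda>\<sigma>. norm (?F \<sigma>) \<le> exp (- (\<sigma> + c)) * D) at_top" by simp
    qed
    then show "((?F \<circ> real_of_ereal) \<longlongrightarrow> 0) (at_left \<infinity>)"
      by (simp add: ereal_tendsto_simps)
  qed simp
  also have "(LBINT \<sigma>=ereal (- c)..\<infinity>. ?f \<sigma>) = (LINT \<sigma>|lborel. indicator {- c<..} \<sigma> *\<^sub>R ?f \<sigma>)"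
  proof -
    have "einterval (ereal (- c)) \<infinity> = {- c<..}" by (auto simp: einterval_def)
    then show ?thesis by (simp add: interval_lebesgue_integral_def set_lebesgue_integral_def)
  qed
  also have "\<dots> = (LINT \<sigma>|lborel. indicator {- c..} \<sigma> *\<^sub>R ?f \<sigma>)"
    by (rule integral_cong_AE)
      (use AE_lborel_singleton[of "- c"] in \<open>auto elim!: eventually_mono simp: indicator_def\<close>)
  finally show "(LINT \<sigma>|lborel. of_real (halfline_exp (\<sigma> + c)) * ?q (\<xi>, \<sigma>)) = \<psi> (\<xi>, - c)"
    unfolding cut by simp
qed


text \<open>Normal frequencies \<open>|\<eta>| < 1\<close>: the density need not be square integrable near the
  paraboloid, nor the trace in time. Convolving the density in \<open>\<sigma>\<close> with the fundamental
  solution of \<open>1 + \<partial>\<^sub>\<sigma>\<close> makes it square integrable, and this is undone on the physical side by the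
  factor \<open>1 - i t\<close>.\<close>

lemma trace_exists_low:
  assumes \<Phi>: "\<Phi> \<in> L2" and lo: "\<And>\<zeta>. 1 \<le> \<bar>snd \<zeta>\<bar> \<Longrightarrow> \<Phi> \<zeta> = 0"
  obtains w where "tempered_fun w"
    "\<And>\<psi>. \<psi> \<in> schwartz \<Longrightarrow> (LINT z|lborel. w z * fourier_integral \<psi> z) = (LINT \<zeta>|lborel. \<Phi> \<zeta> * \<psi> (paraboloid \<zeta>))"
proof -
  note [measurable] = L2_measurable[OF \<Phi>]
  let ?K = "\<lambda>p \<eta>. halfline_exp (snd p + (fst p)\<^sup>2 + \<eta>\<^sup>2)"
  define H where "H p = (LINT \<eta>|lborel. of_real (?K p \<eta>) * \<Phi> (fst p, \<eta>))" for p :: "real \<times> real"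
  have Hm [measurable]: "H \<in> borel_measurable borel"
    unfolding H_def[abs_def] by (rule lborel.borel_measurable_lebesgue_integral) measurable
  have Hsq: "ennreal ((norm (H p))\<^sup>2) \<le> 2 * (\<integral>\<^sup>+\<eta>. ennreal (?K p \<eta> * (norm (\<Phi> (fst p, \<eta>)))\<^sup>2) \<partial>lborel)" for p
  proof -
    have "ennreal (norm (H p)) \<le> (\<integral>\<^sup>+\<eta>. ennreal (norm (of_real (?K p \<eta>) * \<Phi> (fst p, \<eta>))) \<partial>lborel)"
      unfolding H_def by (rule norm_integral_le_nn_integral)
    also have "\<dots> = (\<integral>\<^sup>+\<eta>. indicator {-1..1::real} \<eta> * ennreal (?K p \<eta> * norm (\<Phi> (fst p, \<eta>))) \<partial>lborel)"
      using lo[of "(fst p, \<eta>)" for \<eta>]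
      by (intro nn_integral_cong) (auto simp: norm_mult halfline_exp_bounds indicator_def abs_le_iff)
    \<comment> \<open>Restricting \<open>\<eta>\<close> to an interval of length \<open>2\<close> provides the second factor for Cauchy-Schwarz.\<close>
    finally have "(ennreal (norm (H p)))\<^sup>2 \<le> (\<integral>\<^sup>+\<eta>. indicator {-1..1::real} \<eta> * ennreal (?K p \<eta> * norm (\<Phi> (fst p, \<eta>))) \<partial>lborel)\<^sup>2"
      by (rule power_mono) simp
    also have "\<dots> \<le> (\<integral>\<^sup>+\<eta>. (indicator {-1..1::real} \<eta>)\<^sup>2 \<partial>lborel) * (\<integral>\<^sup>+\<eta>. (ennreal (?K p \<eta> * norm (\<Phi> (fst p, \<eta>))))\<^sup>2 \<partial>lborel)"
      by (rule Cauchy_Schwarz_nn_integral) measurable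
    also have "(\<integral>\<^sup>+\<eta>. (indicator {-1..1::real} \<eta>)\<^sup>2 \<partial>lborel) = 2"
    proof -
      have "(\<integral>\<^sup>+\<eta>. (indicator {-1..1::real} \<eta>)\<^sup>2 \<partial>lborel) = (\<integral>\<^sup>+\<eta>. indicator {-1..1::real} \<eta> \<partial>lborel)"
        by (intro nn_integral_cong) (auto simp: indicator_def)
      then show ?thesis by simp
    qed
    also have "2 * (\<integral>\<^sup>+\<eta>. (ennreal (?K p \<eta> * norm (\<Phi> (fst p, \<eta>))))\<^sup>2 \<partial>lborel) \<le> 2 * (\<integral>\<^sup>+\<eta>. ennreal (?K p \<eta> * (norm (\<Phi> (fst p, \<eta>)))\<^sup>2) \<partial>lborel)"
    proof (intro mult_left_mono nn_integral_mono)
      fix \<eta> :: real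
      have "(?K p \<eta>)\<^sup>2 \<le> ?K p \<eta>"
        using halfline_exp_bounds[of "snd p + (fst p)\<^sup>2 + \<eta>\<^sup>2"] by (simp add: power2_eq_square mult_left_le_one_le)
      then have "(?K p \<eta> * norm (\<Phi> (fst p, \<eta>)))\<^sup>2 \<le> ?K p \<eta> * (norm (\<Phi> (fst p, \<eta>)))\<^sup>2"
        unfolding power_mult_distrib by (rule mult_right_mono) simp
      then show "(ennreal (?K p \<eta> * norm (\<Phi> (fst p, \<eta>))))\<^sup>2 \<le> ennreal (?K p \<eta> * (norm (\<Phi> (fst p, \<eta>)))\<^sup>2)"
        by (simp add: ennreal_power halfline_exp_bounds ennreal_leI)
    qed simp
    finally show ?thesis by (simp add: ennreal_power)
  qed
  have H: "H \<in> L2"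
  proof (rule L2_bound_nn(1)[OF Hm])
    have "(\<integral>\<^sup>+p. ennreal ((norm (H p))\<^sup>2) \<partial>lborel) \<le> (\<integral>\<^sup>+p. 2 * (\<integral>\<^sup>+\<eta>. ennreal (?K p \<eta> * (norm (\<Phi> (fst p, \<eta>)))\<^sup>2) \<partial>lborel) \<partial>lborel)"
      by (intro nn_integral_mono Hsq)
    also have "\<dots> = 2 * (\<integral>\<^sup>+p. (\<integral>\<^sup>+\<eta>. ennreal (?K p \<eta> * (norm (\<Phi> (fst p, \<eta>)))\<^sup>2) \<partial>lborel) \<partial>lborel)"
      by (rule nn_integral_cmult) measurable
    also have "(\<integral>\<^sup>+p. (\<integral>\<^sup>+\<eta>. ennreal (?K p \<eta> * (norm (\<Phi> (fst p, \<eta>)))\<^sup>2) \<partial>lborel) \<partial>lborel)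
        = (\<integral>\<^sup>+\<xi>. (\<integral>\<^sup>+\<sigma>. (\<integral>\<^sup>+\<eta>. ennreal (?K (\<xi>, \<sigma>) \<eta> * (norm (\<Phi> (\<xi>, \<eta>)))\<^sup>2) \<partial>lborel) \<partial>lborel) \<partial>lborel)"
      by (subst nn_integral_lborel_pair) simp_all
    also have "\<dots> = (\<integral>\<^sup>+\<xi>. (\<integral>\<^sup>+\<eta>. (\<integral>\<^sup>+\<sigma>. ennreal (?K (\<xi>, \<sigma>) \<eta> * (norm (\<Phi> (\<xi>, \<eta>)))\<^sup>2) \<partial>lborel) \<partial>lborel) \<partial>lborel)"
      by (intro nn_integral_cong lborel_pair.Fubini') measurable
    also have "\<dots> = (\<integral>\<^sup>+\<xi>. (\<integral>\<^sup>+\<eta>. ennreal ((norm (\<Phi> (\<xi>, \<eta>)))\<^sup>2) \<partial>lborel) \<partial>lborel)"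
    proof (intro nn_integral_cong)
      fix \<xi> \<eta> :: real
      have "(\<integral>\<^sup>+\<sigma>. ennreal (?K (\<xi>, \<sigma>) \<eta> * (norm (\<Phi> (\<xi>, \<eta>)))\<^sup>2) \<partial>lborel) = (\<integral>\<^sup>+\<sigma>. ennreal (halfline_exp (\<sigma> + (\<xi>\<^sup>2 + \<eta>\<^sup>2))) * ennreal ((norm (\<Phi> (\<xi>, \<eta>)))\<^sup>2) \<partial>lborel)"
        by (intro nn_integral_cong) (simp add: ennreal_mult halfline_exp_bounds add.assoc)
      also have "\<dots> = ennreal ((norm (\<Phi> (\<xi>, \<eta>)))\<^sup>2)"
        by (subst nn_integral_multc) (simp_all add: nn_integral_halfline_exp)
      finally show "(\<integral>\<^sup>+\<sigma>. ennreal (?K (\<xi>, \<sigma>) \<eta> * (norm (\<Phi> (\<xi>, \<eta>)))\<^sup>2) \<partial>lborel) = ennreal ((norm (\<Phi> (\<xi>, \<eta>)))\<^sup>2)" .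
    qed
    also have "\<dots> = ennreal ((L2_norm \<Phi>)\<^sup>2)"
      unfolding L2_nn_integral[OF \<Phi>, symmetric] by (rule nn_integral_lborel_pair[symmetric]) measurable
    also have "2 * ennreal ((L2_norm \<Phi>)\<^sup>2) = ennreal ((sqrt 2 * L2_norm \<Phi>)\<^sup>2)"
      by (simp add: power_mult_distrib ennreal_mult)
    finally show "(\<integral>\<^sup>+p. ennreal ((norm (H p))\<^sup>2) \<partial>lborel) \<le> ennreal ((sqrt 2 * L2_norm \<Phi>)\<^sup>2)" .
  qed simp
  obtain h where h: "h \<in> L2" "has_fourier h H" using L2_has_inverse_fourier[OF H] by blast
  have b: "(0, 1) \<in> (Basis :: (real \<times> real) set)" unfolding Basis_prod_def by simp
  have sec: "AE \<xi> in lborel. integrable lborel (\<lambda>\<eta>. \<Phi> (\<xi>, \<eta>))"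
  proof -
    have "integrable (lborel \<Otimes>\<^sub>M lborel) (\<lambda>\<zeta>. (norm (\<Phi> \<zeta>))\<^sup>2)"
      using L2_integrable_sq[OF \<Phi>] by (simp add: lborel_prod)
    from lborel_pair.AE_integrable_fst'[OF this] show ?thesis
    proof eventually_elim
      case (elim \<xi>)
      have "integrable lborel (\<lambda>\<eta>. indicator {-1..1::real} \<eta> + (norm (\<Phi> (\<xi>, \<eta>)))\<^sup>2)"
        using elim by (intro Bochner_Integration.integrable_add integrable_real_indicator) auto
      then show ?case
      proof (rule Bochner_Integration.integrable_bound)
        have "norm (\<Phi> (\<xi>, \<eta>)) \<le> norm (indicator {-1..1::real} \<eta> + (norm (\<Phi> (\<xi>, \<eta>)))\<^sup>2)" for \<eta>
        proof (cases "1 \<le> \<bar>\<eta>\<bar>")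
          case False
          have "2 * norm (\<Phi> (\<xi>, \<eta>)) \<le> (norm (\<Phi> (\<xi>, \<eta>)))\<^sup>2 + 1"
            using sum_squares_bound[of "norm (\<Phi> (\<xi>, \<eta>))" 1] by simp
          then have "norm (\<Phi> (\<xi>, \<eta>)) \<le> 1 + (norm (\<Phi> (\<xi>, \<eta>)))\<^sup>2" using norm_ge_zero[of "\<Phi> (\<xi>, \<eta>)"] by linarith
          moreover have "indicator {-1..1::real} \<eta> = (1::real)" using False by (simp add: indicator_def abs_if split: if_splits)
          ultimately show ?thesis by simp
        qed (simp add: lo)
        then show "AE \<eta> in lborel. norm (\<Phi> (\<xi>, \<eta>)) \<le> norm (indicator {-1..1::real} \<eta> + (norm (\<Phi> (\<xi>, \<eta>)))\<^sup>2)" by simp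
      qed measurable
    qed
  qed
  have pairing: "(LINT p|lborel. H p * (\<psi> p - pd (0, 1) \<psi> p)) = (LINT \<zeta>|lborel. \<Phi> \<zeta> * \<psi> (paraboloid \<zeta>))" if \<psi>: "\<psi> \<in> schwartz" for \<psi>
  proof -
    let ?q = "\<lambda>p. \<psi> p - pd (0, 1) \<psi> p"
    have q: "?q \<in> schwartz" by (intro schwartz_diff \<psi> schwartz_pd b)
    note [measurable] = schwartz_measurable[OF q] schwartz_measurable[OF \<psi>]
    obtain C where C: "0 \<le> C" "\<And>p. norm (?q p) \<le> C" using schwartz_bounded[OF q] by blast
    have "(LINT p|lborel. H p * ?q p) = (LINT \<xi>|lborel. LINT \<sigma>|lborel. H (\<xi>, \<sigma>) * ?q (\<xi>, \<sigma>))"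
      using lborel_pair.integral_fst'[of "\<lambda>p. H p * ?q p"] L2_Cauchy_Schwarz(1)[OF H schwartz_L2[OF q]]
      by (simp add: lborel_prod)
    also have "\<dots> = (LINT \<xi>|lborel. LINT \<eta>|lborel. \<Phi> (\<xi>, \<eta>) * \<psi> (paraboloid (\<xi>, \<eta>)))"
    proof (rule integral_cong_AE)
      show "(\<lambda>\<xi>. LINT \<sigma>|lborel. H (\<xi>, \<sigma>) * ?q (\<xi>, \<sigma>)) \<in> borel_measurable lborel"
        by (rule lborel.borel_measurable_lebesgue_integral) measurable
      show "(\<lambda>\<xi>. LINT \<eta>|lborel. \<Phi> (\<xi>, \<eta>) * \<psi> (paraboloid (\<xi>, \<eta>))) \<in> borel_measurable lborel"
        by (rule lborel.borel_measurable_lebesgue_integral) measurable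
      show "AE \<xi> in lborel. (LINT \<sigma>|lborel. H (\<xi>, \<sigma>) * ?q (\<xi>, \<sigma>)) = (LINT \<eta>|lborel. \<Phi> (\<xi>, \<eta>) * \<psi> (paraboloid (\<xi>, \<eta>)))"
        using sec
      proof eventually_elim
        case (elim \<xi>)
        let ?T = "\<lambda>\<eta> \<sigma>. \<Phi> (\<xi>, \<eta>) * (of_real (halfline_exp (\<sigma> + (\<xi>\<^sup>2 + \<eta>\<^sup>2))) * ?q (\<xi>, \<sigma>))"
        have int: "integrable (lborel \<Otimes>\<^sub>M lborel) (\<lambda>(\<eta>, \<sigma>). ?T \<eta> \<sigma>)"
        proof (rule lborel_pair.Fubini_integrable)
          show "(\<lambda>(\<eta>, \<sigma>). ?T \<eta> \<sigma>) \<in> borel_measurable (lborel \<Otimes>\<^sub>M lborel)" by measurable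
          show "AE \<eta> in lborel. integrable lborel (\<lambda>\<sigma>. case (\<eta>, \<sigma>) of (\<eta>, \<sigma>) \<Rightarrow> ?T \<eta> \<sigma>)"
            unfolding prod.case by (intro AE_I2 integrable_mult_right halfline_exp_fundamental(2) \<psi>)
          show "integrable lborel (\<lambda>\<eta>. LINT \<sigma>|lborel. norm (case (\<eta>, \<sigma>) of (\<eta>, \<sigma>) \<Rightarrow> ?T \<eta> \<sigma>))"
          proof (rule Bochner_Integration.integrable_bound)
            show "integrable lborel (\<lambda>\<eta>. norm (\<Phi> (\<xi>, \<eta>)) * C)" using elim by simp
            show "(\<lambda>\<eta>. LINT \<sigma>|lborel. norm (case (\<eta>, \<sigma>) of (\<eta>, \<sigma>) \<Rightarrow> ?T \<eta> \<sigma>)) \<in> borel_measurable lborel"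
              by (rule lborel.borel_measurable_lebesgue_integral) measurable
            have "norm (LINT \<sigma>|lborel. norm (?T \<eta> \<sigma>)) \<le> norm (norm (\<Phi> (\<xi>, \<eta>)) * C)" for \<eta>
            proof -
              let ?h = "\<lambda>\<sigma>. halfline_exp (\<sigma> + (\<xi>\<^sup>2 + \<eta>\<^sup>2))"
              have hi: "integrable lborel ?h"
                by (rule integrableI_nonneg) (auto simp: halfline_exp_bounds nn_integral_halfline_exp)
              have "ennreal (LINT \<sigma>|lborel. ?h \<sigma>) = ennreal 1"
                using nn_integral_eq_integral[OF hi] by (simp add: halfline_exp_bounds nn_integral_halfline_exp)
              then have h1: "(LINT \<sigma>|lborel. ?h \<sigma>) = 1"
                by (subst (asm) ennreal_inj) (auto intro!: integral_nonneg_AE simp: halfline_exp_bounds)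
              have "(LINT \<sigma>|lborel. norm (?T \<eta> \<sigma>)) \<le> (LINT \<sigma>|lborel. (norm (\<Phi> (\<xi>, \<eta>)) * C) * ?h \<sigma>)"
              proof (rule integral_mono)
                show "integrable lborel (\<lambda>\<sigma>. norm (?T \<eta> \<sigma>))"
                  by (intro integrable_norm integrable_mult_right halfline_exp_fundamental(2) \<psi>)
                show "integrable lborel (\<lambda>\<sigma>. (norm (\<Phi> (\<xi>, \<eta>)) * C) * ?h \<sigma>)" using hi by (rule integrable_mult_right)
                fix \<sigma>
                have "?h \<sigma> * norm (?q (\<xi>, \<sigma>)) \<le> ?h \<sigma> * C" by (intro mult_left_mono C halfline_exp_bounds)
                from mult_left_mono[OF this norm_ge_zero[of "\<Phi> (\<xi>, \<eta>)"]]
                show "norm (?T \<eta> \<sigma>) \<le> (norm (\<Phi> (\<xi>, \<eta>)) * C) * ?h \<sigma>"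
                  unfolding norm_mult norm_of_real abs_of_nonneg[OF halfline_exp_bounds(1)] by (simp only: mult_ac)
              qed
              also have "\<dots> = norm (\<Phi> (\<xi>, \<eta>)) * C" by (simp add: h1)
              finally show ?thesis using C(1) by simp
            qed
            then show "AE \<eta> in lborel. norm (LINT \<sigma>|lborel. norm (case (\<eta>, \<sigma>) of (\<eta>, \<sigma>) \<Rightarrow> ?T \<eta> \<sigma>)) \<le> norm (norm (\<Phi> (\<xi>, \<eta>)) * C)"
              unfolding prod.case by (rule AE_I2)
          qed
        qed
        have "H (\<xi>, \<sigma>) * ?q (\<xi>, \<sigma>) = (LINT \<eta>|lborel. ?T \<eta> \<sigma>)" for \<sigma>
          unfolding H_def integral_mult_left_zero[symmetric]
          by (intro Bochner_Integration.integral_cong refl) (simp add: add.assoc mult_ac)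
        then have "(LINT \<sigma>|lborel. H (\<xi>, \<sigma>) * ?q (\<xi>, \<sigma>)) = (LINT \<sigma>|lborel. LINT \<eta>|lborel. ?T \<eta> \<sigma>)" by simp
        also have "\<dots> = (LINT \<eta>|lborel. LINT \<sigma>|lborel. ?T \<eta> \<sigma>)"
          by (rule lborel_pair.Fubini_integral[OF int])
        also have "\<dots> = (LINT \<eta>|lborel. \<Phi> (\<xi>, \<eta>) * \<psi> (\<xi>, - (\<xi>\<^sup>2 + \<eta>\<^sup>2)))"
          unfolding integral_mult_right_zero halfline_exp_fundamental(1)[OF \<psi>] ..
        finally show ?case by (simp add: paraboloid_def norm_sq_Pair)
      qed
    qed
    also have "\<dots> = (LINT \<zeta>|lborel. \<Phi> \<zeta> * \<psi> (paraboloid \<zeta>))"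
      using lborel_pair.integral_fst'[of "\<lambda>\<zeta>. \<Phi> \<zeta> * \<psi> (paraboloid \<zeta>)"] paraboloid_pairing_integrable[OF \<Phi> \<psi>]
      by (simp add: lborel_prod)
    finally show ?thesis .
  qed
  show ?thesis
  proof (rule that)
    show "tempered_fun (\<lambda>z. (1 - \<i> * of_real (snd z)) * h z)"
    proof (rule tempered_mult[OF L2_imp_tempered[OF h(1)], where C = 1 and k = 1])
      fix z :: "real \<times> real"
      have "norm (1 - \<i> * complex_of_real (snd z)) \<le> 1 + norm (snd z)"
        using norm_triangle_ineq4[of 1 "\<i> * complex_of_real (snd z)"] by (simp add: norm_mult)
      also have "norm (snd z) \<le> norm z" by (metis norm_snd_le prod.collapse)
      finally show "norm (1 - \<i> * complex_of_real (snd z)) \<le> 1 * (1 + norm z) ^ 1" by simp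
    qed measurable
    fix \<psi> :: "real \<times> real \<Rightarrow> complex" assume \<psi>: "\<psi> \<in> schwartz"
    let ?q = "\<lambda>p. \<psi> p - pd (0, 1) \<psi> p"
    have q: "?q \<in> schwartz" by (intro schwartz_diff \<psi> schwartz_pd b)
    have "fourier_integral ?q z = (1 - \<i> * of_real (snd z)) * fourier_integral \<psi> z" for z
    proof -
      have "fourier_integral ?q z = fourier_integral \<psi> z - fourier_integral (pd (0, 1) \<psi>) z"
        unfolding fourier_integral_def
        using integrable_character[OF schwartz_integrable[OF \<psi>]] integrable_character[OF schwartz_integrable[OF schwartz_pd[OF \<psi> b]]]
        by (simp add: right_diff_distrib)
      also have "\<dots> = (1 - \<i> * of_real (snd z)) * fourier_integral \<psi> z"
        unfolding fourier_integral_pd[OF \<psi> b] by (simp add: inner_prod_def algebra_simps)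
      finally show ?thesis .
    qed
    then have "(LINT z|lborel. (1 - \<i> * of_real (snd z)) * h z * fourier_integral \<psi> z) = (LINT z|lborel. h z * fourier_integral ?q z)"
      by (simp add: mult_ac)
    also have "\<dots> = (LINT p|lborel. H p * ?q p)" by (rule has_fourierD(3)[OF h(2) q, symmetric])
    also have "\<dots> = (LINT \<zeta>|lborel. \<Phi> \<zeta> * \<psi> (paraboloid \<zeta>))" by (rule pairing[OF \<psi>])
    finally show "(LINT z|lborel. (1 - \<i> * of_real (snd z)) * h z * fourier_integral \<psi> z) = (LINT \<zeta>|lborel. \<Phi> \<zeta> * \<psi> (paraboloid \<zeta>))" .
  qed
qed

lemma trace_exists:
  assumes \<Phi>: "\<Phi> \<in> L2"
  obtains w where "tempered_fun w"
    "\<And>\<psi>. \<psi> \<in> schwartz \<Longrightarrow> (LINT z|lborel. w z * \<psi> z) = (LINT \<zeta>|lborel. \<Phi> \<zeta> * fourier_integral \<psi> (- paraboloid \<zeta>))"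
proof -
  let ?A = "{\<zeta> :: real \<times> real. 1 \<le> \<bar>snd \<zeta>\<bar>}"
  have [measurable]: "?A \<in> sets borel" by measurable
  let ?h = "\<lambda>\<zeta>. indicator ?A \<zeta> * \<Phi> \<zeta>" and ?l = "\<lambda>\<zeta>. indicator (- ?A) \<zeta> * \<Phi> \<zeta>"
  have h: "?h \<in> L2" by (rule L2_indicator[OF \<Phi>]) measurable
  have l: "?l \<in> L2" by (rule L2_indicator[OF \<Phi>]) measurable
  obtain u where u: "tempered_fun u"
    "\<And>\<psi>. \<psi> \<in> schwartz \<Longrightarrow> (LINT z|lborel. u z * fourier_integral \<psi> z) = (LINT \<zeta>|lborel. ?h \<zeta> * \<psi> (paraboloid \<zeta>))"
    using trace_exists_high[OF h] by (auto simp: indicator_def)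
  obtain v where v: "tempered_fun v"
    "\<And>\<psi>. \<psi> \<in> schwartz \<Longrightarrow> (LINT z|lborel. v z * fourier_integral \<psi> z) = (LINT \<zeta>|lborel. ?l \<zeta> * \<psi> (paraboloid \<zeta>))"
    using trace_exists_low[OF l] by (auto simp: indicator_def)
  show ?thesis
  proof (rule that)
    show "tempered_fun (\<lambda>z. 1 * u z + 1 * v z)" by (rule tempered_lincomb[OF u(1) v(1)])
    fix \<psi> :: "real \<times> real \<Rightarrow> complex" assume \<psi>: "\<psi> \<in> schwartz"
    obtain q where q: "q \<in> schwartz" "\<psi> = fourier_integral q" using schwartz_is_fourier_integral[OF \<psi>] by metis
    have "(LINT z|lborel. (1 * u z + 1 * v z) * \<psi> z) = (LINT z|lborel. u z * \<psi> z) + (LINT z|lborel. v z * \<psi> z)"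
      using schwartz_tempered_integrable[OF u(1) \<psi>] schwartz_tempered_integrable[OF v(1) \<psi>] by (simp add: distrib_right)
    also have "\<dots> = (LINT \<zeta>|lborel. ?h \<zeta> * q (paraboloid \<zeta>)) + (LINT \<zeta>|lborel. ?l \<zeta> * q (paraboloid \<zeta>))"
      unfolding q(2) u(2)[OF q(1)] v(2)[OF q(1)] ..
    also have "\<dots> = (LINT \<zeta>|lborel. ?h \<zeta> * q (paraboloid \<zeta>) + ?l \<zeta> * q (paraboloid \<zeta>))"
      by (rule Bochner_Integration.integral_add[symmetric]) (intro paraboloid_pairing_integrable h l q)+
    also have "\<dots> = (LINT \<zeta>|lborel. \<Phi> \<zeta> * fourier_integral \<psi> (- paraboloid \<zeta>))"
      unfolding q(2) schwartz_inversion[OF q(1)]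
      by (intro Bochner_Integration.integral_cong refl) (simp add: indicator_def)
    finally show "(LINT z|lborel. (1 * u z + 1 * v z) * \<psi> z) = (LINT \<zeta>|lborel. \<Phi> \<zeta> * fourier_integral \<psi> (- paraboloid \<zeta>))" .
  qed
qed

theorem lemma2p1:
  fixes s :: real
    and W :: "real \<Rightarrow> (real \<times> real \<Rightarrow> complex) \<Rightarrow> real \<times> real \<Rightarrow> complex"
  assumes "s \<ge> 0" and "schroedinger_group W"
  shows "\<exists>C>0. \<forall>\<phi>\<in>sobolev s.
    (\<exists>v\<^sub>b. has_trace (\<lambda>t. W t \<phi>) v\<^sub>b) \<and>
    (\<forall>v\<^sub>b. has_trace (\<lambda>t. W t \<phi>) v\<^sub>b \<longrightarrow>
       boundary_norm_finite s v\<^sub>b \<and> boundary_norm s v\<^sub>b \<le> C * sobolev_norm s \<phi>)"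
proof (rule exI[of _ "2 powr (s / 2)"], intro conjI ballI allI impI)
  show "0 < (2::real) powr (s / 2)" by simp
  fix \<phi> :: "real \<times> real \<Rightarrow> complex" assume \<phi>: "\<phi> \<in> sobolev s"
  then have \<phi>2: "\<phi> \<in> L2" by (simp add: sobolev_def)
  have \<Phi>: "fourier \<phi> \<in> L2" by (rule L2_fourier(2)[OF \<phi>2])
  note tr = has_trace_iff[OF assms(2) \<phi>2]
  show "\<exists>v\<^sub>b. has_trace (\<lambda>t. W t \<phi>) v\<^sub>b"
    using trace_exists[OF \<Phi>] unfolding tr by metis
  fix v\<^sub>b assume "has_trace (\<lambda>t. W t \<phi>) v\<^sub>b"
  then have "has_fourier v\<^sub>b (trace_density (fourier \<phi>))"
    unfolding tr by (intro has_fourier_trace_density \<Phi>) auto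
  from this boundary_norm_estimate[OF assms(1) \<phi> this]
  show "boundary_norm_finite s v\<^sub>b" "boundary_norm s v\<^sub>b \<le> 2 powr (s / 2) * sobolev_norm s \<phi>"
    unfolding boundary_norm_finite_def by blast+
qed

end
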